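(* Let $X,Y,Z,P$ be Asplund spaces, $K\subset Z$ a closed convex pointed cone with $\operatorname{int}K\ne\emptyset$, $g:X\times P\to Z$ a map, $H:X\times P\rightrightarrows Y$ a set-valued map with closed graph, and $S(p)=\{x\in X\mid 0\in H(x,p)\}$, $\operatorname{Gr}S=\{(p,x)\mid x\in S(p)\}$. Let $(\overline{x},\overline{p})\in X\times P$ and $L>0$. Suppose: (1) $g$ is $L$-strictly Lipschitz at $(\overline{x},\overline{p})$: $g$ is strictly Lipschitz at $(\overline{x},\overline{p})$ and $\|g(x,p)-g(u,q)\|\le L(\|x-u\|+\|p-q\|)$ for $(x,p),(u,q)$ in a neighborhood of $(\overline{x},\overline{p})$; (2) $(\overline{x},\overline{p})$ is a local weak solution of "minimize $g(x,p)$ subject to $0\in H(x,p)$": $0\in H(\overline{x},\overline{p})$ and there exist neighborhoods $U$ of $\overline{x}$, $W$ of $\overline{p}$ with $g(x,p)-g(\overline{x},\overline{p})\notin-\operatorname{int}K$ for all $(x,p)\in U\times W$ with $0\in H(x,p)$; (3) there exists $r>0$ such that $d((p,x),\operatorname{Gr}S)\le r\,d((x,p,0),\operatorname{Gr}H)$ for all $(x,p)$ in a neighborhood of $(\overline{x},\overline{p})$. Then for every $e\in\operatorname{int}K$ there exist $z^*\in K^*$ with $z^*(e)=1$ and $y^*\in Y^*$ such that \[ (0,0)\in\partial(z^*\circ g)(\overline{x},\overline{p})+D_N^*H((\overline{x},\overline{p}),0)(y^* ). \]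
   Context: Products carry the sum norm; $d(z,A)=\inf_{a\in A}\|z-a\|$, $d(z,\emptyset)=\infty$. $K^*=\{z^*\in Z^*\mid z^*(z)\ge0\ \forall z\in K\}$. A map $h:W\to Z$ is strictly Lipschitz at $\overline{w}$ if it is Lipschitz around $\overline{w}$ and there is a neighborhood $V_0$ of $0$ in $W$ such that $(t_k^{-1}(h(w_k+t_kv)-h(w_k)))_k$ has a norm convergent subsequence whenever $v\in V_0$, $w_k\to\overline{w}$, $t_k\downarrow0$. For $\Omega$ in an Asplund space and $\overline{x}\in\Omega$: Fréchet normal cone $\widehat N(\Omega,x)=\{x^*\mid\limsup_{u\to x,u\in\Omega}\frac{x^*(u-x)}{\|u-x\|}\le0\}$; limiting normal cone $N(\Omega,\overline{x})$ is the set of $w^*$-limits of $x_n^*\in\widehat N(\Omega,x_n)$ with $x_n\to\overline{x}$, $x_n\in\Omega$. Limiting subdifferential $\partial\varphi(\overline{x})=\{x^*\mid(x^*,-1)\in N(\operatorname{epi}\varphi,(\overline{x},\varphi(\overline{x})))\}$. Normal coderivative of $F$ at $(w,y)\in\operatorname{Gr}F$: $D_N^*F(w,y)(y^* )=\{w^*\mid(w^*,-y^* )\in N(\operatorname{Gr}F,(w,y))\}$. *)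

theory Defs
  imports "HOL-Analysis.Analysis"
begin

definition dual_on :: "'a::real_normed_vector set \<Rightarrow> ('a \<Rightarrow> real) set" where
  "dual_on V = {f. (\<forall>x\<in>V. \<forall>y\<in>V. f (x + y) = f x + f y) \<and>
                   (\<forall>c. \<forall>x\<in>V. f (c *\<^sub>R x) = c * f x) \<and>
                   (\<exists>B. \<forall>x\<in>V. \<bar>f x\<bar> \<le> B * norm x)}"

definition separable_set :: "'a::metric_space set \<Rightarrow> bool" where
  "separable_set V \<longleftrightarrow> (\<exists>D. countable D \<and> D \<subseteq> V \<and> V \<subseteq> closure D)"

definition separable_dual_on :: "'a::real_normed_vector set \<Rightarrow> bool" where
  "separable_dual_on V \<longleftrightarrow>
     (\<exists>F. countable F \<and> F \<subseteq> dual_on V \<and>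
        (\<forall>f\<in>dual_on V. \<forall>\<epsilon>>0. \<exists>g\<in>F. \<forall>x\<in>V. \<bar>f x - g x\<bar> \<le> \<epsilon> * norm x))"

definition asplund :: "'a::banach itself \<Rightarrow> bool" where
  "asplund _ \<longleftrightarrow> (\<forall>V::'a set. subspace V \<and> separable_set V \<longrightarrow> separable_dual_on V)"

definition frechet_normal :: "'a::real_normed_vector set \<Rightarrow> 'a \<Rightarrow> ('a \<Rightarrow> real) set" where
  "frechet_normal \<Omega> x = {f. bounded_linear f \<and>
     (\<forall>\<epsilon>>0. \<exists>\<delta>>0. \<forall>u\<in>\<Omega>. norm (u - x) < \<delta> \<longrightarrow> f (u - x) \<le> \<epsilon> * norm (u - x))}"

definition limiting_normal :: "'a::real_normed_vector set \<Rightarrow> 'a \<Rightarrow> ('a \<Rightarrow> real) set" where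
  "limiting_normal \<Omega> x = {f. bounded_linear f \<and>
     (\<exists>xs fs. (\<forall>n. xs n \<in> \<Omega> \<and> fs n \<in> frechet_normal \<Omega> (xs n)) \<and> xs \<longlonglongrightarrow> x \<and>
             (\<forall>u. (\<lambda>n. fs n u) \<longlonglongrightarrow> f u))}"

definition epigraph :: "('a \<Rightarrow> real) \<Rightarrow> ('a \<times> real) set" where
  "epigraph \<phi> = {(u, t). \<phi> u \<le> t}"

definition limiting_subdiff :: "('a::real_normed_vector \<Rightarrow> real) \<Rightarrow> 'a \<Rightarrow> ('a \<Rightarrow> real) set" where
  "limiting_subdiff \<phi> x = {f. bounded_linear f \<and>
     (\<lambda>(u, t). f u - t) \<in> limiting_normal (epigraph \<phi>) (x, \<phi> x)}"

definition graph_sv :: "('a \<Rightarrow> 'b set) \<Rightarrow> ('a \<times> 'b) set" where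
  "graph_sv F = {(w, y). y \<in> F w}"

definition coderiv :: "('a::real_normed_vector \<Rightarrow> 'b::real_normed_vector set) \<Rightarrow> 'a \<Rightarrow> 'b
                        \<Rightarrow> ('b \<Rightarrow> real) \<Rightarrow> ('a \<Rightarrow> real) set" where
  "coderiv F w y ys = {ws. bounded_linear ws \<and>
     (\<lambda>(u, v). ws u - ys v) \<in> limiting_normal (graph_sv F) (w, y)}"

definition dual_cone :: "'a::real_normed_vector set \<Rightarrow> ('a \<Rightarrow> real) set" where
  "dual_cone K = {zs. bounded_linear zs \<and> (\<forall>z\<in>K. zs z \<ge> 0)}"

definition lipschitz_around :: "('a::real_normed_vector \<Rightarrow> 'b::real_normed_vector) \<Rightarrow> 'a \<Rightarrow> bool" where
  "lipschitz_around h w0 \<longleftrightarrow> (\<exists>N C. open N \<and> w0 \<in> N \<and>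
       (\<forall>w\<in>N. \<forall>w'\<in>N. norm (h w - h w') \<le> C * norm (w - w')))"

definition strictly_lipschitz_at :: "('a::real_normed_vector \<Rightarrow> 'b::real_normed_vector) \<Rightarrow> 'a \<Rightarrow> bool" where
  "strictly_lipschitz_at h w0 \<longleftrightarrow> lipschitz_around h w0 \<and>
     (\<exists>V0. open V0 \<and> 0 \<in> V0 \<and>
        (\<forall>v\<in>V0. \<forall>ws ts. ws \<longlonglongrightarrow> w0 \<and> (\<forall>k. ts k > 0) \<and> ts \<longlonglongrightarrow> 0 \<longrightarrow>
           (\<exists>\<sigma>. strict_mono \<sigma> \<and>
              convergent (\<lambda>k. (1 / ts (\<sigma> k)) *\<^sub>R (h (ws (\<sigma> k) + ts (\<sigma> k) *\<^sub>R v) - h (ws (\<sigma> k)))))))"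

definition dist_S :: "('x::real_normed_vector \<times> 'p::real_normed_vector \<Rightarrow> 'y::real_normed_vector set)
                      \<Rightarrow> 'p \<Rightarrow> 'x \<Rightarrow> ereal" where
  "dist_S H p x = (INF qu \<in> {(q, u). 0 \<in> H (u, q)}. ereal (norm (p - fst qu) + norm (x - snd qu)))"

definition dist_GrH :: "('x::real_normed_vector \<times> 'p::real_normed_vector \<Rightarrow> 'y::real_normed_vector set)
                      \<Rightarrow> 'x \<Rightarrow> 'p \<Rightarrow> 'y \<Rightarrow> ereal" where
  "dist_GrH H x p y = (INF w \<in> graph_sv H.
       ereal (norm (x - fst (fst w)) + norm (p - snd (fst w)) + norm (y - snd w)))"

end

theory Submission
  imports Defs "HOL-Library.Diagonal_Subsequence"
begin

text \<open>
  With the gauge \<open>s(z) = inf {t. t e - z \<in> K}\<close> and the calmness condition (3), the point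
  \<open>((w0, g w0), (w0, 0))\<close>, \<open>w0 = (xb, pb)\<close>, is a local minimum over \<open>graph g \<times> Gr H\<close> of a translate of the sublinear function
  \<open>((w, z), (w', v)) \<mapsto> s z + M * norm v + M' * norm (w - w')\<close>.
  The central tool (\<open>fuzzy_minimum\<close>) produces, for a local minimum of a translated sublinear function \<open>s\<close> over a closed set
  of an Asplund space, nearby points with Frechet normals \<open>b\<close> such that \<open>- b \<le> s + \<epsilon> norm\<close>. In a separable subspace
  with separable dual it follows from a smooth approximation of \<open>s\<close> and the Borwein-Preiss variational principle; the
  general case is reduced to this one by a Hahn-Banach characterisation of the existence of \<open>b\<close>.
  Bounded sequences of functionals on an Asplund space have weakly* convergent subsequences, so the normals
  converge, and the graph component is turned into a limiting subgradient of \<open>z* \<circ> g\<close> by a fuzzy sum rule and the strict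
  Lipschitz property of \<open>g\<close>.
\<close>

section \<open>Hahn-Banach theorems\<close>

text \<open>Two obstacles shape the proof. Weak* limits of normals in infinite dimensions may
  vanish, and no normal compactness is assumed. The domination
  \<open>- b \<le> s + \<epsilon> norm\<close> settles this: it bounds the normals, survives the
  limit, and yields the multiplier rules. Evaluated at \<open>e\<close> and \<open>- e\<close>,
  where the gauge is at most 1 and -1, it normalises the multiplier; evaluated where both copies of
  \<open>w\<close> move together, so that the penalty on their distance is zero, it makes the two
  horizontal components cancel. As the copies are coupled only by this penalty, no qualification
  condition for intersecting the two graphs arises.

  The second obstacle is smoothness. An Asplund space need not admit a Frechet smooth norm; the
  definition only provides separable duals of separable subspaces. So smooth functions are built
  relative to one separable subspace, and a normal found there is tested only by points of that
  subspace. An extension of this functional need not be normal to all of \<Omega>; instead the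
  existence of a normal is expressed by finite systems of inequalities, from which a new functional
  is obtained.\<close>

definition sublin :: "('a::real_vector \<Rightarrow> real) \<Rightarrow> bool" where
  "sublin s \<longleftrightarrow> (\<forall>x y. s (x + y) \<le> s x + s y) \<and> (\<forall>c x. c > 0 \<longrightarrow> s (c *\<^sub>R x) = c * s x)"

lemma sublin_add: "sublin s \<Longrightarrow> s (x + y) \<le> s x + s y"
  and sublin_scale_pos: "sublin s \<Longrightarrow> c > 0 \<Longrightarrow> s (c *\<^sub>R x) = c * s x"
  by (auto simp: sublin_def)

lemma sublin_0: "sublin s \<Longrightarrow> s 0 = 0"
  using sublin_scale_pos[of s 2 0] by simp

lemma sublin_scale: "sublin s \<Longrightarrow> c \<ge> 0 \<Longrightarrow> s (c *\<^sub>R x) = c * s x"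
  by (cases "c = 0") (auto simp: sublin_0 sublin_scale_pos)

lemma sublin_neg: "sublin s \<Longrightarrow> - s (- x) \<le> s x"
  using sublin_add[of s x "-x"] sublin_0[of s] by simp

lemma sublin_diff: "sublin s \<Longrightarrow> s x - s y \<le> s (x - y)"
  using sublin_add[of s "x - y" y] by simp

text \<open>This covers infima over chains, infimal convolutions with a ray or a cone, and the gauge
  of \<open>K\<close>. \<open>add\<close> asks only for some smaller element of
  \<open>R (x + y)\<close>: in a chain, values of two different functions need not add up to a value
  of either, but the smaller function stays below their sum. The bound \<open>b\<close> makes the
  infima finite.\<close>

lemma sublin_Inf:
  fixes R :: "'a::real_vector \<Rightarrow> real set"
  assumes ne: "\<And>x. R x \<noteq> {}" and bd: "\<And>x t. t \<in> R x \<Longrightarrow> b x \<le> t"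
    and add: "\<And>x y t t'. t \<in> R x \<Longrightarrow> t' \<in> R y \<Longrightarrow> \<exists>r\<in>R (x + y). r \<le> t + t'"
    and sc: "\<And>x c t. c > 0 \<Longrightarrow> t \<in> R x \<Longrightarrow> c * t \<in> R (c *\<^sub>R x)"
  shows "sublin (\<lambda>x. Inf (R x))"
proof -
  have bb: "bdd_below (R x)" for x using bd by (auto simp: bdd_below_def)
  have le: "Inf (R x) \<le> t" if "t \<in> R x" for x t using that bb by (rule cInf_lower)
  have A: "Inf (R (x + y)) \<le> Inf (R x) + Inf (R y)" for x y
  proof -
    have "Inf (R (x + y)) - t \<le> Inf (R y)" if t: "t \<in> R x" for t
    proof (rule cInf_greatest[OF ne])
      fix t' assume "t' \<in> R y"
      then obtain r where "r \<in> R (x+y)" "r \<le> t + t'" using add t by blast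
      then show "Inf (R (x + y)) - t \<le> t'" using le[of r "x+y"] by simp
    qed
    then have "Inf (R (x + y)) - Inf (R y) \<le> t" if "t \<in> R x" for t using that by fastforce
    then have "Inf (R (x + y)) - Inf (R y) \<le> Inf (R x)" by (intro cInf_greatest ne) auto
    then show ?thesis by simp
  qed
  have B: "Inf (R (c *\<^sub>R x)) \<le> c * Inf (R x)" if c: "c > 0" for c x
  proof -
    have "Inf (R (c *\<^sub>R x)) / c \<le> Inf (R x)"
    proof (rule cInf_greatest[OF ne])
      fix t assume "t \<in> R x"
      then show "Inf (R (c *\<^sub>R x)) / c \<le> t"
        using le[OF sc[OF c, of t x]] c by (simp add: pos_divide_le_eq mult.commute)
    qed
    then show ?thesis using c by (simp add: pos_divide_le_eq mult.commute)
  qed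
  have "Inf (R (c *\<^sub>R x)) = c * Inf (R x)" if c: "c > 0" for c x
    using B[OF c, of x] B[of "1/c" "c *\<^sub>R x"] c by (simp add: field_simps)
  then show ?thesis using A by (auto simp: sublin_def)
qed

text \<open>Zorn's lemma for the reversed pointwise order. The pointwise infimum bounds a nonempty
  chain; it is finite because every sublinear \<open>q \<le> s\<close> satisfies
  \<open>q x \<ge> - q (- x) \<ge> - s (- x)\<close>.\<close>

lemma sublin_minimal:
  assumes s: "sublin s"
  shows "\<exists>q. sublin q \<and> q \<le> s \<and> (\<forall>q'. sublin q' \<and> q' \<le> q \<longrightarrow> q' = q)"
proof -
  let ?A = "{q. sublin q \<and> q \<le> s}"
  let ?P = "\<lambda>q q'. q' \<le> (q :: 'a \<Rightarrow> real)"
  have "\<exists>m\<in>?A. \<forall>a\<in>?A. ?P m a \<longrightarrow> a = m"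
  proof (rule predicate_Zorn)
    show "partial_order_on ?A (relation_of ?P ?A)"
      by (rule partial_order_on_relation_ofI) auto
    fix C assume C: "C \<in> Chains (relation_of ?P ?A)"
    then have CA: "C \<subseteq> ?A" and tot: "\<And>p q. p \<in> C \<Longrightarrow> q \<in> C \<Longrightarrow> p \<le> q \<or> q \<le> p"
      by (auto simp: Chains_def relation_of_def)
    show "\<exists>u\<in>?A. \<forall>a\<in>C. ?P a u"
    proof (cases "C = {}")
      case True then show ?thesis using s by auto
    next
      case False
      let ?R = "\<lambda>x. (\<lambda>q. q x) ` C"
      have bd: "- s (- x) \<le> t" if "t \<in> ?R x" for x t
      proof -
        from that obtain q where q: "q \<in> C" "t = q x" by auto
        then have "sublin q" "q (- x) \<le> s (- x)" using CA by (auto simp: le_fun_def)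
        then show ?thesis using sublin_neg[of q x] q by simp
      qed
      have "sublin (\<lambda>x. Inf (?R x))"
      proof (rule sublin_Inf[of ?R "\<lambda>x. - s (- x)"])
        show "?R x \<noteq> {}" for x using False by auto
        show "- s (- x) \<le> t" if "t \<in> ?R x" for x t using bd that .
        fix x y t t' assume "t \<in> ?R x" "t' \<in> ?R y"
        then obtain p q where p: "p \<in> C" "t = p x" and q: "q \<in> C" "t' = q y" by auto
        then have sl: "sublin p" "sublin q" using CA by auto
        from tot[OF p(1) q(1)] show "\<exists>r\<in>?R (x + y). r \<le> t + t'"
        proof
          assume "p \<le> q"
          then have "p (x + y) \<le> t + t'" using sublin_add[OF sl(1), of x y] p q by (smt (verit) le_funD)
          then show ?thesis using p by blast
        next
          assume "q \<le> p"
          then have "q (x + y) \<le> t + t'" using sublin_add[OF sl(2), of x y] p q by (smt (verit) le_funD)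
          then show ?thesis using q by blast
        qed
      next
        fix x c t assume "(c::real) > 0" "t \<in> ?R x"
        then obtain q where "q \<in> C" "t = q x" "sublin q" using CA by auto
        then show "c * t \<in> ?R (c *\<^sub>R x)" using sublin_scale_pos[of q c x] \<open>c > 0\<close>
          by (intro image_eqI[of _ _ q]) auto
      qed
      moreover have lb: "(\<lambda>x. Inf (?R x)) \<le> a" if "a \<in> C" for a
        using that by (auto simp: le_fun_def intro!: cInf_lower bdd_belowI bd)
      moreover have "(\<lambda>x. Inf (?R x)) \<le> s"
        using False lb CA by (metis (no_types, lifting) ex_in_conv mem_Collect_eq order_trans subset_iff)
      ultimately show ?thesis by blast
    qed
  qed
  then show ?thesis by (metis (mono_tags, lifting) mem_Collect_eq order_trans)
qed

text \<open>A minimal sublinear functional is linear.\<close>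

lemma ex_linear_below_sublin:
  fixes s :: "'a::real_vector \<Rightarrow> real"
  assumes s: "sublin s"
  shows "\<exists>F. linear F \<and> (\<forall>x. F x \<le> s x)"
proof -
  obtain q where q: "sublin q" "q \<le> s" and min: "\<And>q'. sublin q' \<Longrightarrow> q' \<le> q \<Longrightarrow> q' = q"
    using sublin_minimal[OF s] by blast
  have sup: "q x + q y \<le> q (x + y)" for x y
  proof -
    \<comment> \<open>The infimum over \<open>t\<close> is sublinear and, by \<open>t = 0\<close>,
      at most \<open>q\<close>, hence equal to \<open>q\<close> by minimality; \<open>t = 1\<close>
      then gives superadditivity.\<close>
    let ?R = "\<lambda>x. (\<lambda>t. q (x + t *\<^sub>R y) - t * q y) ` {0..}"
    have bd: "- q (- x) \<le> r" if "r \<in> ?R x" for x r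
    proof -
      from that obtain t where t: "t \<ge> 0" "r = q (x + t *\<^sub>R y) - t * q y" by auto
      have "q (t *\<^sub>R y) \<le> q (x + t *\<^sub>R y) + q (- x)"
        using sublin_add[OF q(1), of "x + t *\<^sub>R y" "-x"] by simp
      then show ?thesis using t sublin_scale[OF q(1)] by auto
    qed
    have bb: "bdd_below (?R x)" for x by (rule bdd_belowI[OF bd])
    have "sublin (\<lambda>x. Inf (?R x))"
    proof (rule sublin_Inf[of ?R "\<lambda>x. - q (- x)"])
      show "- q (- x) \<le> t" if "t \<in> ?R x" for x t using bd that .
      fix x x' r r' assume "r \<in> ?R x" "r' \<in> ?R x'"
      then obtain t t' where t: "t \<ge> 0" "r = q (x + t *\<^sub>R y) - t * q y"
        and t': "t' \<ge> 0" "r' = q (x' + t' *\<^sub>R y) - t' * q y" by auto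
      have "q (x + x' + (t + t') *\<^sub>R y) - (t + t') * q y \<le> r + r'"
        using sublin_add[OF q(1), of "x + t *\<^sub>R y" "x' + t' *\<^sub>R y"] t t'
        by (simp add: algebra_simps)
      then show "\<exists>r''\<in>?R (x + x'). r'' \<le> r + r'" using t t' by (intro bexI) auto
    next
      fix x c r assume c: "(c::real) > 0" "r \<in> ?R x"
      then obtain t where t: "t \<ge> 0" "r = q (x + t *\<^sub>R y) - t * q y" by auto
      have "c * r = q (c *\<^sub>R x + (c * t) *\<^sub>R y) - (c * t) * q y"
        using sublin_scale_pos[OF q(1) c(1), of "x + t *\<^sub>R y"] unfolding t(2)
        by (simp add: algebra_simps)
      then show "c * r \<in> ?R (c *\<^sub>R x)" using c t by (intro image_eqI[of _ _ "c * t"]) auto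
    qed auto
    moreover have le: "Inf (?R x) \<le> q x" for x
      using cInf_lower[OF _ bb, of "q x" x] by (force intro: image_eqI[of _ _ 0])
    ultimately have eq: "(\<lambda>x. Inf (?R x)) = q" by (intro min) (auto simp: le_fun_def)
    have "Inf (?R x) \<le> q (x + y) - q y"
      by (rule cInf_lower[OF _ bb]) (auto intro!: image_eqI[of _ _ 1])
    then show ?thesis using fun_cong[OF eq, of x] by simp
  qed
  have add: "q (x + y) = q x + q y" for x y using sup[of x y] sublin_add[OF q(1), of x y] by simp
  have neg: "q (- x) = - q x" for x using add[of x "-x"] sublin_0[OF q(1)] by simp
  have "q (c *\<^sub>R x) = c * q x" for c x
  proof (cases "c \<ge> 0")
    case True then show ?thesis using sublin_scale[OF q(1)] by simp
  next
    case False
    then have "q ((- c) *\<^sub>R x) = (- c) * q x" by (intro sublin_scale[OF q(1)]) simp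
    then show ?thesis using neg[of "c *\<^sub>R x"] by simp
  qed
  then have "linear q" using add by (intro linearI) auto
  then show ?thesis using q(2) by (auto simp: le_fun_def)
qed

lemma bounded_linear_below:
  fixes F :: "'a::real_normed_vector \<Rightarrow> real"
  assumes F: "linear F" and le: "\<And>x. F x \<le> M * norm x"
  shows "bounded_linear F" "\<bar>F x\<bar> \<le> M * norm x"
proof -
  show *: "\<bar>F x\<bar> \<le> M * norm x" for x
    using le[of x] le[of "-x"] linear_neg[OF F, of x] by auto
  show "bounded_linear F"
    using F * by (intro bounded_linear.intro bounded_linear_axioms.intro)
      (auto simp: real_norm_def mult.commute intro!: exI[of _ M])
qed

lemma sublin_norm: "M \<ge> 0 \<Longrightarrow> sublin (\<lambda>x::'a::real_normed_vector. M * norm x)"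
  by (auto simp: sublin_def distrib_left[symmetric] norm_triangle_ineq mult_left_mono)

section \<open>Systems of linear inequalities under a sublinear bound\<close>

text \<open>Lists turn sums of combinations into concatenations and multiples into maps, and one
  list is a witness involving finitely many indices.\<close>

definition cone_sum :: "('i \<Rightarrow> 'a::real_vector) \<Rightarrow> (real \<times> 'i) list \<Rightarrow> 'a" where
  "cone_sum \<alpha> T = (\<Sum>(l, i)\<leftarrow>T. l *\<^sub>R \<alpha> i)"

definition in_cone :: "'i set \<Rightarrow> (real \<times> 'i) list \<Rightarrow> bool" where
  "in_cone A T \<longleftrightarrow> (\<forall>(l, i)\<in>set T. l \<ge> 0 \<and> i \<in> A)"

lemma in_cone_simps [simp]: "in_cone A []" "in_cone A ((l, i) # T) \<longleftrightarrow> l \<ge> 0 \<and> i \<in> A \<and> in_cone A T"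
    "in_cone A (T @ T') \<longleftrightarrow> in_cone A T \<and> in_cone A T'"
  by (auto simp: in_cone_def)

lemma cone_sum_simps [simp]: "cone_sum \<alpha> [] = 0" "cone_sum \<alpha> ((l, i) # T) = l *\<^sub>R \<alpha> i + cone_sum \<alpha> T"
    "cone_sum \<alpha> (T @ T') = cone_sum \<alpha> T + cone_sum \<alpha> T'"
  by (simp_all add: cone_sum_def)

lemma cone_sum_scale: "cone_sum \<alpha> (map (\<lambda>(l, i). (c * l, i)) T) = c *\<^sub>R cone_sum \<alpha> T"
  by (induction T) (auto simp: algebra_simps)

lemma in_cone_scale: "c \<ge> 0 \<Longrightarrow> in_cone A T \<Longrightarrow> in_cone A (map (\<lambda>(l, i). (c * l, i)) T)"
  by (auto simp: in_cone_def)

text \<open>A theorem of the alternative: \<open>pos\<close> is also necessary, since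
  \<open>cone_sum \<rho> T\<close> is at least \<open>b\<close> of the combined vector, hence at
  least \<open>- s\<close> of it. A linear \<open>F\<close> below the infimal convolution of
  \<open>s\<close> with the constraints does the job as \<open>- b\<close>: the empty list gives
  \<open>F \<le> s\<close>, the list \<open>[(1, i)]\<close> gives the constraint
  \<open>i\<close>.\<close>

lemma ex_linear_cone_constraints:
  fixes s :: "'a::real_vector \<Rightarrow> real" and \<alpha> :: "'i \<Rightarrow> 'a" and \<rho> :: "'i \<Rightarrow> real"
  assumes s: "sublin s" and pos: "\<And>T. in_cone A T \<Longrightarrow> cone_sum \<rho> T + s (cone_sum \<alpha> T) \<ge> 0"
  shows "\<exists>b. linear b \<and> (\<forall>x. - b x \<le> s x) \<and> (\<forall>i\<in>A. b (\<alpha> i) \<le> \<rho> i)"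
proof -
  let ?R = "\<lambda>x. (\<lambda>T. cone_sum \<rho> T + s (x + cone_sum \<alpha> T)) ` Collect (in_cone A)"
  have bd: "- s (- x) \<le> t" if "t \<in> ?R x" for x t
  proof -
    from that obtain T where T: "in_cone A T" "t = cone_sum \<rho> T + s (x + cone_sum \<alpha> T)" by auto
    have "s (cone_sum \<alpha> T) \<le> s (x + cone_sum \<alpha> T) + s (- x)"
      using sublin_add[OF s, of "x + cone_sum \<alpha> T" "-x"] by simp
    then show ?thesis using T pos[of T] by simp
  qed
  have bb: "bdd_below (?R x)" for x by (rule bdd_belowI[OF bd])
  have sl: "sublin (\<lambda>x. Inf (?R x))"
  proof (rule sublin_Inf[of ?R "\<lambda>x. - s (- x)"])
    show "?R x \<noteq> {}" for x by (auto intro!: exI[of _ "[]"])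
    show "- s (- x) \<le> t" if "t \<in> ?R x" for x t using bd that .
    fix x x' r r' assume "r \<in> ?R x" "r' \<in> ?R x'"
    then obtain T T' where T: "in_cone A T" "r = cone_sum \<rho> T + s (x + cone_sum \<alpha> T)"
      and T': "in_cone A T'" "r' = cone_sum \<rho> T' + s (x' + cone_sum \<alpha> T')" by auto
    have "cone_sum \<rho> (T @ T') + s (x + x' + cone_sum \<alpha> (T @ T')) \<le> r + r'"
      using sublin_add[OF s, of "x + cone_sum \<alpha> T" "x' + cone_sum \<alpha> T'"] T T'
      by (simp add: algebra_simps)
    moreover have "in_cone A (T @ T')" using T T' by simp
    ultimately show "\<exists>r''\<in>?R (x + x'). r'' \<le> r + r'" by blast
  next
    fix x c r assume c: "(c::real) > 0" "r \<in> ?R x"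
    then obtain T where T: "in_cone A T" "r = cone_sum \<rho> T + s (x + cone_sum \<alpha> T)" by auto
    let ?T = "map (\<lambda>(l, i). (c * l, i)) T"
    have "c * r = cone_sum \<rho> ?T + s (c *\<^sub>R x + cone_sum \<alpha> ?T)"
      using sublin_scale_pos[OF s c(1), of "x + cone_sum \<alpha> T"] T
      unfolding cone_sum_scale by (simp add: algebra_simps)
    moreover have "in_cone A ?T" using T c by (intro in_cone_scale) auto
    ultimately show "c * r \<in> ?R (c *\<^sub>R x)" by blast
  qed
  obtain F where F: "linear F" "\<And>x. F x \<le> Inf (?R x)" using ex_linear_below_sublin[OF sl] by blast
  have 1: "F x \<le> s x" for x
  proof -
    have "Inf (?R x) \<le> s x" by (rule cInf_lower[OF _ bb]) (auto intro!: image_eqI[of _ _ "[]"])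
    then show ?thesis using F(2)[of x] by simp
  qed
  have 2: "F (- \<alpha> i) \<le> \<rho> i" if "i \<in> A" for i
  proof -
    have "Inf (?R (- \<alpha> i)) \<le> \<rho> i"
      by (rule cInf_lower[OF _ bb]) (use that sublin_0[OF s] in \<open>auto intro!: image_eqI[of _ _ "[(1, i)]"]\<close>)
    then show ?thesis using F(2)[of "- \<alpha> i"] by simp
  qed
  show ?thesis using F(1) 1 2 linear_neg[OF F(1)]
    by (intro exI[of _ "\<lambda>x. - F x"]) (auto intro: linear_compose_neg)
qed

text \<open>The one-sided constraints \<open>b v \<le> - f v\<close> for all \<open>v\<close> in
  \<open>V\<close> become equalities because \<open>V\<close> contains \<open>- v\<close>.\<close>

lemma hahn_banach_extension:
  fixes s :: "'a::real_vector \<Rightarrow> real"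
  assumes s: "sublin s" and V: "subspace V"
    and fa: "\<And>x y. x \<in> V \<Longrightarrow> y \<in> V \<Longrightarrow> f (x + y) = f x + f y"
    and fs: "\<And>c x. x \<in> V \<Longrightarrow> f (c *\<^sub>R x) = c * f x"
    and le: "\<And>x. x \<in> V \<Longrightarrow> f x \<le> s x"
  shows "\<exists>F. linear F \<and> (\<forall>x. F x \<le> s x) \<and> (\<forall>x\<in>V. F x = f x)"
proof -
  have f0: "f 0 = 0" using fs[of 0 0] V by (simp add: subspace_0)
  have T: "cone_sum (\<lambda>v. v) T \<in> V \<and> cone_sum (\<lambda>v. - f v) T = - f (cone_sum (\<lambda>v. v) T)" if "in_cone V T" for T
    using that
  proof (induction T)
    case Nil then show ?case using V f0 by (simp add: subspace_0)
  next
    case (Cons t T)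
    then show ?case using V fa fs by (cases t) (auto simp: subspace_add subspace_scale)
  qed
  have "cone_sum (\<lambda>v. - f v) T + s (cone_sum (\<lambda>v. v) T) \<ge> 0" if "in_cone V T" for T
    using T[OF that] le by auto
  from ex_linear_cone_constraints[where A = V, OF s this]
  obtain b where b: "linear b" "\<forall>x. - b x \<le> s x" "\<forall>v\<in>V. b v \<le> - f v" by auto
  have "- b v = f v" if v: "v \<in> V" for v
  proof -
    have "b (- v) \<le> - f ((-1) *\<^sub>R v)" using b(3) v V subspace_neg by fastforce
    then show ?thesis using b(3) v fs[OF v, of "-1"] linear_neg[OF b(1), of v] by force
  qed
  then show ?thesis using b by (intro exI[of _ "\<lambda>x. - b x"]) (auto intro: linear_compose_neg)
qed

text \<open>A single constraint at \<open>x\<close> with right-hand side \<open>- s x\<close>; its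
  cone is a ray, on which \<open>s\<close> is linear.\<close>

lemma support_functional:
  fixes s :: "'a::real_vector \<Rightarrow> real"
  assumes s: "sublin s"
  shows "\<exists>F. linear F \<and> (\<forall>x. F x \<le> s x) \<and> F x = s x"
proof -
  have T: "\<exists>c\<ge>0. cone_sum (\<lambda>v. v) T = c *\<^sub>R x \<and> cone_sum (\<lambda>v. - s v) T = - c * s x" if "in_cone {x} T" for T
    using that
  proof (induction T)
    case (Cons t T)
    then obtain l c where "t = (l, x)" "l \<ge> 0" "c \<ge> 0"
      "cone_sum (\<lambda>v. v) T = c *\<^sub>R x" "cone_sum (\<lambda>v. - s v) T = - c * s x" by (cases t) auto
    then show ?case by (intro exI[of _ "l + c"]) (auto simp: algebra_simps)
  qed auto
  have "cone_sum (\<lambda>v. - s v) T + s (cone_sum (\<lambda>v. v) T) \<ge> 0" if "in_cone {x} T" for T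
    using T[OF that] sublin_scale[OF s] by auto
  from ex_linear_cone_constraints[where A = "{x}", OF s this]
  obtain b where b: "linear b" "\<forall>y. - b y \<le> s y" "b x \<le> - s x" by auto
  then show ?thesis
    by (intro exI[of _ "\<lambda>x. - b x"]) (auto intro!: linear_compose_neg antisym)
qed

text \<open>Elements of \<open>dual_on V\<close> are arbitrary outside \<open>V\<close>; this
  replaces them by functionals on the whole space.\<close>

lemma dual_on_extend:
  assumes V: "subspace V" and f: "f \<in> dual_on V"
  shows "\<exists>F. bounded_linear F \<and> (\<forall>x\<in>V. F x = f x)"
proof -
  obtain B where B: "\<forall>x\<in>V. \<bar>f x\<bar> \<le> B * norm x" using f by (auto simp: dual_on_def)
  have B': "f x \<le> max B 0 * norm x" if "x \<in> V" for x
  proof -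
    have "f x \<le> B * norm x" using B that by (smt (verit) abs_le_D1)
    also have "\<dots> \<le> max B 0 * norm x" by (intro mult_right_mono) auto
    finally show ?thesis .
  qed
  obtain F where "linear F" "\<forall>x. F x \<le> max B 0 * norm x" "\<forall>x\<in>V. F x = f x"
    using hahn_banach_extension[OF sublin_norm[of "max B 0"] V _ _ B'] f by (auto simp: dual_on_def)
  then show ?thesis using bounded_linear_below(1)[of F "max B 0"] by blast
qed

section \<open>Asplund spaces\<close>

lemma diagonal_convergent:
  fixes a :: "nat \<Rightarrow> nat \<Rightarrow> real"
  assumes bd: "\<And>k. bounded (range (a k))"
  shows "\<exists>\<sigma>. strict_mono \<sigma> \<and> (\<forall>k. convergent (\<lambda>n. a k (\<sigma> n)))"
proof -
  interpret subseqs "\<lambda>k \<sigma>. convergent (\<lambda>n. a k (\<sigma> n))"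
  proof
    fix k and s :: "nat \<Rightarrow> nat"
    have "bounded (range (a k \<circ> s))" using bd[of k] by (rule bounded_subset) auto
    then obtain l r where "strict_mono r" "((a k \<circ> s) \<circ> r) \<longlonglongrightarrow> l"
      using bounded_imp_convergent_subsequence by blast
    then show "\<exists>r'. strict_mono r' \<and> convergent (\<lambda>n. a k ((s \<circ> r') n))"
      by (auto simp: convergent_def o_def)
  qed
  have "convergent (\<lambda>n. a k (diagseq n))" for k
  proof -
    \<comment> \<open>Only from index \<open>Suc k\<close> on is the diagonal sequence a subsequence
      of the one selected for \<open>a k\<close>.\<close>
    have "convergent (\<lambda>n. a k ((diagseq \<circ> (+) (Suc k)) n))"
    proof (rule diagseq_holds)
      fix r s :: "nat \<Rightarrow> nat" and n
      assume "strict_mono r" "convergent (\<lambda>m. a n (s m))"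
      then show "convergent (\<lambda>m. a n ((s \<circ> r) m))"
        using convergent_subseq_convergent[of "\<lambda>m. a n (s m)" r] by (simp add: o_def)
    qed
    then have "convergent (\<lambda>n. a k (diagseq (n + Suc k)))" by (simp add: o_def add.commute)
    then show ?thesis by (subst (asm) convergent_ignore_initial_segment)
  qed
  then show ?thesis using subseq_diagseq by blast
qed

lemma pointwise_convergent_closure:
  fixes f :: "nat \<Rightarrow> 'a::real_normed_vector \<Rightarrow> real"
  assumes lin: "\<And>n. linear (f n)" and B: "\<And>n x. \<bar>f n x\<bar> \<le> B * norm x"
    and D: "\<And>d. d \<in> D \<Longrightarrow> convergent (\<lambda>n. f n d)" and x: "x \<in> closure D"
  shows "convergent (\<lambda>n. f n x)"
proof -
  have "Cauchy (\<lambda>n. f n x)"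
  proof (rule CauchyI)
    fix e :: real assume e: "e > 0"
    define C where "C = max B 1"
    have C: "C > 0" "\<And>n x. \<bar>f n x\<bar> \<le> C * norm x"
      using B by (auto simp: C_def) (smt (verit, best) mult_right_mono norm_ge_zero)
    obtain d where d: "d \<in> D" "dist d x < e / (4 * C)"
      using x C e by (meson closure_approachable divide_pos_pos mult_pos_pos zero_less_numeral)
    have "Cauchy (\<lambda>n. f n d)" using D d convergent_Cauchy by blast
    then obtain N where N: "\<And>m n. m \<ge> N \<Longrightarrow> n \<ge> N \<Longrightarrow> \<bar>f m d - f n d\<bar> < e / 2"
      using e unfolding Cauchy_iff by (metis half_gt_zero real_norm_def)
    have *: "\<bar>f n x - f n d\<bar> \<le> e / 4" for n
    proof -
      have "\<bar>f n x - f n d\<bar> \<le> C * norm (x - d)" using C(2)[of n "x - d"] linear_diff[OF lin] by simp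
      also have "\<dots> \<le> C * (e / (4 * C))" using d C
        by (intro mult_left_mono) (auto simp: dist_norm norm_minus_commute)
      finally show ?thesis using C by simp
    qed
    have "norm (f m x - f n x) < e" if "m \<ge> N" "n \<ge> N" for m n
      using N[OF that] *[of m] *[of n] unfolding real_norm_def by linarith
    then show "\<exists>M. \<forall>m\<ge>M. \<forall>n\<ge>M. norm (f m x - f n x) < e" by blast
  qed
  then show ?thesis by (simp add: Cauchy_convergent_iff)
qed

lemma pointwise_convergent_subseq:
  fixes f :: "nat \<Rightarrow> 'a::real_normed_vector \<Rightarrow> real"
  assumes lin: "\<And>n. linear (f n)" and B: "\<And>n x. \<bar>f n x\<bar> \<le> B * norm x" and D: "countable D"
  shows "\<exists>\<sigma>. strict_mono \<sigma> \<and> (\<forall>x\<in>closure D. convergent (\<lambda>n. f (\<sigma> n) x))"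
proof (cases "D = {}")
  case True then show ?thesis by (auto intro: exI[of _ id] strict_mono_id)
next
  case False
  have "bounded (range (\<lambda>n. f n (from_nat_into D k)))" for k
    using B by (auto simp: bounded_iff)
  from diagonal_convergent[of "\<lambda>k n. f n (from_nat_into D k)", OF this]
  obtain \<sigma> where s: "strict_mono \<sigma>" "\<And>k. convergent (\<lambda>n. f (\<sigma> n) (from_nat_into D k))" by blast
  have "convergent (\<lambda>n. f (\<sigma> n) d)" if "d \<in> D" for d
    using s(2)[of "to_nat_on D d"] D that by simp
  then show ?thesis using pointwise_convergent_closure[of "\<lambda>n. f (\<sigma> n)" B D] lin B s by blast
qed

section \<open>Duals of subspaces and products of Asplund spaces\<close>

lemma bounded_linear_in_dual_on:
  assumes f: "bounded_linear f" shows "f \<in> dual_on V"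
proof -
  obtain B where "\<forall>x. norm (f x) \<le> norm x * B" using bounded_linear.bounded[OF f] by blast
  then have "\<exists>B. \<forall>x\<in>V. \<bar>f x\<bar> \<le> B * norm x" by (auto simp: mult.commute)
  then show ?thesis using bounded_linear.linear[OF f] by (simp add: dual_on_def linear_add linear_scale)
qed

lemma separable_dual_onE:
  assumes "separable_dual_on V"
  obtains F where "countable F" "F \<subseteq> dual_on V"
    "\<And>f e. f \<in> dual_on V \<Longrightarrow> e > 0 \<Longrightarrow> \<exists>h\<in>F. \<forall>x\<in>V. \<bar>f x - h x\<bar> \<le> e * norm x"
proof -
  from assms obtain F where "countable F \<and> F \<subseteq> dual_on V \<and>
      (\<forall>f\<in>dual_on V. \<forall>e>0. \<exists>h\<in>F. \<forall>x\<in>V. \<bar>f x - h x\<bar> \<le> e * norm x)"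
    unfolding separable_dual_on_def by (rule exE)
  then show thesis by (intro that[of F]) simp_all
qed

lemma separable_dual_onI:
  assumes "countable F" "F \<subseteq> dual_on V"
    "\<And>f e. f \<in> dual_on V \<Longrightarrow> e > 0 \<Longrightarrow> \<exists>h\<in>F. \<forall>x\<in>V. \<bar>f x - h x\<bar> \<le> e * norm x"
  shows "separable_dual_on V"
  unfolding separable_dual_on_def using assms by (intro exI[of _ F]) simp

lemma asplund_real: "asplund TYPE(real)"
  unfolding asplund_def
proof (intro allI impI)
  fix V :: "real set" assume "subspace V \<and> separable_set V"
  then have V: "subspace V" by simp
  let ?F = "(\<lambda>q x. q * x) ` (\<rat> :: real set)"
  have "countable ?F" by (simp add: countable_rat)
  moreover have "?F \<subseteq> dual_on V"
    by (auto intro!: bounded_linear_in_dual_on bounded_linear_mult_right)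
  moreover have "\<exists>h\<in>?F. \<forall>x\<in>V. \<bar>f x - h x\<bar> \<le> e * norm x" if f: "f \<in> dual_on V" and e: "e > 0" for f e
  proof -
    obtain F where F: "bounded_linear F" "\<forall>x\<in>V. F x = f x" using dual_on_extend[OF V f] by blast
    obtain q where q: "q \<in> \<rat>" "F 1 - e < q" "q < F 1 + e"
      using Rats_dense_in_real[of "F 1 - e" "F 1 + e"] e by auto
    have "\<bar>f x - q * x\<bar> \<le> e * norm x" if "x \<in> V" for x
    proof -
      have "f x = F 1 * x"
        using F that linear_scale[OF bounded_linear.linear[OF F(1)], of x 1] by simp
      then have "\<bar>f x - q * x\<bar> = \<bar>F 1 - q\<bar> * \<bar>x\<bar>" by (simp add: abs_mult[symmetric] algebra_simps)
      also have "\<dots> \<le> e * \<bar>x\<bar>" using q by (intro mult_right_mono) auto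
      finally show ?thesis by simp
    qed
    then show ?thesis using q by blast
  qed
  ultimately show "separable_dual_on V" by (rule separable_dual_onI)
qed

lemma separable_set_image:
  assumes "separable_set V" "continuous_on UNIV f"
  shows "separable_set (f ` V)"
proof -
  obtain D where D: "countable D" "D \<subseteq> V" "V \<subseteq> closure D" using assms by (auto simp: separable_set_def)
  have "f ` V \<subseteq> closure (f ` D)"
    using D image_closure_subset[of D f "closure (f ` D)"] assms(2) closure_subset
    by (metis (no_types, lifting) closed_closure continuous_on_subset image_mono order_trans top_greatest)
  then show ?thesis using D unfolding separable_set_def by (intro exI[of _ "f ` D"]) auto
qed

lemma norm_fst_le_norm: "norm (fst z) \<le> norm z" and norm_snd_le_norm: "norm (snd z) \<le> norm z"
  using norm_fst_le[of "fst z" "snd z"] norm_snd_le[of "snd z" "fst z"] by auto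

lemma asplund_prod:
  assumes A: "asplund TYPE('a::banach)" and B: "asplund TYPE('b::banach)"
  shows "asplund TYPE('a \<times> 'b)"
  unfolding asplund_def
proof (intro allI impI)
  fix V :: "('a \<times> 'b) set" assume VV: "subspace V \<and> separable_set V"
  then have V: "subspace V" by simp
  have "subspace (fst ` V)" "subspace (snd ` V)"
    using linear_subspace_image[OF bounded_linear.linear[OF bounded_linear_fst] V]
      linear_subspace_image[OF bounded_linear.linear[OF bounded_linear_snd] V] by auto
  moreover have "separable_set (fst ` V)" "separable_set (snd ` V)"
    using VV separable_set_image[of V fst] separable_set_image[of V snd]
      continuous_on_fst[OF continuous_on_id] continuous_on_snd[OF continuous_on_id] by auto
  ultimately have sd: "separable_dual_on (fst ` V)" "separable_dual_on (snd ` V)"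
    using A B by (auto simp: asplund_def)
  from separable_dual_onE[OF sd(1)] obtain F where F: "countable F" "F \<subseteq> dual_on (fst ` V)"
      "\<And>f e. f \<in> dual_on (fst ` V) \<Longrightarrow> e > 0 \<Longrightarrow> \<exists>h\<in>F. \<forall>x\<in>fst ` V. \<bar>f x - h x\<bar> \<le> e * norm x"
    by metis
  from separable_dual_onE[OF sd(2)] obtain G where G: "countable G" "G \<subseteq> dual_on (snd ` V)"
      "\<And>f e. f \<in> dual_on (snd ` V) \<Longrightarrow> e > 0 \<Longrightarrow> \<exists>h\<in>G. \<forall>x\<in>snd ` V. \<bar>f x - h x\<bar> \<le> e * norm x"
    by metis
  let ?H = "(\<lambda>(f, h) z. f (fst z) + h (snd z)) ` (F \<times> G)"
  have "countable ?H" using F G by blast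
  moreover have "?H \<subseteq> dual_on V"
  proof
    fix k assume "k \<in> ?H"
    then obtain f h where k: "f \<in> F" "h \<in> G" "k = (\<lambda>z. f (fst z) + h (snd z))" by auto
    then have f: "f \<in> dual_on (fst ` V)" and h: "h \<in> dual_on (snd ` V)" using F G by auto
    obtain C1 where C1: "\<forall>x\<in>fst ` V. \<bar>f x\<bar> \<le> C1 * norm x" using f by (auto simp: dual_on_def)
    obtain C2 where C2: "\<forall>x\<in>snd ` V. \<bar>h x\<bar> \<le> C2 * norm x" using h by (auto simp: dual_on_def)
    have "\<bar>k z\<bar> \<le> (\<bar>C1\<bar> + \<bar>C2\<bar>) * norm z" if z: "z \<in> V" for z
    proof -
      have "\<bar>f (fst z)\<bar> \<le> C1 * norm (fst z)" "\<bar>h (snd z)\<bar> \<le> C2 * norm (snd z)" using C1 C2 z by auto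
      moreover have "C1 * norm (fst z) \<le> \<bar>C1\<bar> * norm z" "C2 * norm (snd z) \<le> \<bar>C2\<bar> * norm z"
        by (auto intro!: mult_mono simp: norm_fst_le_norm norm_snd_le_norm)
      ultimately show ?thesis unfolding k(3) distrib_right by linarith
    qed
    moreover have "k (x + y) = k x + k y" if "x \<in> V" "y \<in> V" for x y
      using f h that by (auto simp: k(3) dual_on_def)
    moreover have "k (c *\<^sub>R x) = c * k x" if "x \<in> V" for x c
      using f h that by (auto simp: k(3) dual_on_def algebra_simps)
    ultimately show "k \<in> dual_on V" unfolding dual_on_def by blast
  qed
  moreover have "\<exists>k\<in>?H. \<forall>z\<in>V. \<bar>f z - k z\<bar> \<le> e * norm z" if f: "f \<in> dual_on V" and e: "e > 0" for f e
  proof -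
    \<comment> \<open>\<open>(fst z, 0)\<close> need not lie in \<open>V\<close>, so the functional
      can be split into its two components only after extension to the whole product.\<close>
    obtain f' where f': "bounded_linear f'" "\<forall>x\<in>V. f' x = f x" using dual_on_extend[OF V f] by blast
    have "bounded_linear (\<lambda>x. f' (x, 0))" "bounded_linear (\<lambda>y. f' (0, y))"
      by (intro bounded_linear_compose[OF f'(1)] bounded_linear_Pair bounded_linear_ident bounded_linear_zero)+
    then have d: "(\<lambda>x. f' (x, 0)) \<in> dual_on (fst ` V)" "(\<lambda>y. f' (0, y)) \<in> dual_on (snd ` V)"
      by (auto intro: bounded_linear_in_dual_on)
    obtain h where h: "h \<in> F" "\<forall>x\<in>fst ` V. \<bar>f' (x, 0) - h x\<bar> \<le> e / 2 * norm x"
      using F(3)[OF d(1), of "e/2"] e by auto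
    obtain k where k: "k \<in> G" "\<forall>x\<in>snd ` V. \<bar>f' (0, x) - k x\<bar> \<le> e / 2 * norm x"
      using G(3)[OF d(2), of "e/2"] e by auto
    have "\<bar>f z - (h (fst z) + k (snd z))\<bar> \<le> e * norm z" if z: "z \<in> V" for z
    proof -
      have "f z = f' (fst z, 0) + f' (0, snd z)"
        using f' z linear_add[OF bounded_linear.linear[OF f'(1)], of "(fst z, 0)" "(0, snd z)"] by simp
      moreover have "\<bar>f' (fst z, 0) - h (fst z)\<bar> \<le> e / 2 * norm (fst z)"
        "\<bar>f' (0, snd z) - k (snd z)\<bar> \<le> e / 2 * norm (snd z)" using h k z by auto
      moreover have "e / 2 * norm (fst z) \<le> e / 2 * norm z" "e / 2 * norm (snd z) \<le> e / 2 * norm z"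
        using e by (auto intro!: mult_left_mono simp: norm_fst_le_norm norm_snd_le_norm)
      ultimately show ?thesis by linarith
    qed
    then show ?thesis using h k by (intro bexI[of _ "\<lambda>z. h (fst z) + k (snd z)"]) auto
  qed
  ultimately show "separable_dual_on V" by (rule separable_dual_onI)
qed

lemma asplund_dense_functionals:
  fixes V :: "'a::banach set"
  assumes A: "asplund TYPE('a)" and V: "subspace V" "separable_set V"
  shows "\<exists>g :: nat \<Rightarrow> 'a \<Rightarrow> real. (\<forall>k. bounded_linear (g k)) \<and>
    (\<forall>f. bounded_linear f \<longrightarrow> (\<forall>e>0. \<exists>k. \<forall>x\<in>V. \<bar>f x - g k x\<bar> \<le> e * norm x))"
proof -
  obtain F where F: "countable F" "F \<subseteq> dual_on V"
      "\<And>f e. f \<in> dual_on V \<Longrightarrow> e > 0 \<Longrightarrow> \<exists>h\<in>F. \<forall>x\<in>V. \<bar>f x - h x\<bar> \<le> e * norm x"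
    using separable_dual_onE[OF A[unfolded asplund_def, rule_format, OF conjI[OF V]]] by metis
  have "\<forall>f\<in>F. \<exists>h. bounded_linear h \<and> (\<forall>x\<in>V. h x = f x)" using dual_on_extend[OF V(1)] F by blast
  then obtain E where E: "\<And>f. f \<in> F \<Longrightarrow> bounded_linear (E f)" "\<And>f x. f \<in> F \<Longrightarrow> x \<in> V \<Longrightarrow> E f x = f x"
    by metis
  have ne: "F \<noteq> {}" using F(3)[OF bounded_linear_in_dual_on[OF bounded_linear_zero], of 1] by auto
  let ?g = "\<lambda>k. E (from_nat_into F k)"
  have "bounded_linear (?g k)" for k using E(1) from_nat_into[OF ne] by blast
  moreover have "\<exists>k. \<forall>x\<in>V. \<bar>f x - ?g k x\<bar> \<le> e * norm x" if f: "bounded_linear f" and e: "e > 0" for f e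
  proof -
    obtain h where h: "h \<in> F" "\<forall>x\<in>V. \<bar>f x - h x\<bar> \<le> e * norm x"
      using F(3)[OF bounded_linear_in_dual_on[OF f] e] by blast
    then show ?thesis using E F by (intro exI[of _ "to_nat_on F h"]) auto
  qed
  ultimately show ?thesis by (intro exI[of _ ?g]) simp
qed

section \<open>Smooth approximation of sublinear functionals\<close>

text \<open>Only the upper half of Frechet differentiability, relative to \<open>V\<close>, is needed at a minimum.\<close>

definition superdiff :: "'a::real_normed_vector set \<Rightarrow> ('a \<Rightarrow> real) \<Rightarrow> 'a \<Rightarrow> ('a \<Rightarrow> real) \<Rightarrow> bool" where
  "superdiff V S x p \<longleftrightarrow> (\<forall>\<epsilon>>0. \<exists>\<delta>>0. \<forall>h\<in>V. norm h < \<delta> \<longrightarrow> S (x + h) - S x \<le> p h + \<epsilon> * norm h)"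

text \<open>\<open>D\<close> provides weak* sequential compactness of bounded sets of functionals on
  \<open>V\<close>; \<open>g\<close> provides centres that are dense in the norm of the dual of
  \<open>V\<close>.\<close>

locale separable_dual =
  fixes V D :: "'a::real_normed_vector set" and g :: "nat \<Rightarrow> 'a \<Rightarrow> real"
  assumes subspace_V: "subspace V" and countable_D: "countable D" and V_closure: "V \<subseteq> closure D"
    and bounded_linear_g: "\<And>k. bounded_linear (g k)"
    and g_dense: "\<And>f e. bounded_linear f \<Longrightarrow> e > 0 \<Longrightarrow> \<exists>k. \<forall>x\<in>V. \<bar>f x - g k x\<bar> \<le> e * norm x"
begin

definition dual_norm :: "('a \<Rightarrow> real) \<Rightarrow> real" where
  "dual_norm f = (SUP x\<in>{x\<in>V. norm x \<le> 1}. \<bar>f x\<bar>)"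

lemma dual_norm_le:
  assumes "\<And>x. x \<in> V \<Longrightarrow> \<bar>f x\<bar> \<le> B * norm x" "B \<ge> 0"
  shows "dual_norm f \<le> B"
  unfolding dual_norm_def
proof (rule cSUP_least)
  show "{x\<in>V. norm x \<le> 1} \<noteq> {}" using subspace_0[OF subspace_V] by force
  fix x assume x: "x \<in> {x\<in>V. norm x \<le> 1}"
  then have "\<bar>f x\<bar> \<le> B * norm x" using assms by auto
  also have "\<dots> \<le> B * 1" using x assms by (intro mult_left_mono) auto
  finally show "\<bar>f x\<bar> \<le> B" by simp
qed

lemma dual_norm_bdd_above:
  fixes f :: "'a \<Rightarrow> real"
  assumes f: "bounded_linear f"
  shows "bdd_above ((\<lambda>x. \<bar>f x\<bar>) ` {x\<in>V. norm x \<le> 1})"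
proof -
  obtain B where B: "B > 0" "\<And>x. \<bar>f x\<bar> \<le> norm x * B"
    using bounded_linear.pos_bounded[OF f] by auto
  have "\<bar>f y\<bar> \<le> B" if "norm y \<le> 1" for y
  proof -
    have "norm y * B \<le> 1 * B" using that B by (intro mult_right_mono) auto
    then show ?thesis using B(2)[of y] by simp
  qed
  then show ?thesis by (auto intro!: bdd_aboveI[of _ B])
qed

lemma dual_norm_bound:
  assumes f: "bounded_linear f" and x: "x \<in> V"
  shows "\<bar>f x\<bar> \<le> dual_norm f * norm x"
proof (cases "x = 0")
  case True then show ?thesis using f by (simp add: bounded_linear.linear linear_0)
next
  case False
  let ?y = "(1 / norm x) *\<^sub>R x"
  have "\<bar>f ?y\<bar> \<le> dual_norm f" unfolding dual_norm_def using x False subspace_V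
    by (intro cSUP_upper dual_norm_bdd_above f) (auto simp: subspace_scale)
  moreover have "f ?y = f x / norm x" using linear_scale[OF bounded_linear.linear[OF f]] by simp
  ultimately show ?thesis using False by (simp add: abs_divide pos_divide_le_eq)
qed

lemma dual_norm_ge_0:
  assumes f: "bounded_linear f" shows "dual_norm f \<ge> 0"
proof -
  have "\<bar>f 0\<bar> \<le> dual_norm f" unfolding dual_norm_def using subspace_0[OF subspace_V]
    by (intro cSUP_upper dual_norm_bdd_above f) auto
  then show ?thesis by simp
qed

section \<open>The penalty on the dual of the subspace\<close>

definition weight :: "nat \<Rightarrow> real" where "weight k = (1/2) ^ k / (1 + dual_norm (g k))\<^sup>2"

text \<open>
  Midpoint convexity of every summand is strict enough to detect convergence: if the convexity defect
  of \<open>penalty\<close> along \<open>f\<^sub>n\<close> and \<open>f\<close> tends to 0, then the distances of \<open>f\<^sub>n\<close> and of \<open>f\<close> to each \<open>g k\<close> agree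
  in the limit, and density of \<open>g\<close> forces convergence in the norm of the dual of \<open>V\<close>. The weights only
  ensure summability.
\<close>

definition penalty :: "('a \<Rightarrow> real) \<Rightarrow> real" where
  "penalty f = (\<Sum>k. weight k * (dual_norm (\<lambda>x. f x - g k x))\<^sup>2)"

lemma weight_pos: "weight k > 0"
  using dual_norm_ge_0[OF bounded_linear_g, of k] by (auto simp: weight_def intro!: divide_pos_pos)

lemma dual_norm_diff_g_le:
  assumes f: "bounded_linear f" and M: "M \<ge> 0" "\<And>x. \<bar>f x\<bar> \<le> M * norm x"
  shows "dual_norm (\<lambda>x. f x - g k x) \<le> M + dual_norm (g k)"
proof (rule dual_norm_le)
  show "M + dual_norm (g k) \<ge> 0" using M dual_norm_ge_0[OF bounded_linear_g] by simp
  fix x assume "x \<in> V"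
  then have "\<bar>g k x\<bar> \<le> dual_norm (g k) * norm x" using dual_norm_bound bounded_linear_g by blast
  then show "\<bar>f x - g k x\<bar> \<le> (M + dual_norm (g k)) * norm x" using M(2)[of x] by (simp add: distrib_right)
qed

text \<open>The distance from \<open>f\<close> to \<open>g k\<close> is at most
  \<open>(M + 1) * (1 + dual_norm (g k))\<close>; the denominator of \<open>weight k\<close> cancels
  the second factor, leaving a geometric series independent of \<open>g\<close>.\<close>

lemma penalty_terms:
  assumes f: "bounded_linear f" and M: "M \<ge> 0" "\<And>x. \<bar>f x\<bar> \<le> M * norm x"
  shows "weight k * (dual_norm (\<lambda>x. f x - g k x))\<^sup>2 \<le> (M + 1)\<^sup>2 * (1/2) ^ k"
proof -
  let ?a = "dual_norm (g k)"
  have a: "?a \<ge> 0" using dual_norm_ge_0[OF bounded_linear_g] .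
  have "dual_norm (\<lambda>x. f x - g k x) \<le> M + ?a" using dual_norm_diff_g_le[OF f M] .
  also have "\<dots> \<le> (M + 1) * (1 + ?a)" using a M by (simp add: algebra_simps)
  finally have "(dual_norm (\<lambda>x. f x - g k x))\<^sup>2 \<le> ((M + 1) * (1 + ?a))\<^sup>2"
    using dual_norm_ge_0[OF bounded_linear_sub[OF f bounded_linear_g]] by (intro power_mono) auto
  then have "weight k * (dual_norm (\<lambda>x. f x - g k x))\<^sup>2 \<le> weight k * ((M + 1) * (1 + ?a))\<^sup>2"
    using weight_pos[of k] by (intro mult_left_mono) auto
  also have "\<dots> = (M + 1)\<^sup>2 * (1/2) ^ k" using a by (simp add: weight_def power_mult_distrib)
  finally show ?thesis .
qed

lemma penalty_summable:
  assumes f: "bounded_linear f"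
  shows "summable (\<lambda>k. weight k * (dual_norm (\<lambda>x. f x - g k x))\<^sup>2)"
proof -
  obtain M where "M > 0" "\<And>x. \<bar>f x\<bar> \<le> M * norm x"
    using bounded_linear.pos_bounded[OF f] by (auto simp: mult.commute)
  then have "norm (weight k * (dual_norm (\<lambda>x. f x - g k x))\<^sup>2) \<le> (M + 1)\<^sup>2 * (1/2) ^ k" for k
    using penalty_terms[OF f, of M k] weight_pos[of k] by simp
  moreover have "summable (\<lambda>k. (M + 1)\<^sup>2 * (1/2::real) ^ k)" by (intro summable_mult summable_geometric) simp
  ultimately show ?thesis by (rule summable_comparison_test'[of _ 0, rotated])
qed

lemma penalty_ge_0: assumes "bounded_linear f" shows "penalty f \<ge> 0"
  unfolding penalty_def using penalty_summable[OF assms] weight_pos by (intro suminf_nonneg) (auto simp: less_imp_le)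

lemma penalty_le:
  assumes f: "bounded_linear f" and M: "M \<ge> 0" "\<And>x. \<bar>f x\<bar> \<le> M * norm x"
  shows "penalty f \<le> 2 * (M + 1)\<^sup>2"
proof -
  have "penalty f \<le> (\<Sum>k. (M + 1)\<^sup>2 * (1/2::real) ^ k)"
    unfolding penalty_def using penalty_terms[OF f M] penalty_summable[OF f]
    by (intro suminf_le summable_mult summable_geometric) auto
  also have "\<dots> = 2 * (M + 1)\<^sup>2" by (subst suminf_mult) (auto simp: suminf_geometric)
  finally show ?thesis .
qed

lemma dual_norm_midpoint:
  assumes f: "bounded_linear f" and h: "bounded_linear h"
  shows "dual_norm (\<lambda>x. (f x + h x) / 2 - g k x) \<le> (dual_norm (\<lambda>x. f x - g k x) + dual_norm (\<lambda>x. h x - g k x)) / 2"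
proof (rule dual_norm_le)
  have bl: "bounded_linear (\<lambda>x. f x - g k x)" "bounded_linear (\<lambda>x. h x - g k x)"
    using f h bounded_linear_g by (auto intro: bounded_linear_sub)
  show "0 \<le> (dual_norm (\<lambda>x. f x - g k x) + dual_norm (\<lambda>x. h x - g k x)) / 2"
    using dual_norm_ge_0[OF bl(1)] dual_norm_ge_0[OF bl(2)] by simp
  fix x assume "x \<in> V"
  then have "\<bar>f x - g k x\<bar> \<le> dual_norm (\<lambda>x. f x - g k x) * norm x" "\<bar>h x - g k x\<bar> \<le> dual_norm (\<lambda>x. h x - g k x) * norm x"
    using dual_norm_bound[OF bl(1)] dual_norm_bound[OF bl(2)] by auto
  then show "\<bar>(f x + h x) / 2 - g k x\<bar> \<le> (dual_norm (\<lambda>x. f x - g k x) + dual_norm (\<lambda>x. h x - g k x)) / 2 * norm x"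
    by (simp add: distrib_right add_divide_distrib)
qed

text \<open>Each summand obeys \<open>((a + b) / 2)^2 = (a^2 + b^2) / 2 - (a - b)^2 / 4\<close>.
  Only the gain of the \<open>k\<close>-th summand is kept.\<close>

lemma penalty_midpoint:
  assumes f: "bounded_linear f" and h: "bounded_linear h"
  shows "penalty (\<lambda>x. (f x + h x) / 2) + weight k / 4 * (dual_norm (\<lambda>x. f x - g k x) - dual_norm (\<lambda>x. h x - g k x))\<^sup>2
           \<le> (penalty f + penalty h) / 2"
proof -
  let ?a = "\<lambda>k. dual_norm (\<lambda>x. f x - g k x)" and ?b = "\<lambda>k. dual_norm (\<lambda>x. h x - g k x)"
  let ?m = "\<lambda>k. dual_norm (\<lambda>x. (f x + h x) / 2 - g k x)"
  have m: "bounded_linear (\<lambda>x. (f x + h x) / 2)"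
    using bounded_linear_compose[OF bounded_linear_divide bounded_linear_add[OF f h]] .
  have m0: "?m j \<ge> 0" for j using m bounded_linear_g by (intro dual_norm_ge_0 bounded_linear_sub)
  \<comment> \<open>The gain is written as a series with one nonzero term, so that the two sides can
    be compared term by term.\<close>
  define d where "d j = (if j = k then weight k / 4 * (?a k - ?b k)\<^sup>2 else 0)" for j
  have sd: "d sums (weight k / 4 * (?a k - ?b k)\<^sup>2)" unfolding d_def by (rule sums_single)
  have le: "weight j * (?m j)\<^sup>2 + d j \<le> (weight j * (?a j)\<^sup>2 + weight j * (?b j)\<^sup>2) / 2" for j
  proof -
    have "(?m j)\<^sup>2 \<le> ((?a j + ?b j) / 2)\<^sup>2" using dual_norm_midpoint[OF f h] m0 by (intro power_mono)
    also have "\<dots> = ((?a j)\<^sup>2 + (?b j)\<^sup>2) / 2 - (?a j - ?b j)\<^sup>2 / 4"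
      by (simp add: power2_eq_square field_simps)
    finally have "weight j * (?m j)\<^sup>2 \<le> weight j * (((?a j)\<^sup>2 + (?b j)\<^sup>2) / 2 - (?a j - ?b j)\<^sup>2 / 4)"
      using weight_pos[of j] by (intro mult_left_mono) auto
    also have "\<dots> = (weight j * (?a j)\<^sup>2 + weight j * (?b j)\<^sup>2) / 2 - weight j / 4 * (?a j - ?b j)\<^sup>2"
      by (simp add: field_simps)
    moreover have "d j \<le> weight j / 4 * (?a j - ?b j)\<^sup>2" using weight_pos[of j] by (simp add: d_def)
    ultimately show ?thesis by linarith
  qed
  have "(\<lambda>j. weight j * (?m j)\<^sup>2 + d j) sums (penalty (\<lambda>x. (f x + h x) / 2) + weight k / 4 * (?a k - ?b k)\<^sup>2)"
    unfolding penalty_def using penalty_summable[OF m] by (intro sums_add sd summable_sums)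
  moreover have "(\<lambda>j. (weight j * (?a j)\<^sup>2 + weight j * (?b j)\<^sup>2) / 2) sums ((penalty f + penalty h) / 2)"
    unfolding penalty_def using penalty_summable[OF f] penalty_summable[OF h]
    by (intro sums_divide sums_add summable_sums)
  ultimately show ?thesis by (rule sums_le[OF le])
qed

text \<open>The direct method: a maximising sequence has a subsequence converging pointwise on
  \<open>V\<close>, the penalty is lower semicontinuous for this convergence, and Hahn-Banach
  extends the limit from \<open>V\<close> to a competitor below \<open>s\<close>.\<close>

lemma penalized_sup_attained:
  fixes s :: "'a \<Rightarrow> real"
  assumes s: "sublin s" and M: "M \<ge> 0" "\<And>x. s x \<le> M * norm x" and c: "c > 0" and x: "x \<in> V"
    and le: "\<And>p. linear p \<Longrightarrow> (\<And>y. p y \<le> s y) \<Longrightarrow> p x - c * penalty p \<le> S"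
    and ap: "\<And>e. e > 0 \<Longrightarrow> \<exists>p. linear p \<and> (\<forall>y. p y \<le> s y) \<and> S - e \<le> p x - c * penalty p"
  shows "\<exists>p. linear p \<and> (\<forall>y. p y \<le> s y) \<and> p x - c * penalty p = S"
proof -
  have bl: "bounded_linear p" "\<bar>p y\<bar> \<le> M * norm y" if "linear p" "\<And>y. p y \<le> s y" for p y
    using bounded_linear_below[OF that(1), of M] that(2) M(2) order_trans by blast+
  have "\<forall>n. \<exists>p. linear p \<and> (\<forall>y. p y \<le> s y) \<and> S - 1 / real (Suc n) \<le> p x - c * penalty p"
    using ap by simp
  then obtain p where p: "\<And>n. linear (p n)" "\<And>n y. p n y \<le> s y"
      "\<And>n. S - 1 / real (Suc n) \<le> p n x - c * penalty (p n)" by metis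
  have pb: "bounded_linear (p n)" "\<bar>p n y\<bar> \<le> M * norm y" for n y using bl p by auto
  obtain r1 where r1: "strict_mono r1" "\<And>y. y \<in> V \<Longrightarrow> convergent (\<lambda>n. p (r1 n) y)"
    using pointwise_convergent_subseq[of p M D, OF p(1) pb(2) countable_D] V_closure by blast
  \<comment> \<open>A second extraction makes the distances to every \<open>g k\<close> converge;
    the distance of the limit is at most their limit \<open>\<rho> k\<close>.\<close>
  have "bounded (range (\<lambda>n. dual_norm (\<lambda>y. p (r1 n) y - g k y)))" for k
    using dual_norm_diff_g_le[OF pb(1) M(1) pb(2)] dual_norm_ge_0[OF bounded_linear_sub[OF pb(1) bounded_linear_g]]
    by (auto simp: bounded_iff intro!: exI[of _ "M + dual_norm (g k)"])
  from diagonal_convergent[of "\<lambda>k n. dual_norm (\<lambda>y. p (r1 n) y - g k y)", OF this]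
  obtain r2 where r2: "strict_mono r2" "\<And>k. convergent (\<lambda>n. dual_norm (\<lambda>y. p (r1 (r2 n)) y - g k y))" by blast
  define q where "q n = p (r1 (r2 n))" for n
  obtain \<rho> where \<rho>: "\<And>k. (\<lambda>n. dual_norm (\<lambda>y. q n y - g k y)) \<longlonglongrightarrow> \<rho> k"
    using r2(2) unfolding convergent_def q_def by metis
  have "\<exists>l. (\<lambda>n. q n y) \<longlonglongrightarrow> l" if "y \<in> V" for y
    using convergent_subseq_convergent[OF r1(2)[OF that] r2(1)] by (auto simp: convergent_def q_def o_def)
  then obtain f where f: "\<And>y. y \<in> V \<Longrightarrow> (\<lambda>n. q n y) \<longlonglongrightarrow> f y" by metis
  have fa: "f (y + z) = f y + f z" if "y \<in> V" "z \<in> V" for y z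
  proof (rule LIMSEQ_unique[OF f])
    show "y + z \<in> V" using that subspace_V subspace_add by blast
    show "(\<lambda>n. q n (y + z)) \<longlonglongrightarrow> f y + f z"
      using tendsto_add[OF f[OF that(1)] f[OF that(2)]] p(1) by (simp add: q_def linear_add)
  qed
  have fs: "f (a *\<^sub>R y) = a * f y" if "y \<in> V" for y a
  proof (rule LIMSEQ_unique[OF f])
    show "a *\<^sub>R y \<in> V" using that subspace_V subspace_scale by blast
    show "(\<lambda>n. q n (a *\<^sub>R y)) \<longlonglongrightarrow> a * f y"
      using tendsto_mult_left[OF f[OF that]] p(1) by (simp add: q_def linear_scale)
  qed
  have "f y \<le> s y" if "y \<in> V" for y
    using f[OF that] p(2) by (intro LIMSEQ_le_const2) (auto simp: q_def)
  then obtain F where F: "linear F" "\<And>y. F y \<le> s y" "\<And>y. y \<in> V \<Longrightarrow> F y = f y"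
    using hahn_banach_extension[OF s subspace_V fa fs] by blast
  have Fb: "bounded_linear F" using bl(1)[OF F(1)] F(2) by blast
  have dnF: "dual_norm (\<lambda>y. F y - g k y) \<le> \<rho> k" for k
  proof (rule dual_norm_le)
    show "\<rho> k \<ge> 0" using \<rho>[of k] dual_norm_ge_0[OF bounded_linear_sub[OF pb(1) bounded_linear_g]]
      by (intro LIMSEQ_le_const[of _ "\<rho> k"]) (auto simp: q_def)
    fix y assume y: "y \<in> V"
    have "(\<lambda>n. \<bar>q n y - g k y\<bar>) \<longlonglongrightarrow> \<bar>F y - g k y\<bar>" using f[OF y] F(3)[OF y]
      by (intro tendsto_intros) auto
    moreover have "(\<lambda>n. dual_norm (\<lambda>y. q n y - g k y) * norm y) \<longlonglongrightarrow> \<rho> k * norm y"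
      by (intro tendsto_intros \<rho>)
    ultimately show "\<bar>F y - g k y\<bar> \<le> \<rho> k * norm y"
      by (rule LIMSEQ_le) (use dual_norm_bound[OF bounded_linear_sub[OF pb(1) bounded_linear_g] y] in \<open>auto simp: q_def\<close>)
  qed
  have rr: "strict_mono (\<lambda>n. r1 (r2 n))" using strict_mono_o[OF r1(1) r2(1)] by (simp add: o_def)
  have lim0: "(\<lambda>n. 1 / real (Suc (r1 (r2 n)))) \<longlonglongrightarrow> 0"
    using LIMSEQ_subseq_LIMSEQ[OF LIMSEQ_inverse_real_of_nat rr] by (simp add: o_def inverse_eq_divide)
  \<comment> \<open>As in Fatou's lemma, finite partial sums pass to the limit and the bound does
    not depend on \<open>K\<close>.\<close>
  have "(\<Sum>k<K. weight k * (dual_norm (\<lambda>y. F y - g k y))\<^sup>2) \<le> (F x - S) / c" for K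
  proof -
    have "(\<Sum>k<K. weight k * (dual_norm (\<lambda>y. F y - g k y))\<^sup>2) \<le> (\<Sum>k<K. weight k * (\<rho> k)\<^sup>2)"
      using dnF dual_norm_ge_0[OF bounded_linear_sub[OF Fb bounded_linear_g]] weight_pos
      by (intro sum_mono mult_left_mono power_mono) (auto simp: less_imp_le)
    also have "\<dots> \<le> (F x - S) / c"
    proof (rule LIMSEQ_le)
      show "(\<lambda>n. \<Sum>k<K. weight k * (dual_norm (\<lambda>y. q n y - g k y))\<^sup>2) \<longlonglongrightarrow> (\<Sum>k<K. weight k * (\<rho> k)\<^sup>2)"
        by (intro tendsto_intros \<rho>)
      have "(\<lambda>n. (q n x - S + 1 / real (Suc (r1 (r2 n)))) / c) \<longlonglongrightarrow> (F x - S + 0) / c"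
        using c f[OF x] F(3)[OF x] lim0 by (intro tendsto_intros) auto
      then show "(\<lambda>n. (q n x - S + 1 / real (Suc (r1 (r2 n)))) / c) \<longlonglongrightarrow> (F x - S) / c" by simp
      have "(\<Sum>k<K. weight k * (dual_norm (\<lambda>y. q n y - g k y))\<^sup>2) \<le> (q n x - S + 1 / real (Suc (r1 (r2 n)))) / c" for n
      proof -
        have "(\<Sum>k<K. weight k * (dual_norm (\<lambda>y. q n y - g k y))\<^sup>2) \<le> penalty (q n)"
          unfolding penalty_def q_def using weight_pos by (intro sum_le_suminf penalty_summable pb) (auto simp: less_imp_le)
        also have "\<dots> \<le> (q n x - S + 1 / real (Suc (r1 (r2 n)))) / c"
          using p(3)[of "r1 (r2 n)"] c by (simp add: q_def pos_le_divide_eq mult.commute)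
        finally show ?thesis .
      qed
      then show "\<exists>N. \<forall>n\<ge>N. (\<Sum>k<K. weight k * (dual_norm (\<lambda>y. q n y - g k y))\<^sup>2) \<le> (q n x - S + 1 / real (Suc (r1 (r2 n)))) / c"
        by blast
    qed
    finally show ?thesis .
  qed
  then have "penalty F \<le> (F x - S) / c" unfolding penalty_def by (intro suminf_le_const penalty_summable Fb)
  then have "F x - c * penalty F \<ge> S" using c by (simp add: pos_le_divide_eq mult.commute)
  then show ?thesis using le[OF F(1,2)] F by force
qed

text \<open>
  The approximation is \<open>S x = (SUP p. p x - c * penalty p)\<close> over the linear \<open>p \<le> s\<close>: near-maximisers at \<open>x\<close>
  are norm close to the maximiser, which is therefore a Frechet gradient of \<open>S\<close> at \<open>x\<close>.
\<close>

lemma smooth_approximation: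
  fixes s :: "'a \<Rightarrow> real"
  assumes s: "sublin s" and M: "M \<ge> 0" "\<And>x. s x \<le> M * norm x" and e: "e > 0"
  shows "\<exists>S. (\<forall>x. s x - e \<le> S x \<and> S x \<le> s x) \<and> (\<forall>x y. S x - S y \<le> M * norm (x - y)) \<and>
    (\<forall>x\<in>V. \<exists>p. linear p \<and> (\<forall>y. p y \<le> s y) \<and> superdiff V S x p)"
proof -
  define P where "P = {p. linear p \<and> (\<forall>y. p y \<le> s y)}"
  have bl: "bounded_linear p" "\<And>y. \<bar>p y\<bar> \<le> M * norm y" if "p \<in> P" for p
  proof -
    have "linear p" "\<And>y. p y \<le> M * norm y" using that M(2) order_trans by (auto simp: P_def) blast
    then show "bounded_linear p" "\<And>y. \<bar>p y\<bar> \<le> M * norm y" using bounded_linear_below by blast+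
  qed
  \<comment> \<open>By \<open>penalty_le\<close>, the penalty of every \<open>p \<le> s\<close> is
    at most \<open>2 * (M + 1)^2\<close>, so \<open>c * penalty p\<close> stays within
    \<open>e\<close>.\<close>
  define c where "c = e / (2 * (M + 1)\<^sup>2)"
  have c: "c > 0" using e M by (auto simp: c_def intro!: divide_pos_pos)
  have cQ: "0 \<le> c * penalty p" "c * penalty p \<le> e" if "p \<in> P" for p
  proof -
    have "c * penalty p \<le> c * (2 * (M + 1)\<^sup>2)" using penalty_le[OF bl(1) M(1) bl(2)] that c by (intro mult_left_mono) auto
    then show "c * penalty p \<le> e" using M(1) by (simp add: c_def)
  qed (use c penalty_ge_0 bl that in auto)
  have Pne: "P \<noteq> {}" using ex_linear_below_sublin[OF s] by (auto simp: P_def)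
  define S where "S x = (SUP p\<in>P. p x - c * penalty p)" for x
  have val: "p x - c * penalty p \<le> s x" if "p \<in> P" for p x
  proof -
    have "p x \<le> s x" using that by (simp add: P_def)
    then show ?thesis using cQ(1)[OF that] by linarith
  qed
  have bdd: "bdd_above ((\<lambda>p. p x - c * penalty p) ` P)" for x using val by (auto intro!: bdd_aboveI[of _ "s x"])
  have up: "p x - c * penalty p \<le> S x" if "p \<in> P" for p x unfolding S_def using that bdd by (rule cSUP_upper)
  have least: "S x \<le> b" if "\<And>p. p \<in> P \<Longrightarrow> p x - c * penalty p \<le> b" for x b
    unfolding S_def using Pne that by (rule cSUP_least)
  have near: "\<exists>p\<in>P. S x - d \<le> p x - c * penalty p" if "d > 0" for x d
  proof (rule ccontr)
    assume "\<not> ?thesis"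
    then have "S x \<le> S x - d" by (intro least) force
    then show False using that by simp
  qed
  have S_le: "S x \<le> s x" for x using least val by blast
  have S_ge: "s x - e \<le> S x" for x
  proof -
    obtain F where F: "linear F" "\<forall>y. F y \<le> s y" "F x = s x" using support_functional[OF s] by blast
    then have "F \<in> P" by (simp add: P_def)
    then show ?thesis using up[of F x] cQ(2)[of F] F by linarith
  qed
  have S_lip: "S x - S y \<le> M * norm (x - y)" for x y
  proof -
    have "p x - c * penalty p \<le> M * norm (x - y) + S y" if "p \<in> P" for p
    proof -
      have "p (x - y) \<le> M * norm (x - y)" using bl(2)[OF that, of "x - y"] by simp
      moreover have "p (x - y) = p x - p y" using that by (simp add: P_def linear_diff)
      ultimately show ?thesis using up[OF that, of y] by linarith
    qed
    then have "S x \<le> M * norm (x - y) + S y" by (rule least)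
    then show ?thesis by simp
  qed
  have "\<exists>p. linear p \<and> (\<forall>y. p y \<le> s y) \<and> superdiff V S x p" if x: "x \<in> V" for x
  proof -
    have "\<exists>p. linear p \<and> (\<forall>y. p y \<le> s y) \<and> p x - c * penalty p = S x"
      by (rule penalized_sup_attained[OF s M c x]) (use up near in \<open>auto simp: P_def\<close>)
    then obtain p where pP: "p \<in> P" and px: "p x - c * penalty p = S x" by (auto simp: P_def)
    \<comment> \<open>The midpoint of \<open>p\<close> and a near-maximiser \<open>q\<close> cannot
      beat the supremum, so the gain in \<open>penalty_midpoint\<close> is at most
      \<open>\<eta> / 2\<close>. For a centre \<open>g k\<close> within \<open>\<epsilon>/3\<close>
      of \<open>p\<close> this puts \<open>q\<close> within \<open>2\<epsilon>/3\<close> of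
      \<open>g k\<close>, hence within \<epsilon> of \<open>p\<close>.\<close>
    have stable: "\<exists>\<eta>>0. \<forall>q\<in>P. S x - \<eta> \<le> q x - c * penalty q \<longrightarrow> (\<forall>h\<in>V. \<bar>q h - p h\<bar> \<le> \<epsilon> * norm h)" if \<epsilon>: "\<epsilon> > 0" for \<epsilon>
    proof -
      obtain k where k: "\<forall>y\<in>V. \<bar>p y - g k y\<bar> \<le> \<epsilon> / 3 * norm y" using g_dense[OF bl(1)[OF pP], of "\<epsilon>/3"] \<epsilon> by auto
      let ?n = "\<lambda>q. dual_norm (\<lambda>y. q y - g k y)"
      have np: "?n p \<le> \<epsilon> / 3" using k \<epsilon> by (intro dual_norm_le) auto
      define \<eta> where "\<eta> = c * weight k / 2 * (\<epsilon> / 3)\<^sup>2"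
      have "\<eta> > 0" using c weight_pos[of k] \<epsilon> by (auto simp: \<eta>_def)
      moreover have "\<bar>q h - p h\<bar> \<le> \<epsilon> * norm h" if q: "q \<in> P" "S x - \<eta> \<le> q x - c * penalty q" and h: "h \<in> V" for q h
      proof -
        let ?m = "\<lambda>y. (p y + q y) / 2"
        have "linear ?m"
          using linear_compose_scale_right[OF linear_compose_add[of p q], of "1/2"] pP q by (auto simp: P_def)
        moreover have "?m y \<le> s y" for y
        proof -
          have "p y \<le> s y" "q y \<le> s y" using pP q by (auto simp: P_def)
          then show ?thesis by simp
        qed
        ultimately have "?m \<in> P" by (simp add: P_def)
        then have 1: "?m x - c * penalty ?m \<le> S x" by (rule up)
        have "c * (penalty ?m + weight k / 4 * (?n p - ?n q)\<^sup>2) \<le> c * ((penalty p + penalty q) / 2)"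
          using penalty_midpoint[OF bl(1)[OF pP] bl(1)[OF q(1)], of k] c by (intro mult_left_mono) auto
        then have "c * penalty ?m + c * weight k / 4 * (?n p - ?n q)\<^sup>2 \<le> (c * penalty p + c * penalty q) / 2"
          by (simp add: algebra_simps add_divide_distrib)
        then have "c * weight k / 4 * (?n p - ?n q)\<^sup>2 \<le> \<eta> / 2" using 1 px q(2) by (simp add: add_divide_distrib)
        then have "(c * weight k / 4) * (?n p - ?n q)\<^sup>2 \<le> (c * weight k / 4) * (\<epsilon> / 3)\<^sup>2" by (simp add: \<eta>_def)
        moreover have "c * weight k / 4 > 0" using c weight_pos[of k] by simp
        ultimately have "(?n p - ?n q)\<^sup>2 \<le> (\<epsilon> / 3)\<^sup>2" by (rule mult_left_le_imp_le)
        then have "\<bar>?n p - ?n q\<bar> \<le> \<epsilon> / 3" using \<epsilon> by (simp add: abs_le_square_iff[symmetric])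
        then have nq: "?n q \<le> 2 * (\<epsilon> / 3)" using np by linarith
        have "\<bar>q h - g k h\<bar> \<le> ?n q * norm h"
          using dual_norm_bound[OF bounded_linear_sub[OF bl(1)[OF q(1)] bounded_linear_g] h] .
        also have "\<dots> \<le> 2 * (\<epsilon> / 3) * norm h" using nq by (intro mult_right_mono) auto
        finally have "\<bar>q h - g k h\<bar> \<le> 2 * (\<epsilon> / 3) * norm h" .
        moreover have "\<bar>p h - g k h\<bar> \<le> \<epsilon> / 3 * norm h" using k h by blast
        ultimately show ?thesis by linarith
      qed
      ultimately show ?thesis by (intro exI[of _ \<eta>]) simp
    qed
    have "\<exists>\<delta>>0. \<forall>h\<in>V. norm h < \<delta> \<longrightarrow> S (x + h) - S x \<le> p h + \<epsilon> * norm h" if \<epsilon>: "\<epsilon> > 0" for \<epsilon>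
    proof -
      obtain \<eta> where \<eta>: "\<eta> > 0" "\<And>q h. q \<in> P \<Longrightarrow> S x - \<eta> \<le> q x - c * penalty q \<Longrightarrow> h \<in> V \<Longrightarrow> \<bar>q h - p h\<bar> \<le> \<epsilon> / 2 * norm h"
        using stable[of "\<epsilon>/2"] \<epsilon> by auto
      \<comment> \<open>A maximiser at \<open>x + h\<close> up to
        \<open>\<epsilon> / 2 * norm h\<close> is one at \<open>x\<close> up to
        \<open>(2 * M + \<epsilon>) * norm h\<close>: one \<open>M\<close> comes from the Lipschitz
        bound of \<open>S\<close>, the other from \<open>q h\<close>.\<close>
      define \<delta> where "\<delta> = \<eta> / (2 * M + \<epsilon> + 1)"
      have \<delta>: "\<delta> > 0" using \<eta> M \<epsilon> by (auto simp: \<delta>_def intro!: divide_pos_pos)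
      have "S (x + h) - S x \<le> p h + \<epsilon> * norm h" if h: "h \<in> V" "norm h < \<delta>" for h
      proof (cases "h = 0")
        case True then show ?thesis using pP by (simp add: P_def linear_0)
      next
        case False
        then have d: "\<epsilon> / 2 * norm h > 0" using \<epsilon> by simp
        obtain q where q: "q \<in> P" "S (x + h) - \<epsilon> / 2 * norm h \<le> q (x + h) - c * penalty q" using near[OF d] by blast
        have qa: "q (x + h) = q x + q h" using q by (simp add: P_def linear_add)
        have "S x - S (x + h) \<le> M * norm h" using S_lip[of x "x + h"] by simp
        moreover have "q h \<le> M * norm h" using bl(2)[OF q(1), of h] by simp
        moreover have "norm h * (2 * M + \<epsilon> + 1) < \<eta>"
          using h(2) M \<epsilon> by (simp add: \<delta>_def pos_less_divide_eq)
        then have "2 * (M * norm h) + \<epsilon> * norm h + norm h < \<eta>" by (simp add: algebra_simps)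
        ultimately have "S x - \<eta> \<le> q x - c * penalty q" using q(2) qa d norm_ge_zero[of h] by linarith
        then have "\<bar>q h - p h\<bar> \<le> \<epsilon> / 2 * norm h" using \<eta>(2) q h by blast
        moreover have "q x - c * penalty q \<le> S x" using up q by blast
        ultimately show ?thesis using q(2) qa by linarith
      qed
      then show ?thesis using \<delta> by blast
    qed
    then show ?thesis using pP by (intro exI[of _ p]) (simp add: P_def superdiff_def)
  qed
  then show ?thesis using S_le S_ge S_lip by (intro exI[of _ S]) simp
qed

end

section \<open>Smooth variational principle\<close>

lemma ex_approx_minimizer:
  fixes F :: "'a \<Rightarrow> real"
  assumes ne: "E \<noteq> {}" and bd: "\<And>u. u \<in> E \<Longrightarrow> B \<le> F u" and e: "e > 0"
  shows "\<exists>x\<in>E. \<forall>u\<in>E. F x \<le> F u + e"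
proof -
  have bb: "bdd_below (F ` E)" using bd by (auto intro!: bdd_belowI[of _ B])
  have "Inf (F ` E) < Inf (F ` E) + e" using e by simp
  then obtain x where x: "x \<in> E" "F x < Inf (F ` E) + e"
    using cInf_lessD[of "F ` E" "Inf (F ` E) + e"] ne by auto
  have "F x \<le> F u + e" if "u \<in> E" for u using cInf_lower[OF imageI[OF that] bb] x by simp
  then show ?thesis using x by blast
qed

text \<open>
  The Borwein-Preiss argument, with a different smooth approximation \<open>\<theta> n\<close> of the norm in each step;
  \<open>\<theta> n\<close> may be slightly negative, so the errors \<open>\<eta> / \<mu> / 2 ^ n\<close> enter the estimates.
\<close>

lemma smooth_variational_principle:
  fixes E :: "'a::banach set" and \<phi> :: "'a \<Rightarrow> real" and \<theta> :: "nat \<Rightarrow> 'a \<Rightarrow> real"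
  assumes E: "closed E" "x0 \<in> E" and lip: "\<And>u v. \<phi> u - \<phi> v \<le> L * norm (u - v)" and L: "L \<ge> 0"
    and min: "\<forall>u\<in>E. \<phi> x0 \<le> \<phi> u + \<eta>" and \<eta>: "\<eta> > 0" and \<mu>: "\<mu> > 0"
    and \<theta>: "\<And>n x. norm x - \<eta> / \<mu> / 2 ^ n \<le> \<theta> n x" "\<And>n x. \<theta> n x \<le> norm x"
    and \<theta>_lip: "\<And>n u v. \<theta> n u - \<theta> n v \<le> norm (u - v)"
  shows "\<exists>xs y. y \<in> E \<and> (\<forall>n. xs n \<in> E) \<and> norm (y - x0) \<le> 10 * (\<eta> / \<mu>) \<and>
    (\<forall>u. summable (\<lambda>n. \<mu> / 2 ^ Suc n * \<theta> n (u - xs n))) \<and>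
    (\<forall>u\<in>E. \<phi> y + (\<Sum>n. \<mu> / 2 ^ Suc n * \<theta> n (y - xs n)) \<le> \<phi> u + (\<Sum>n. \<mu> / 2 ^ Suc n * \<theta> n (u - xs n)))"
proof -
  \<comment> \<open>The weights \<open>m\<close> sum to \<mu>. Powers of 4 in \<open>e\<close>
    against powers of 2 in \<open>m\<close> make the steps geometric, and by \<open>mc\<close> the
    allowed negativity of \<open>\<theta> n\<close> costs half of \<open>e n\<close>.\<close>
  define m where "m n = \<mu> / 2 ^ Suc n" for n :: nat
  define e where "e n = \<eta> / 4 ^ n" for n :: nat
  have m: "m n > 0" for n using \<mu> by (simp add: m_def)
  have e: "e n > 0" for n using \<eta> by (simp add: e_def)
  have mc: "m n * (\<eta> / \<mu> / 2 ^ n) = e n / 2" for n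
    using \<mu> by (simp add: m_def e_def field_simps power_mult_distrib[symmetric])
  let ?P = "\<lambda>n (x, F). x \<in> E \<and> (\<forall>u\<in>E. F x \<le> F u + e n)"
  let ?Q = "\<lambda>n (x, F) (x', F'). F' = (\<lambda>u. F u + m n * \<theta> n (u - x))"
  have "\<exists>f. (\<forall>n. ?P n (f n)) \<and> (\<forall>n. ?Q n (f n) (f (Suc n))) \<and> f 0 = (x0, \<phi>)"
  proof -
    \<comment> \<open>The state is a point together with the perturbed function built so far; the
      clause for \<open>n = 0\<close> pins the starting state.\<close>
    have "\<exists>f. \<forall>n. (?P n (f n) \<and> (n = 0 \<longrightarrow> f n = (x0, \<phi>))) \<and> ?Q n (f n) (f (Suc n))"
    proof (rule dependent_nat_choice[where P = "\<lambda>n z. ?P n z \<and> (n = 0 \<longrightarrow> z = (x0, \<phi>))" and Q = ?Q])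
      show "\<exists>x. ?P 0 x \<and> (0 = 0 \<longrightarrow> x = (x0, \<phi>))" using E min by (intro exI[of _ "(x0, \<phi>)"]) (simp add: e_def)
      fix z n assume z: "?P n z \<and> (n = 0 \<longrightarrow> z = (x0, \<phi>))"
      obtain x F where zz: "z = (x, F)" by (cases z)
      have x: "x \<in> E" "\<And>u. u \<in> E \<Longrightarrow> F x \<le> F u + e n" using z zz by auto
      let ?F = "\<lambda>u. F u + m n * \<theta> n (u - x)"
      have "F x - e n - e n / 2 \<le> ?F u" if "u \<in> E" for u
      proof -
        have "- (\<eta> / \<mu> / 2 ^ n) \<le> \<theta> n (u - x)" using \<theta>(1)[of "u - x" n] norm_ge_zero[of "u - x"] by linarith
        then have "m n * (- (\<eta> / \<mu> / 2 ^ n)) \<le> m n * \<theta> n (u - x)" using m[of n] by (intro mult_left_mono) auto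
        then show ?thesis using x(2)[OF that] unfolding mult_minus_right mc by linarith
      qed
      then obtain x' where "x' \<in> E" "\<forall>u\<in>E. ?F x' \<le> ?F u + e (Suc n)"
        using ex_approx_minimizer[of E "F x - e n - e n / 2" ?F "e (Suc n)"] x(1) e by blast
      then show "\<exists>y. (?P (Suc n) y \<and> (Suc n = 0 \<longrightarrow> y = (x0, \<phi>))) \<and> ?Q n z y"
        by (intro exI[of _ "(x', ?F)"]) (simp add: zz)
    qed
    then obtain f where "\<forall>n. (?P n (f n) \<and> (n = 0 \<longrightarrow> f n = (x0, \<phi>))) \<and> ?Q n (f n) (f (Suc n))" by (rule exE)
    then show ?thesis by (intro exI[of _ f]) simp
  qed
  then obtain f where "(\<forall>n. ?P n (f n)) \<and> (\<forall>n. ?Q n (f n) (f (Suc n))) \<and> f 0 = (x0, \<phi>)" by (rule exE)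
  then have f: "?P n (f n)" "?Q n (f n) (f (Suc n))" "f 0 = (x0, \<phi>)" for n by simp_all
  define xs where "xs n = fst (f n)" for n
  define F where "F n = snd (f n)" for n
  have x0: "xs 0 = x0" and F0: "F 0 = \<phi>" using f(3) by (auto simp: xs_def F_def)
  have xsE: "xs n \<in> E" and opt: "\<And>u. u \<in> E \<Longrightarrow> F n (xs n) \<le> F n u + e n" for n
    using f(1)[of n] by (auto simp: xs_def F_def case_prod_beta)
  have FS: "F (Suc n) = (\<lambda>u. F n u + m n * \<theta> n (u - xs n))" for n
    using f(2)[of n] by (auto simp: xs_def F_def case_prod_beta)
  have Fsum: "F n u = \<phi> u + (\<Sum>k<n. m k * \<theta> k (u - xs k))" for n u
    by (induction n) (simp_all add: F0 FS)
  \<comment> \<open>The two near-minimality errors and the negativity of \<open>\<theta> n\<close>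
    add up to \<open>7/4 * e n\<close>, while \<open>m n\<close> times the right-hand side is
    \<open>5/2 * e n\<close>. Summing the geometric series turns 5 into the 10 of the
    statement.\<close>
  have step: "norm (xs (Suc n) - xs n) \<le> 5 * (\<eta> / \<mu>) * (1/2) ^ n" for n
  proof -
    let ?d = "xs (Suc n) - xs n"
    have "\<theta> n 0 \<le> 0" using \<theta>(2)[of n 0] by simp
    then have "F (Suc n) (xs n) \<le> F n (xs n)" using m[of n] by (simp add: FS mult_nonneg_nonpos)
    moreover have "m n * (norm ?d - \<eta> / \<mu> / 2 ^ n) \<le> m n * \<theta> n ?d"
      using \<theta>(1)[of ?d n] m[of n] by (intro mult_left_mono) auto
    moreover have "F (Suc n) (xs (Suc n)) = F n (xs (Suc n)) + m n * \<theta> n ?d" by (simp add: FS)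
    ultimately have "m n * (norm ?d - \<eta> / \<mu> / 2 ^ n) \<le> e n + e (Suc n)"
      using opt[of "xs n" "Suc n"] opt[of "xs (Suc n)" n] xsE by (smt (verit))
    then have "m n * norm ?d \<le> e n + e (Suc n) + e n / 2" unfolding right_diff_distrib mc by linarith
    also have "\<dots> \<le> m n * (5 * (\<eta> / \<mu>) * (1/2) ^ n)"
    proof -
      have "m n * (5 * (\<eta> / \<mu>) * (1/2) ^ n) = 5 * (m n * (\<eta> / \<mu> / 2 ^ n))" by (simp add: power_divide)
      also have "\<dots> = 5 * (e n / 2)" by (simp only: mc)
      finally show ?thesis using e[of n] by (simp add: e_def)
    qed
    finally show ?thesis using m[of n] by (simp only: mult_le_cancel_left_pos)
  qed
  have geo: "summable (\<lambda>n. 5 * (\<eta> / \<mu>) * (1/2::real) ^ n)" by (intro summable_mult summable_geometric) simp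
  have sn: "summable (\<lambda>n. norm (xs (Suc n) - xs n))"
    by (rule summable_comparison_test'[OF geo, of 0]) (simp only: real_norm_def abs_norm_cancel step)
  then have sd: "summable (\<lambda>n. xs (Suc n) - xs n)" by (rule summable_norm_cancel)
  define y where "y = x0 + (\<Sum>n. xs (Suc n) - xs n)"
  have tel: "(\<Sum>k<n. xs (Suc k) - xs k) = xs n - x0" for n using sum_lessThan_telescope[of xs n] x0 by simp
  have lim: "xs \<longlonglongrightarrow> y"
  proof -
    have "(\<lambda>n. xs n - x0) \<longlonglongrightarrow> (\<Sum>n. xs (Suc n) - xs n)" using summable_LIMSEQ[OF sd] by (simp only: tel)
    then have "(\<lambda>n. x0 + (xs n - x0)) \<longlonglongrightarrow> y" unfolding y_def by (intro tendsto_intros)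
    then show ?thesis by simp
  qed
  have yE: "y \<in> E" using E(1) lim xsE closed_sequentially by blast
  have ydist: "norm (y - x0) \<le> 10 * (\<eta> / \<mu>)"
  proof -
    have "norm (y - x0) \<le> (\<Sum>n. norm (xs (Suc n) - xs n))" using summable_norm[OF sn] by (simp add: y_def)
    also have "\<dots> \<le> (\<Sum>n. 5 * (\<eta> / \<mu>) * (1/2::real) ^ n)" by (rule suminf_le[OF step sn geo])
    also have "\<dots> = 10 * (\<eta> / \<mu>)" by (subst suminf_mult) (auto simp: suminf_geometric)
    finally show ?thesis .
  qed
  have msum: "(\<lambda>n. c / 2 ^ Suc n) sums c" for c :: real
    using sums_mult[OF power_half_series, of c] by (simp add: power_divide)
  have summ: "summable (\<lambda>n. m n * \<theta> n (u - xs n))" for u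
  proof -
    have "bounded (range xs)" using lim convergent_imp_bounded by blast
    then obtain B where B: "\<And>n. norm (xs n) \<le> B" by (auto simp: bounded_iff)
    have "norm (m n * \<theta> n (u - xs n)) \<le> \<mu> * (norm u + B + \<eta> / \<mu>) / 2 ^ Suc n" for n
    proof -
      have "\<eta> / \<mu> / 2 ^ n \<le> \<eta> / \<mu>" using \<eta> \<mu> by (simp add: field_simps)
      then have "\<bar>\<theta> n (u - xs n)\<bar> \<le> norm u + B + \<eta> / \<mu>"
        using \<theta>(1)[of "u - xs n" n] \<theta>(2)[of n "u - xs n"] norm_triangle_ineq4[of u "xs n"] B[of n]
          norm_ge_zero[of "u - xs n"] norm_ge_zero[of u] norm_ge_zero[of "xs n"] divide_pos_pos[OF \<eta> \<mu>] by linarith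
      then have "m n * \<bar>\<theta> n (u - xs n)\<bar> \<le> m n * (norm u + B + \<eta> / \<mu>)" using m[of n] by (intro mult_left_mono) auto
      moreover have "norm (m n * \<theta> n (u - xs n)) = m n * \<bar>\<theta> n (u - xs n)\<bar>" using m[of n] by (simp add: abs_mult)
      moreover have "m n * (norm u + B + \<eta> / \<mu>) = \<mu> * (norm u + B + \<eta> / \<mu>) / 2 ^ Suc n" by (simp add: m_def)
      ultimately show ?thesis by simp
    qed
    then show ?thesis by (rule summable_comparison_test'[OF sums_summable[OF msum], of 0])
  qed
  have "\<phi> y + (\<Sum>n. m n * \<theta> n (y - xs n)) \<le> \<phi> u + (\<Sum>n. m n * \<theta> n (u - xs n))" if u: "u \<in> E" for u
  proof -
    have FL: "F n a - F n b \<le> (L + \<mu>) * norm (a - b)" for n a b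
    proof -
      have "F n a - F n b = (\<phi> a - \<phi> b) + (\<Sum>k<n. m k * (\<theta> k (a - xs k) - \<theta> k (b - xs k)))"
        by (simp add: Fsum sum_subtractf right_diff_distrib)
      also have "\<dots> \<le> L * norm (a - b) + (\<Sum>k<n. m k * norm (a - b))"
      proof (intro add_mono lip sum_mono mult_left_mono)
        show "\<theta> k (a - xs k) - \<theta> k (b - xs k) \<le> norm (a - b)" for k
          using \<theta>_lip[of k "a - xs k" "b - xs k"] by simp
      qed (use m less_imp_le in auto)
      also have "(\<Sum>k<n. m k * norm (a - b)) = (\<Sum>k<n. m k) * norm (a - b)" by (simp add: sum_distrib_right)
      also have "\<dots> \<le> \<mu> * norm (a - b)"
      proof (rule mult_right_mono)
        have "(\<Sum>k<n. m k) \<le> suminf m" using msum[of \<mu>] m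
          by (intro sum_le_suminf) (auto simp: m_def[abs_def] sums_iff less_imp_le)
        then show "(\<Sum>k<n. m k) \<le> \<mu>" using msum[of \<mu>] by (simp add: m_def[abs_def] sums_iff)
      qed simp
      finally show ?thesis by (simp add: distrib_right)
    qed
    \<comment> \<open>The point \<open>xs n\<close> links \<open>y\<close> to \<open>u\<close>:
      Lipschitz continuity of \<open>F n\<close> between \<open>y\<close> and \<open>xs n\<close>,
      near-minimality against \<open>u\<close>, and a lower bound for the tail of the series, whose
      terms may be negative.\<close>
    have low: "F n y - (L + \<mu>) * norm (y - xs n) - e n - \<eta> * (1/2) ^ n \<le> \<phi> u + (\<Sum>n. m n * \<theta> n (u - xs n))" for n
    proof -
      let ?a = "\<lambda>n. m n * \<theta> n (u - xs n)"
      have sp: "(\<Sum>n. ?a n) = (\<Sum>k. ?a (k + n)) + (\<Sum>k<n. ?a k)" by (rule suminf_split_initial_segment[OF summ])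
      have t: "(\<lambda>k. - (\<eta> * (1/2) ^ n) / 2 ^ Suc k) sums (- (\<eta> * (1/2) ^ n))" by (rule msum)
      have sh: "summable (\<lambda>k. ?a (k + n))" using summ[of u] by (subst summable_iff_shift)
      have "- (\<eta> * (1/2) ^ n) / 2 ^ Suc k \<le> ?a (k + n)" for k
      proof -
        have "- (\<eta> / \<mu> / 2 ^ (k + n)) \<le> \<theta> (k + n) (u - xs (k + n))"
          using \<theta>(1)[of "u - xs (k + n)" "k + n"] norm_ge_zero[of "u - xs (k + n)"] by linarith
        then have "m (k + n) * (- (\<eta> / \<mu> / 2 ^ (k + n))) \<le> ?a (k + n)"
          using m[of "k + n"] by (intro mult_left_mono) auto
        then have "- (e (k + n) / 2) \<le> ?a (k + n)" using mc[of "k + n"] by simp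
        moreover have "e (k + n) / 2 \<le> (\<eta> * (1/2) ^ n) / 2 ^ Suc k"
        proof -
          have "(2::real) ^ (k + n) \<le> 4 ^ (k + n)" by (intro power_mono) auto
          then have "\<eta> / 4 ^ (k + n) / 2 \<le> \<eta> / 2 ^ (k + n) / 2"
            using \<eta> by (intro divide_right_mono divide_left_mono) auto
          also have "\<dots> = (\<eta> * (1/2) ^ n) / 2 ^ Suc k"
            by (simp add: power_add power_divide field_simps)
          finally show ?thesis unfolding e_def .
        qed
        ultimately show ?thesis by simp
      qed
      then have "- (\<eta> * (1/2) ^ n) \<le> (\<Sum>k. ?a (k + n))"
        by (rule sums_le[OF _ t summable_sums[OF sh]])
      moreover have "F n (xs n) \<le> F n u + e n" using opt[OF u] .
      moreover have "F n y - F n (xs n) \<le> (L + \<mu>) * norm (y - xs n)" by (rule FL)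
      ultimately show ?thesis using sp Fsum[of n u] by linarith
    qed
    have "(\<lambda>n. F n y - (L + \<mu>) * norm (y - xs n) - e n - \<eta> * (1/2) ^ n)
        \<longlonglongrightarrow> (\<phi> y + (\<Sum>n. m n * \<theta> n (y - xs n))) - (L + \<mu>) * norm (y - y) - \<eta> * 0 - \<eta> * 0"
    proof (intro tendsto_diff tendsto_mult tendsto_const tendsto_norm lim)
      show "(\<lambda>n. F n y) \<longlonglongrightarrow> \<phi> y + (\<Sum>n. m n * \<theta> n (y - xs n))"
        unfolding Fsum by (intro tendsto_add tendsto_const summable_LIMSEQ summ)
      have "(\<lambda>n. \<eta> * (1/4::real) ^ n) \<longlonglongrightarrow> \<eta> * 0" by (intro tendsto_mult tendsto_const LIMSEQ_power_zero) simp
      then show "e \<longlonglongrightarrow> \<eta> * 0" by (simp add: e_def[abs_def] power_divide)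
      show "(\<lambda>n. (1/2::real) ^ n) \<longlonglongrightarrow> 0" by (rule LIMSEQ_power_zero) simp
    qed
    then show ?thesis using low by (intro LIMSEQ_le_const2) auto
  qed
  then show ?thesis using yE xsE ydist summ unfolding m_def by (intro exI[of _ xs] exI[of _ y]) simp
qed

section \<open>Superdifferentials of sums and the minimum rule relative to a subspace\<close>

text \<open>Finitely many terms are handled by their own superdifferentials, the tail by its
  Lipschitz constants, whose sum is small.\<close>

lemma superdiff_suminf:
  fixes a :: "nat \<Rightarrow> 'a::real_normed_vector \<Rightarrow> real"
  assumes lip: "\<And>n u v. a n u - a n v \<le> m n * norm (u - v)" and m: "\<And>n. m n \<ge> 0" "summable m"
    and sa: "\<And>u. summable (\<lambda>n. a n u)" and p: "\<And>n. linear (p n)" "\<And>n h. \<bar>p n h\<bar> \<le> m n * norm h"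
    and sd: "\<And>n. superdiff V (a n) y (p n)"
  shows "linear (\<lambda>h. \<Sum>n. p n h)" "\<bar>\<Sum>n. p n h\<bar> \<le> suminf m * norm h"
    "superdiff V (\<lambda>u. \<Sum>n. a n u) y (\<lambda>h. \<Sum>n. p n h)"
proof -
  have sm: "summable (\<lambda>n. m n * norm h)" for h :: 'a by (rule summable_mult2[OF m(2)])
  have sp': "summable (\<lambda>n. \<bar>p n h\<bar>)" for h
    by (rule summable_comparison_test'[OF sm[of h], of 0]) (simp add: p(2))
  then have sp: "summable (\<lambda>n. p n h)" for h by (rule summable_rabs_cancel)
  show "linear (\<lambda>h. \<Sum>n. p n h)"
    by (rule linearI) (simp_all add: linear_add[OF p(1)] linear_scale[OF p(1)] suminf_add[OF sp sp] suminf_mult[OF sp])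
  have "\<bar>\<Sum>n. p n h\<bar> \<le> (\<Sum>n. \<bar>p n h\<bar>)" by (rule summable_rabs[OF sp'])
  also have "\<dots> \<le> (\<Sum>n. m n * norm h)" by (rule suminf_le[OF p(2) sp' sm])
  also have "\<dots> = suminf m * norm h" by (rule suminf_mult2[OF m(2), symmetric])
  finally show "\<bar>\<Sum>n. p n h\<bar> \<le> suminf m * norm h" .
  show "superdiff V (\<lambda>u. \<Sum>n. a n u) y (\<lambda>h. \<Sum>n. p n h)"
    unfolding superdiff_def
  proof (intro allI impI)
    fix \<epsilon> :: real assume \<epsilon>: "\<epsilon> > 0"
    \<comment> \<open>A tail term and its linear part together contribute
      \<open>2 * m n * norm h\<close>, so a tail sum below \<open>\<epsilon> / 4\<close> costs
      \<open>\<epsilon> / 2\<close>; the first \<open>N\<close> terms share the other half.\<close>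
    have "(\<lambda>N. \<Sum>n. m (n + N)) \<longlonglongrightarrow> 0" by (rule suminf_exist_split2[OF m(2)])
    then have "eventually (\<lambda>N. (\<Sum>n. m (n + N)) < \<epsilon> / 4) sequentially" using \<epsilon> by (intro order_tendstoD(2)) auto
    then obtain N where N: "(\<Sum>n. m (n + N)) < \<epsilon> / 4" by (auto simp: eventually_sequentially)
    have "\<forall>n. \<exists>\<delta>>0. \<forall>h\<in>V. norm h < \<delta> \<longrightarrow> a n (y + h) - a n y \<le> p n h + \<epsilon> / (2 * (real N + 1)) * norm h"
      using sd \<epsilon> unfolding superdiff_def by (metis add_nonneg_pos divide_pos_pos mult_pos_pos of_nat_0_le_iff zero_less_numeral zero_less_one)
    then obtain \<delta> where \<delta>: "\<And>n. \<delta> n > 0"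
      "\<And>n h. h \<in> V \<Longrightarrow> norm h < \<delta> n \<Longrightarrow> a n (y + h) - a n y \<le> p n h + \<epsilon> / (2 * (real N + 1)) * norm h" by metis
    define d where "d = Min (insert 1 (\<delta> ` {..<N}))"
    have d: "d > 0" using \<delta>(1) by (auto simp: d_def)
    have dle: "d \<le> \<delta> n" if "n < N" for n using that by (auto simp: d_def)
    have "(\<Sum>n. a n (y + h)) - (\<Sum>n. a n y) \<le> (\<Sum>n. p n h) + \<epsilon> * norm h" if h: "h \<in> V" "norm h < d" for h
    proof -
      let ?b = "\<lambda>n. a n (y + h) - a n y - p n h"
      have sb: "summable ?b" by (intro summable_diff sa sp)
      have eq: "(\<Sum>n. ?b n) = (\<Sum>n. a n (y + h)) - (\<Sum>n. a n y) - (\<Sum>n. p n h)"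
        by (subst suminf_diff[symmetric] | intro summable_diff sa sp refl)+
      have "(\<Sum>n. ?b n) = (\<Sum>n. ?b (n + N)) + (\<Sum>n<N. ?b n)" by (rule suminf_split_initial_segment[OF sb])
      moreover have "(\<Sum>n<N. ?b n) \<le> \<epsilon> / 2 * norm h"
      proof -
        have "(\<Sum>n<N. ?b n) \<le> (\<Sum>n<N. \<epsilon> / (2 * (real N + 1)) * norm h)"
        proof (rule sum_mono)
          fix n assume "n \<in> {..<N}"
          then have "norm h < \<delta> n" using dle[of n] h(2) by simp
          then show "?b n \<le> \<epsilon> / (2 * (real N + 1)) * norm h" using \<delta>(2)[OF h(1)] by fastforce
        qed
        also have "\<dots> = (real N / (real N + 1)) * (\<epsilon> / 2 * norm h)" by simp
        also have "\<dots> \<le> 1 * (\<epsilon> / 2 * norm h)" using \<epsilon> by (intro mult_right_mono) auto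
        finally show ?thesis by simp
      qed
      moreover have "(\<Sum>n. ?b (n + N)) \<le> \<epsilon> / 2 * norm h"
      proof -
        have sh: "summable (\<lambda>n. m (n + N))" using m(2) by (simp add: summable_iff_shift)
        have "(\<Sum>n. ?b (n + N)) \<le> (\<Sum>n. m (n + N) * (2 * norm h))"
        proof (rule suminf_le)
          show "?b (n + N) \<le> m (n + N) * (2 * norm h)" for n
            using lip[of "n + N" "y + h" y] p(2)[of "n + N" h] by simp
          show "summable (\<lambda>n. ?b (n + N))" using sb by (subst summable_iff_shift)
          show "summable (\<lambda>n. m (n + N) * (2 * norm h))" by (rule summable_mult2[OF sh])
        qed
        also have "\<dots> = (\<Sum>n. m (n + N)) * (2 * norm h)" by (rule suminf_mult2[OF sh, symmetric])
        also have "\<dots> \<le> \<epsilon> / 4 * (2 * norm h)" using N by (intro mult_right_mono) auto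
        finally show ?thesis by simp
      qed
      ultimately show ?thesis using eq by linarith
    qed
    then show "\<exists>\<delta>>0. \<forall>h\<in>V. norm h < \<delta> \<longrightarrow> (\<Sum>n. a n (y + h)) - (\<Sum>n. a n y) \<le> (\<Sum>n. p n h) + \<epsilon> * norm h"
      using d by blast
  qed
qed

lemma superdiff_scale:
  assumes "superdiff V S x p" "c > 0"
  shows "superdiff V (\<lambda>u. c * S u) x (\<lambda>h. c * p h)"
  unfolding superdiff_def
proof (intro allI impI)
  fix \<epsilon> :: real assume "\<epsilon> > 0"
  then have "\<epsilon> / c > 0" using assms by simp
  then obtain \<delta> where \<delta>: "\<delta> > 0" "\<And>h. h \<in> V \<Longrightarrow> norm h < \<delta> \<Longrightarrow> S (x + h) - S x \<le> p h + \<epsilon> / c * norm h"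
    using assms(1) unfolding superdiff_def by blast
  have "c * S (x + h) - c * S x \<le> c * p h + \<epsilon> * norm h" if "h \<in> V" "norm h < \<delta>" for h
  proof -
    have "c * (S (x + h) - S x) \<le> c * (p h + \<epsilon> / c * norm h)" using \<delta>(2)[OF that] assms(2) by (intro mult_left_mono) auto
    then show ?thesis using assms(2) by (simp add: algebra_simps)
  qed
  then show "\<exists>\<delta>>0. \<forall>h\<in>V. norm h < \<delta> \<longrightarrow> c * S (x + h) - c * S x \<le> c * p h + \<epsilon> * norm h" using \<delta>(1) by blast
qed

lemma superdiff_shift:
  assumes "superdiff V S (x - z) p"
  shows "superdiff V (\<lambda>u. S (u - z)) x p"
  using assms by (simp add: superdiff_def algebra_simps)

text \<open>The variational principle is applied to the smooth approximation of \<open>s\<close>,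
  translated to \<open>xb\<close>, over the part of \<open>\<Omega> \<inter> V\<close> near
  \<open>xb\<close>. The resulting functional is normal only relative to
  \<open>\<Omega> \<inter> V\<close>.\<close>

lemma fuzzy_minimum_separable:
  fixes V :: "'a::banach set"
  assumes sep: "separable_dual V D g" and cV: "closed V" and O: "closed \<Omega>"
    and s: "sublin s" and M: "M \<ge> 0" "\<And>x. s x \<le> M * norm x" and xb: "xb \<in> \<Omega>" "xb \<in> V"
    and r: "r > 0" "\<forall>x\<in>\<Omega>. norm (x - xb) < r \<longrightarrow> s (x - xb) \<ge> 0" and \<epsilon>: "\<epsilon> > 0"
  shows "\<exists>x b. x \<in> \<Omega> \<and> x \<in> V \<and> norm (x - xb) < \<epsilon> \<and> linear b \<and> (\<forall>h. - b h \<le> s h + \<epsilon> * norm h) \<and>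
    (\<forall>\<tau>>0. \<exists>\<delta>>0. \<forall>u\<in>\<Omega> \<inter> V. norm (u - x) < \<delta> \<longrightarrow> b (u - x) \<le> \<tau> * norm (u - x))"
proof -
  interpret separable_dual V D g by (rule sep)
  \<comment> \<open>Then \<open>10 * (\<eta> / \<epsilon>)\<close> is half of
    \<open>min \<epsilon> (r/2)\<close>: the new point stays within \<open>r / 4\<close> of
    \<open>xb\<close>, so the restriction to \<open>cball xb (r/2)\<close> is inactive near
    it.\<close>
  define \<eta> where "\<eta> = \<epsilon> * min \<epsilon> (r/2) / 20"
  have \<eta>: "\<eta> > 0" using \<epsilon> r by (simp add: \<eta>_def)
  have \<eta>\<epsilon>: "10 * (\<eta> / \<epsilon>) < \<epsilon>" "10 * (\<eta> / \<epsilon>) \<le> r / 4" using \<epsilon> r by (auto simp: \<eta>_def)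
  obtain S where S: "\<And>x. s x - \<eta> \<le> S x" "\<And>x. S x \<le> s x" "\<And>x y. S x - S y \<le> M * norm (x - y)"
      "\<And>x. x \<in> V \<Longrightarrow> \<exists>p. linear p \<and> (\<forall>y. p y \<le> s y) \<and> superdiff V S x p"
    using smooth_approximation[OF s M \<eta>] by metis
  have "\<forall>n. \<exists>T. (\<forall>x. norm x - \<eta> / \<epsilon> / 2 ^ n \<le> T x \<and> T x \<le> norm x) \<and> (\<forall>x y. T x - T y \<le> norm (x - y)) \<and>
      (\<forall>x\<in>V. \<exists>p. linear p \<and> (\<forall>y. p y \<le> norm y) \<and> superdiff V T x p)"
    using smooth_approximation[of norm 1 "\<eta> / \<epsilon> / 2 ^ n" for n] \<eta> \<epsilon> sublin_norm[of 1, where 'a = 'a] by simp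
  then obtain \<theta> where \<theta>: "\<And>n x. norm x - \<eta> / \<epsilon> / 2 ^ n \<le> \<theta> n x" "\<And>n x. \<theta> n x \<le> norm x"
      "\<And>n x y. \<theta> n x - \<theta> n y \<le> norm (x - y)"
      "\<And>n x. x \<in> V \<Longrightarrow> \<exists>p. linear p \<and> (\<forall>y. p y \<le> norm y) \<and> superdiff V (\<theta> n) x p"
    by metis
  define E where "E = \<Omega> \<inter> V \<inter> cball xb (r/2)"
  have E: "closed E" "xb \<in> E" using O cV xb r by (auto simp: E_def)
  define \<phi> where "\<phi> u = S (u - xb)" for u
  have min: "\<phi> xb \<le> \<phi> u + \<eta>" if "u \<in> E" for u
  proof -
    have "norm (u - xb) < r" using that r(1) by (auto simp: E_def dist_norm norm_minus_commute)
    then have "s (u - xb) \<ge> 0" using r(2) that by (auto simp: E_def)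
    then show ?thesis using S(1)[of "u - xb"] S(2)[of 0] sublin_0[OF s] by (simp add: \<phi>_def)
  qed
  have lip: "\<phi> u - \<phi> v \<le> M * norm (u - v)" for u v using S(3)[of "u - xb" "v - xb"] by (simp add: \<phi>_def)
  have "\<forall>u\<in>E. \<phi> xb \<le> \<phi> u + \<eta>" using min by blast
  from smooth_variational_principle[OF E lip M(1) this \<eta> \<epsilon> \<theta>(1,2,3)]
  obtain xs y where BP: "y \<in> E \<and> (\<forall>n. xs n \<in> E) \<and> norm (y - xb) \<le> 10 * (\<eta> / \<epsilon>) \<and>
    (\<forall>u. summable (\<lambda>n. \<epsilon> / 2 ^ Suc n * \<theta> n (u - xs n))) \<and>
    (\<forall>u\<in>E. \<phi> y + (\<Sum>n. \<epsilon> / 2 ^ Suc n * \<theta> n (y - xs n)) \<le> \<phi> u + (\<Sum>n. \<epsilon> / 2 ^ Suc n * \<theta> n (u - xs n)))"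
    by (elim exE) simp
  then have y: "y \<in> E" and xs: "\<And>n. xs n \<in> E" and yd: "norm (y - xb) \<le> 10 * (\<eta> / \<epsilon>)"
    and summ: "\<And>u. summable (\<lambda>n. \<epsilon> / 2 ^ Suc n * \<theta> n (u - xs n))"
    and opt: "\<And>u. u \<in> E \<Longrightarrow> \<phi> y + (\<Sum>n. \<epsilon> / 2 ^ Suc n * \<theta> n (y - xs n)) \<le> \<phi> u + (\<Sum>n. \<epsilon> / 2 ^ Suc n * \<theta> n (u - xs n))"
    by blast+
  have yV: "y \<in> V" "y \<in> \<Omega>" using y by (auto simp: E_def)
  have dV: "y - xs n \<in> V" for n using yV xs[of n] subspace_diff[OF subspace_V] by (auto simp: E_def)
  define m where "m n = \<epsilon> / 2 ^ Suc n" for n :: nat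
  have m: "m n > 0" for n using \<epsilon> by (simp add: m_def)
  have ms: "m sums \<epsilon>" using sums_mult[OF power_half_series, of \<epsilon>] by (simp add: power_divide m_def[abs_def])
  define a where "a n u = m n * \<theta> n (u - xs n)" for n u
  have "\<forall>n. \<exists>p. linear p \<and> (\<forall>y. p y \<le> norm y) \<and> superdiff V (\<theta> n) (y - xs n) p" using \<theta>(4)[OF dV] by blast
  then obtain q where q: "\<And>n. linear (q n)" "\<And>n h. q n h \<le> norm h" "\<And>n. superdiff V (\<theta> n) (y - xs n) (q n)"
    by metis
  define p2 where "p2 n h = m n * q n h" for n h
  have 1: "superdiff V (a n) y (p2 n)" for n
    unfolding a_def[abs_def] p2_def[abs_def] by (intro superdiff_scale superdiff_shift q m)
  have 2: "linear (p2 n)" for n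
    unfolding p2_def[abs_def] using linear_compose_scale_right[OF q(1)[of n], of "m n"] by simp
  have 3: "\<bar>p2 n h\<bar> \<le> m n * norm h" for n h
  proof -
    have "\<bar>q n h\<bar> \<le> 1 * norm h" using q(2) by (intro bounded_linear_below q) simp
    then show ?thesis using m[of n] by (simp add: p2_def abs_mult)
  qed
  have 4: "a n u - a n v \<le> m n * norm (u - v)" for n u v
  proof -
    have "m n * (\<theta> n (u - xs n) - \<theta> n (v - xs n)) \<le> m n * norm (u - v)"
      using \<theta>(3)[of n "u - xs n" "v - xs n"] m[of n] by (intro mult_left_mono) auto
    then show ?thesis by (simp add: a_def right_diff_distrib)
  qed
  have 5: "summable (\<lambda>n. a n u)" for u using summ[of u] by (simp add: a_def m_def)
  define P where "P h = (\<Sum>n. p2 n h)" for h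
  have P: "linear P" "\<bar>P h\<bar> \<le> \<epsilon> * norm h" "superdiff V (\<lambda>u. \<Sum>n. a n u) y P" for h
    using superdiff_suminf[OF 4 less_imp_le[OF m] sums_summable[OF ms] 5 2 3 1] ms
    by (auto simp: P_def[abs_def] sums_iff)
  have "y - xb \<in> V" using yV xb subspace_diff[OF subspace_V] by auto
  then obtain p where p: "linear p" "\<And>h. p h \<le> s h" "superdiff V S (y - xb) p" using S(4) by blast
  have p': "superdiff V \<phi> y p" unfolding \<phi>_def[abs_def] by (rule superdiff_shift[OF p(3)])
  \<comment> \<open>At the minimiser \<open>y\<close>, the increment towards \<open>u\<close> is
    nonnegative and at most \<open>p h + P h\<close> plus a small multiple of \<open>norm h\<close>,
    where \<open>h = u - y\<close>; this is the normal inequality for \<open>b\<close>. The bounds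
    on \<open>p\<close> and \<open>P\<close> give the domination by \<open>s\<close>.\<close>
  define b where "b h = - (p h + P h)" for h
  have "linear b" unfolding b_def[abs_def] by (intro linear_compose_neg linear_compose_add p P)
  moreover have "- b h \<le> s h + \<epsilon> * norm h" for h using p(2)[of h] P(2)[of h] by (simp add: b_def)
  moreover have "\<exists>\<delta>>0. \<forall>u\<in>\<Omega> \<inter> V. norm (u - y) < \<delta> \<longrightarrow> b (u - y) \<le> \<tau> * norm (u - y)" if \<tau>: "\<tau> > 0" for \<tau>
  proof -
    have \<tau>2: "\<tau> / 2 > 0" using \<tau> by simp
    obtain d1 where d1: "d1 > 0" "\<And>h. h \<in> V \<Longrightarrow> norm h < d1 \<Longrightarrow> \<phi> (y + h) - \<phi> y \<le> p h + \<tau> / 2 * norm h"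
      using p'[unfolded superdiff_def, rule_format, OF \<tau>2] by blast
    obtain d2 where d2: "d2 > 0" "\<And>h. h \<in> V \<Longrightarrow> norm h < d2 \<Longrightarrow>
        (\<Sum>n. a n (y + h)) - (\<Sum>n. a n y) \<le> P h + \<tau> / 2 * norm h"
      using P(3)[unfolded superdiff_def, rule_format, OF \<tau>2] by blast
    have "b (u - y) \<le> \<tau> * norm (u - y)" if u: "u \<in> \<Omega>" "u \<in> V" "norm (u - y) < min (r/4) (min d1 d2)" for u
    proof -
      have "norm (u - xb) \<le> norm (u - y) + norm (y - xb)" using norm_triangle_ineq[of "u - y" "y - xb"] by simp
      then have "norm (u - xb) \<le> r / 2" using u(3) yd \<eta>\<epsilon>(2) by simp
      then have "u \<in> E" using u by (simp add: E_def dist_norm norm_minus_commute)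
      then have "\<phi> y + (\<Sum>n. a n y) \<le> \<phi> u + (\<Sum>n. a n u)" using opt by (simp add: a_def m_def)
      moreover have "u - y \<in> V" using u yV subspace_diff[OF subspace_V] by blast
      ultimately show ?thesis using d1(2)[of "u - y"] d2(2)[of "u - y"] u(3) by (simp add: b_def)
    qed
    then show ?thesis using r(1) d1(1) d2(1) by (intro exI[of _ "min (r/4) (min d1 d2)"]) auto
  qed
  moreover have "norm (y - xb) < \<epsilon>" using yd \<eta>\<epsilon>(1) by simp
  ultimately show ?thesis using yV by blast
qed

section \<open>Separable reduction\<close>

text \<open>A binary \<open>\<Phi>\<close> accommodates sums; rational multiples and witness points
  depend on one argument only.\<close>

lemma countable_closed_superset:
  fixes \<Phi> :: "'a \<Rightarrow> 'a \<Rightarrow> 'a set"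
  assumes C: "countable C" and \<Phi>: "\<And>x y. countable (\<Phi> x y)"
  shows "\<exists>D. countable D \<and> C \<subseteq> D \<and> (\<forall>x\<in>D. \<forall>y\<in>D. \<Phi> x y \<subseteq> D)"
proof -
  define S where "S n = ((\<lambda>A. A \<union> (\<Union>x\<in>A. \<Union>y\<in>A. \<Phi> x y)) ^^ n) C" for n
  have S0: "S 0 = C" and SS: "S (Suc n) = S n \<union> (\<Union>x\<in>S n. \<Union>y\<in>S n. \<Phi> x y)" for n
    by (auto simp: S_def)
  have cS: "countable (S n)" for n by (induction n) (auto simp: S0 SS C \<Phi>)
  have mono: "S m \<subseteq> S n" if "m \<le> n" for m n using lift_Suc_mono_le[of S m n, OF _ that] SS by blast
  have "\<Phi> x y \<subseteq> (\<Union>n. S n)" if "x \<in> S m" "y \<in> S n" for x y m n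
  proof -
    have "x \<in> S (max m n)" "y \<in> S (max m n)" using that mono[of m "max m n"] mono[of n "max m n"] by auto
    then have "\<Phi> x y \<subseteq> S (Suc (max m n))" by (auto simp: SS)
    then show ?thesis by blast
  qed
  moreover have "countable (\<Union>n. S n)" using cS by blast
  ultimately show ?thesis using S0 by (intro exI[of _ "\<Union>n. S n"]) blast
qed

text \<open>Rational scalars allow \<open>D\<close> to be countable; real scalars are recovered in
  the closure.\<close>

lemma subspace_closure_rational:
  fixes D :: "'a::real_normed_vector set"
  assumes 0: "0 \<in> D" and add: "\<And>x y. x \<in> D \<Longrightarrow> y \<in> D \<Longrightarrow> x + y \<in> D"
    and sc: "\<And>q x. q \<in> \<rat> \<Longrightarrow> x \<in> D \<Longrightarrow> q *\<^sub>R x \<in> D"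
  shows "subspace (closure D)"
  unfolding subspace_def
proof (intro conjI ballI allI)
  show "0 \<in> closure D" using 0 closure_subset by blast
  fix x assume "x \<in> closure D"
  then obtain f where f: "\<And>n. f n \<in> D" "f \<longlonglongrightarrow> x" by (auto simp: closure_sequential)
  {
    fix y assume "y \<in> closure D"
    then obtain h where h: "\<And>n. h n \<in> D" "h \<longlonglongrightarrow> y" by (auto simp: closure_sequential)
    have "(\<lambda>n. f n + h n) \<longlonglongrightarrow> x + y" by (intro tendsto_intros f h)
    then show "x + y \<in> closure D" using f(1) h(1) add
      unfolding closure_sequential by (intro exI[of _ "\<lambda>n. f n + h n"]) simp
  }
  fix c :: real
  have "c \<in> closure \<rat>" by (simp add: Rats_closure_real)
  then obtain q where q: "\<And>n. q n \<in> \<rat>" "q \<longlonglongrightarrow> c" by (auto simp: closure_sequential)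
  have "(\<lambda>n. q n *\<^sub>R f n) \<longlonglongrightarrow> c *\<^sub>R x" by (intro tendsto_intros f q)
  then show "c *\<^sub>R x \<in> closure D" using f(1) q(1) sc
    unfolding closure_sequential by (intro exI[of _ "\<lambda>n. q n *\<^sub>R f n"]) simp
qed

section \<open>Defects of finite systems of slope inequalities\<close>

lemma cone_sum_mono:
  fixes f h :: "'i \<Rightarrow> real"
  assumes "in_cone A T" "\<And>i. i \<in> A \<Longrightarrow> f i \<le> h i"
  shows "cone_sum f T \<le> cone_sum h T"
  using assms
proof (induction T)
  case (Cons t T) then show ?case by (cases t) (auto intro!: add_mono mult_left_mono)
qed simp

lemma cone_sum_nonneg:
  fixes f :: "'i \<Rightarrow> real"
  assumes "in_cone A T" "\<And>i. i \<in> A \<Longrightarrow> f i \<ge> 0"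
  shows "cone_sum f T \<ge> 0"
  using assms
proof (induction T)
  case (Cons t T) then show ?case by (cases t) auto
qed simp

lemma linear_cone_sum: "linear b \<Longrightarrow> b (cone_sum \<alpha> T) = cone_sum (\<lambda>i. b (\<alpha> i)) T"
  by (induction T) (auto simp: linear_0 linear_add linear_scale)

lemma cone_sum_shift: "cone_sum (\<lambda>i. \<alpha> i + z) T = cone_sum \<alpha> T + cone_sum (\<lambda>_. 1) T *\<^sub>R z"
  by (induction T) (auto simp: algebra_simps)

lemma in_cone_subset: "in_cone A T \<Longrightarrow> (\<And>l i. (l, i) \<in> set T \<Longrightarrow> i \<in> B) \<Longrightarrow> in_cone B T"
  by (auto simp: in_cone_def)

text \<open>
  By the Hahn-Banach theorem, a Frechet normal \<open>b\<close> to \<open>\<Omega>\<close> at \<open>x\<close> with \<open>- b \<le> s\<close> exists iff, for suitable radii \<open>\<delta> m\<close>,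
  the defect is nonnegative on all lists of weighted pairs \<open>(u, m)\<close> with \<open>u \<in> \<Omega>\<close> and \<open>norm (u - x) < \<delta> m\<close>.
  A violation involves only finitely many radii, so that countably many witnesses of violations suffice
  to build a separable subspace \<open>V\<close> for which the condition relative to \<open>V\<close> implies the condition in the whole space.
\<close>

definition slope_defect :: "('a::real_normed_vector \<Rightarrow> real) \<Rightarrow> 'a \<Rightarrow> (real \<times> 'a \<times> nat) list \<Rightarrow> real" where
  "slope_defect s x T = cone_sum (\<lambda>(u, m). norm (u - x) / real (Suc m)) T + s (cone_sum (\<lambda>(u, m). u - x) T)"

text \<open>Total weight at most 1 makes the defect Lipschitz in the base point, which allows
  passing between a point of \<open>V\<close> and nearby points of the countable set.\<close>

lemma slope_defect_shift:
  assumes s: "sublin s" and M: "\<And>h. s h \<le> M * norm h" "M \<ge> 0" and T: "in_cone A T" "cone_sum (\<lambda>_. 1::real) T \<le> 1"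
  shows "slope_defect s y T \<le> slope_defect s x T + (1 + M) * norm (x - y)"
proof -
  let ?t = "cone_sum (\<lambda>_. 1::real) T"
  have t0: "?t \<ge> 0" by (rule cone_sum_nonneg[OF T(1)]) simp
  have "cone_sum (\<lambda>(u, m). norm (u - y) / real (Suc m)) T \<le> cone_sum (\<lambda>i. (\<lambda>(u, m). norm (u - x) / real (Suc m)) i + norm (x - y)) T"
  proof (rule cone_sum_mono[OF T(1)])
    fix i :: "'a \<times> nat"
    obtain u m where i: "i = (u, m)" by (cases i)
    have "norm (u - y) \<le> norm (u - x) + norm (x - y)" using norm_triangle_ineq[of "u - x" "x - y"] by simp
    then have "norm (u - y) / real (Suc m) \<le> norm (u - x) / real (Suc m) + norm (x - y) / real (Suc m)"
      by (simp add: add_divide_distrib[symmetric] divide_right_mono)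
    also have "norm (x - y) / real (Suc m) \<le> norm (x - y)" by (simp add: divide_le_eq mult_le_cancel_left1)
    finally show "(case i of (u, m) \<Rightarrow> norm (u - y) / real (Suc m)) \<le> (\<lambda>(u, m). norm (u - x) / real (Suc m)) i + norm (x - y)"
      by (simp add: i)
  qed
  also have "\<dots> = cone_sum (\<lambda>(u, m). norm (u - x) / real (Suc m)) T + ?t * norm (x - y)"
    by (simp add: cone_sum_shift)
  finally have 1: "cone_sum (\<lambda>(u, m). norm (u - y) / real (Suc m)) T
    \<le> cone_sum (\<lambda>(u, m). norm (u - x) / real (Suc m)) T + ?t * norm (x - y)" .
  have "(\<lambda>(u, m::nat). u - y) = (\<lambda>i. (\<lambda>(u, m). u - x) i + (x - y))" by auto
  then have "cone_sum (\<lambda>(u, m). u - y) T = cone_sum (\<lambda>(u, m). u - x) T + ?t *\<^sub>R (x - y)"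
    using cone_sum_shift[of "\<lambda>(u, m::nat). u - x" "x - y" T] by simp
  then have "s (cone_sum (\<lambda>(u, m). u - y) T) \<le> s (cone_sum (\<lambda>(u, m). u - x) T) + ?t * s (x - y)"
    using sublin_add[OF s, of "cone_sum (\<lambda>(u, m). u - x) T" "?t *\<^sub>R (x - y)"] sublin_scale[OF s t0] by simp
  also have "?t * s (x - y) \<le> ?t * (M * norm (x - y))" using M t0 by (intro mult_left_mono) auto
  finally have 2: "s (cone_sum (\<lambda>(u, m). u - y) T) \<le> s (cone_sum (\<lambda>(u, m). u - x) T) + ?t * (M * norm (x - y))" by simp
  have "?t * ((1 + M) * norm (x - y)) \<le> 1 * ((1 + M) * norm (x - y))" using T(2) M(2) by (intro mult_right_mono) auto
  then show ?thesis using 1 2 unfolding slope_defect_def by (simp add: algebra_simps)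
qed

lemma slope_defect_scale:
  assumes "sublin s" "c > 0"
  shows "slope_defect s x (map (\<lambda>(l, i). (c * l, i)) T) = c * slope_defect s x T"
  using assms unfolding slope_defect_def cone_sum_scale by (simp add: sublin_scale_pos algebra_simps)

text \<open>The easy half of the duality: a functional satisfying the inequalities excludes a
  violation.\<close>

lemma slope_defect_nonneg:
  assumes b: "linear b" "\<And>h. - b h \<le> s h" and T: "in_cone A T"
    and A: "\<And>u m. (u, m) \<in> A \<Longrightarrow> b (u - x) \<le> norm (u - x) / real (Suc m)"
  shows "slope_defect s x T \<ge> 0"
proof -
  let ?w = "cone_sum (\<lambda>(u, m). u - x) T"
  have "b ?w = cone_sum (\<lambda>i. b ((\<lambda>(u, m). u - x) i)) T" by (rule linear_cone_sum[OF b(1)])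
  also have "\<dots> \<le> cone_sum (\<lambda>(u, m). norm (u - x) / real (Suc m)) T"
    by (rule cone_sum_mono[OF T]) (use A in auto)
  finally show ?thesis using b(2)[of ?w] by (simp add: slope_defect_def)
qed

theorem fuzzy_minimum:
  fixes \<Omega> :: "'a::banach set"
  assumes asp: "asplund TYPE('a)" and O: "closed \<Omega>"
    and s: "sublin s" and M: "M \<ge> 0" "\<And>x. s x \<le> M * norm x" and xb: "xb \<in> \<Omega>"
    and r: "r > 0" "\<forall>x\<in>\<Omega>. norm (x - xb) < r \<longrightarrow> s (x - xb) \<ge> 0" and \<epsilon>: "\<epsilon> > 0"
  shows "\<exists>x b. x \<in> \<Omega> \<and> norm (x - xb) < \<epsilon> \<and> b \<in> frechet_normal \<Omega> x \<and> (\<forall>h. - b h \<le> s h + \<epsilon> * norm h)"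
proof -
  define S where "S h = s h + \<epsilon> * norm h" for h
  have S: "sublin S" "\<And>h. S h \<le> (M + \<epsilon>) * norm h"
  proof -
    show "S h \<le> (M + \<epsilon>) * norm h" for h using M(2)[of h] by (simp add: S_def distrib_right)
    show "sublin S" using sublin_norm[of \<epsilon>, where 'a = 'a] s \<epsilon> unfolding sublin_def S_def
      by (smt (verit, ccfv_SIG) distrib_left)
  qed
  have M': "M + \<epsilon> \<ge> 0" using M \<epsilon> by simp
  \<comment> \<open>Radii are coded by a finite list of natural numbers, so there are countably many
    systems; entry \<open>m\<close> is the radius belonging to the slope
    \<open>1 / real (Suc m)\<close>.\<close>
  define adm where "adm ds x = {(u, m). u \<in> \<Omega> \<and> m < length ds \<and> norm (u - x) < 1 / real (Suc (ds ! m))}" for ds :: "nat list" and x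
  \<comment> \<open>The bounded weight and the margin \<open>1 / real (Suc N)\<close> make a
    violation robust under small changes of the base point.\<close>
  define wit where "wit ds N x T \<longleftrightarrow> in_cone (adm ds x) T \<and> cone_sum (\<lambda>_. 1::real) T \<le> 1 \<and> slope_defect S x T < - 1 / real (Suc N)" for ds N x T
  \<comment> \<open>One violating list per code and base point is recorded, which keeps the
    collected points countable.\<close>
  define pts where "pts ds N x = (if \<exists>T. wit ds N x T then (\<lambda>(l, u, m). u) ` set (SOME T. wit ds N x T) else {})" for ds N x
  have pts_fin: "countable (pts ds N x)" for ds N x by (auto simp: pts_def intro: countable_finite)
  define \<Phi> where "\<Phi> x y = {x + y} \<union> (\<lambda>q. q *\<^sub>R x) ` \<rat> \<union> (\<Union>ds. \<Union>N. pts ds N x)" for x y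
  have c\<Phi>: "countable (\<Phi> x y)" for x y
    unfolding \<Phi>_def using pts_fin by (intro countable_Un countable_image countable_UN countable_rat) auto
  have "countable {xb, 0}" by simp
  from countable_closed_superset[OF this c\<Phi>]
  obtain D where "countable D \<and> {xb, 0} \<subseteq> D \<and> (\<forall>x\<in>D. \<forall>y\<in>D. \<Phi> x y \<subseteq> D)" by (rule exE)
  then have D: "countable D" "{xb, 0} \<subseteq> D" "\<forall>x\<in>D. \<forall>y\<in>D. \<Phi> x y \<subseteq> D" by simp_all
  have \<Phi>D: "x + y \<in> D" "q \<in> \<rat> \<Longrightarrow> q *\<^sub>R x \<in> D" "pts ds N x \<subseteq> D" if "x \<in> D" "y \<in> D" for x y q ds N
    using D(3)[rule_format, OF that] unfolding \<Phi>_def by blast+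
  define V where "V = closure D"
  have subV: "subspace V" unfolding V_def
  proof (rule subspace_closure_rational)
    show "0 \<in> D" using D by simp
    show "x + y \<in> D" if "x \<in> D" "y \<in> D" for x y using \<Phi>D that by blast
    show "q *\<^sub>R x \<in> D" if "q \<in> \<rat>" "x \<in> D" for q x using \<Phi>D that by blast
  qed
  have DV: "D \<subseteq> V" by (simp add: V_def closure_subset)
  have sepV: "separable_set V" unfolding separable_set_def using D(1) DV by (intro exI[of _ D]) (simp add: V_def)
  obtain g where "\<And>k. bounded_linear (g k)" "\<And>f e. bounded_linear f \<Longrightarrow> e > 0 \<Longrightarrow> \<exists>k::nat. \<forall>x\<in>V. \<bar>f x - g k x\<bar> \<le> e * norm x"
    using asplund_dense_functionals[OF asp subV sepV] by metis
  then have "separable_dual V D g" using subV D(1) by (intro separable_dual.intro) (auto simp: V_def)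
  moreover have "closed V" "xb \<in> V" using D(2) DV by (auto simp: V_def)
  ultimately have "\<exists>x b. x \<in> \<Omega> \<and> x \<in> V \<and> norm (x - xb) < \<epsilon> \<and> linear b \<and> (\<forall>h. - b h \<le> s h + \<epsilon> * norm h) \<and>
    (\<forall>\<tau>>0. \<exists>\<delta>>0. \<forall>u\<in>\<Omega> \<inter> V. norm (u - x) < \<delta> \<longrightarrow> b (u - x) \<le> \<tau> * norm (u - x))"
    using O s M xb r \<epsilon> by (intro fuzzy_minimum_separable)
  then obtain x b where xbb: "x \<in> \<Omega> \<and> x \<in> V \<and> norm (x - xb) < \<epsilon> \<and> linear b \<and> (\<forall>h. - b h \<le> s h + \<epsilon> * norm h) \<and>
    (\<forall>\<tau>>0. \<exists>\<delta>>0. \<forall>u\<in>\<Omega> \<inter> V. norm (u - x) < \<delta> \<longrightarrow> b (u - x) \<le> \<tau> * norm (u - x))" by (elim exE)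
  then have x: "x \<in> \<Omega>" "x \<in> V" "norm (x - xb) < \<epsilon>" and b: "linear b" "\<And>h. - b h \<le> S h"
    by (simp_all add: S_def)
  have nb: "\<exists>\<delta>>0. \<forall>u\<in>\<Omega> \<inter> V. norm (u - x) < \<delta> \<longrightarrow> b (u - x) \<le> \<tau> * norm (u - x)" if "\<tau> > 0" for \<tau>
    using xbb that by blast
  have "\<forall>m. \<exists>\<delta>>0. \<forall>u\<in>\<Omega> \<inter> V. norm (u - x) < \<delta> \<longrightarrow> b (u - x) \<le> norm (u - x) / real (Suc m)"
    using nb[of "1 / real (Suc m)" for m] by simp
  then obtain \<delta> where \<delta>: "\<And>m::nat. \<delta> m > 0"
    "\<And>m u. u \<in> \<Omega> \<Longrightarrow> u \<in> V \<Longrightarrow> norm (u - x) < \<delta> m \<Longrightarrow> b (u - x) \<le> norm (u - x) / real (Suc m)" by (metis IntI)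
  \<comment> \<open>The other half of \<open>\<delta> m\<close> is kept in reserve for replacing
    \<open>x\<close> by a nearby point of \<open>D\<close>.\<close>
  have "\<forall>m. \<exists>k. 1 / real (Suc k) < \<delta> m / 2"
    using \<delta>(1) by (metis half_gt_zero inverse_eq_divide reals_Archimedean)
  then obtain k where k: "\<And>m. 1 / real (Suc (k m)) < \<delta> m / 2" by metis
  let ?A = "{(u, m). u \<in> \<Omega> \<and> norm (u - x) < 1 / real (Suc (k m))}"
  \<comment> \<open>A violation at \<open>x\<close> may use points outside \<open>V\<close>. It is
    carried over to a nearby \<open>d\<close> in \<open>D\<close>, replaced by the list recorded for
    \<open>d\<close>, whose points lie in \<open>D\<close>, and carried back to \<open>x\<close>,
    where the functional \<open>b\<close> excludes it.\<close>
  have pos: "slope_defect S x T \<ge> 0" if T: "in_cone ?A T" for T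
  proof (rule ccontr)
    assume neg: "\<not> slope_defect S x T \<ge> 0"
    define \<Lambda> where "\<Lambda> = cone_sum (\<lambda>_. 1::real) T"
    have \<Lambda>: "\<Lambda> \<ge> 0" unfolding \<Lambda>_def by (rule cone_sum_nonneg[OF T]) simp
    define T1 where "T1 = map (\<lambda>(l, i). (1 / (1 + \<Lambda>) * l, i)) T"
    have T1: "in_cone ?A T1" unfolding T1_def using \<Lambda> T by (intro in_cone_scale) auto
    have T1tot: "cone_sum (\<lambda>_. 1::real) T1 \<le> 1"
      unfolding T1_def cone_sum_scale \<Lambda>_def[symmetric] using \<Lambda> by simp
    have T1neg: "slope_defect S x T1 < 0"
      unfolding T1_def using neg \<Lambda> slope_defect_scale[OF S(1), of "1 / (1 + \<Lambda>)" x T] by (simp add: divide_neg_pos)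
    define K where "K = Suc (Max (insert 0 ((\<lambda>(l, u, m). m) ` set T1)))"
    have K: "m < K" if "(l, u, m) \<in> set T1" for l u m
    proof -
      have "m \<in> insert 0 ((\<lambda>(l, u, m). m) ` set T1)" using that by force
      then have "m \<le> Max (insert 0 ((\<lambda>(l, u, m). m) ` set T1))" by (intro Max_ge) auto
      then show ?thesis by (simp add: K_def)
    qed
    define ds where "ds = map k [0..<K]"
    \<comment> \<open>The defect at \<open>x\<close> is below \<open>- 2 / real (Suc N)\<close>.
      Moving to \<open>d\<close> costs at most \<open>1 / real (Suc N)\<close> and leaves the margin
      required by \<open>wit\<close>; moving the recorded list back costs the same and leaves a
      negative defect.\<close>
    have "0 < - slope_defect S x T1 / 2" using T1neg by simp
    then obtain N where N: "1 / real (Suc N) < - slope_defect S x T1 / 2"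
      by (metis inverse_eq_divide reals_Archimedean)
    let ?gaps = "(\<lambda>(l, u, m). 1 / real (Suc (k m)) - norm (u - x)) ` set T1"
    \<comment> \<open>The three kinds of bounds control the change of the defect, use the reserve in
      \<open>\<delta> m\<close>, and preserve the strict inequalities saying that the points of
      \<open>T1\<close> lie within their radii.\<close>
    define \<rho> where "\<rho> = Min (insert (1 / real (Suc N) / (1 + (M + \<epsilon>))) ((\<lambda>m. \<delta> m / 2) ` {..<K} \<union> ?gaps))"
    have \<rho>: "\<rho> > 0" unfolding \<rho>_def using \<delta>(1) M' T1 by (subst Min_gr_iff) (auto simp: in_cone_def)
    have \<rho>1: "\<rho> \<le> 1 / real (Suc N) / (1 + (M + \<epsilon>))" unfolding \<rho>_def by (rule Min_le) auto
    have \<rho>2: "\<rho> \<le> \<delta> m / 2" if "m < K" for m unfolding \<rho>_def using that by (intro Min_le) auto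
    have \<rho>3: "\<rho> \<le> 1 / real (Suc (k m)) - norm (u - x)" if "(l, u, m) \<in> set T1" for l u m
      unfolding \<rho>_def by (rule Min_le) (use that in force)+
    obtain d where d: "d \<in> D" "norm (d - x) < \<rho>"
      using x(2) \<rho> unfolding V_def closure_approachable dist_norm by blast
    have small: "(1 + (M + \<epsilon>)) * norm (d - x) \<le> 1 / real (Suc N)"
    proof -
      have "norm (d - x) \<le> 1 / real (Suc N) / (1 + (M + \<epsilon>))" using d(2) \<rho>1 by simp
      then have "norm (d - x) * (1 + (M + \<epsilon>)) \<le> 1 / real (Suc N)" using M' by (subst (asm) pos_le_divide_eq) auto
      then show ?thesis by (simp only: mult.commute)
    qed
    have "in_cone (adm ds d) T1"
    proof (rule in_cone_subset[OF T1])
      fix l i assume li: "(l, i) \<in> set T1"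
      obtain u m where i: "i = (u, m)" by (cases i)
      have "u \<in> \<Omega>" using T1 li i by (auto simp: in_cone_def)
      moreover have "norm (u - d) < 1 / real (Suc (k m))"
        using \<rho>3[of l u m] li i d(2) norm_triangle_ineq4[of "u - x" "d - x"] by simp
      ultimately show "i \<in> adm ds d" using K[of l u m] li i by (simp add: adm_def ds_def)
    qed
    moreover have "slope_defect S d T1 < - 1 / real (Suc N)"
      using slope_defect_shift[OF S(1,2) M' T1 T1tot, of d x] small N by (simp add: norm_minus_commute)
    ultimately have ex: "\<exists>T. wit ds N d T" using T1tot by (auto simp: wit_def)
    define T2 where "T2 = (SOME T. wit ds N d T)"
    have T2: "wit ds N d T2" unfolding T2_def using ex by (rule someI_ex)
    have "pts ds N d \<subseteq> D" by (rule \<Phi>D(3)[OF d(1) d(1)])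
    then have T2D: "u \<in> V" if "(l, u, m) \<in> set T2" for l u m
      using that ex DV unfolding pts_def T2_def[symmetric] by force
    let ?B = "{(u, m). u \<in> \<Omega> \<and> u \<in> V \<and> norm (u - x) < \<delta> m}"
    have T2c: "in_cone (adm ds d) T2" "cone_sum (\<lambda>_. 1::real) T2 \<le> 1" using T2 by (auto simp: wit_def)
    have "in_cone ?B T2"
    proof (rule in_cone_subset[OF T2c(1)])
      fix l i assume li: "(l, i) \<in> set T2"
      obtain u m where i: "i = (u, m)" by (cases i)
      have "(u, m) \<in> adm ds d" using T2c(1) li i by (auto simp: in_cone_def)
      then have u: "u \<in> \<Omega>" "m < K" "norm (u - d) < 1 / real (Suc (k m))" by (auto simp: adm_def ds_def)
      have "norm (u - x) \<le> norm (u - d) + norm (d - x)" using norm_triangle_ineq[of "u - d" "d - x"] by simp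
      then have "norm (u - x) < \<delta> m" using u(3) d(2) \<rho>2[OF u(2)] k[of m] by linarith
      then show "i \<in> ?B" using u T2D[of l u m] li i by simp
    qed
    then have "slope_defect S x T2 \<ge> 0" by (rule slope_defect_nonneg[OF b]) (use \<delta>(2) in auto)
    moreover have "slope_defect S x T2 \<le> slope_defect S d T2 + (1 + (M + \<epsilon>)) * norm (d - x)"
      by (rule slope_defect_shift[OF S(1,2) M' T2c])
    ultimately show False using T2 small by (simp add: wit_def)
  qed
  \<comment> \<open>\<open>B\<close> is a new functional that may differ from \<open>b\<close> even
    on \<open>V\<close>, but its slope inequalities hold at all points of \<Omega> within the
    radii.\<close>
  have "\<exists>B. linear B \<and> (\<forall>h. - B h \<le> S h) \<and> (\<forall>i\<in>?A. B ((\<lambda>(u, m). u - x) i) \<le> (\<lambda>(u, m). norm (u - x) / real (Suc m)) i)"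
    by (rule ex_linear_cone_constraints[OF S(1)]) (use pos in \<open>simp add: slope_defect_def\<close>)
  then obtain B where B: "linear B" "\<And>h. - B h \<le> S h"
    and BA: "\<And>u m. u \<in> \<Omega> \<Longrightarrow> norm (u - x) < 1 / real (Suc (k m)) \<Longrightarrow> B (u - x) \<le> norm (u - x) / real (Suc m)"
    by auto
  have "bounded_linear (\<lambda>h. - B h)"
    by (rule bounded_linear_below(1)[OF linear_compose_neg[OF B(1)], of "M + \<epsilon>"]) (use B(2) S(2) order_trans in blast)
  then have "bounded_linear B" using bounded_linear_minus[of "\<lambda>h. - B h"] by simp
  moreover have "\<exists>\<delta>>0. \<forall>u\<in>\<Omega>. norm (u - x) < \<delta> \<longrightarrow> B (u - x) \<le> \<tau> * norm (u - x)" if \<tau>: "\<tau> > 0" for \<tau>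
  proof -
    obtain m where m: "1 / real (Suc m) < \<tau>" using \<tau> by (metis inverse_eq_divide reals_Archimedean)
    have "B (u - x) \<le> \<tau> * norm (u - x)" if u: "u \<in> \<Omega>" "norm (u - x) < 1 / real (Suc (k m))" for u
    proof -
      have "B (u - x) \<le> 1 / real (Suc m) * norm (u - x)" using BA[OF u] by simp
      also have "\<dots> \<le> \<tau> * norm (u - x)" using m by (intro mult_right_mono) auto
      finally show ?thesis .
    qed
    then show ?thesis by (intro exI[of _ "1 / real (Suc (k m))"]) auto
  qed
  ultimately have "B \<in> frechet_normal \<Omega> x" by (simp add: frechet_normal_def)
  then show ?thesis using x B(2) unfolding S_def by blast
qed

section \<open>Weak* sequential compactness\<close>

lemma separable_closed_span:
  fixes C :: "'a::real_normed_vector set"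
  assumes "countable C"
  shows "\<exists>V. subspace V \<and> separable_set V \<and> C \<subseteq> V"
proof -
  define \<Phi> :: "'a \<Rightarrow> 'a \<Rightarrow> 'a set" where "\<Phi> x y = {x + y} \<union> (\<lambda>q. q *\<^sub>R x) ` \<rat>" for x y
  have c: "countable (\<Phi> x y)" for x y unfolding \<Phi>_def by (intro countable_Un countable_image countable_rat) auto
  have "countable (insert 0 C)" using assms by simp
  from countable_closed_superset[OF this c]
  obtain D where "countable D \<and> insert 0 C \<subseteq> D \<and> (\<forall>x\<in>D. \<forall>y\<in>D. \<Phi> x y \<subseteq> D)" by (rule exE)
  then have D: "countable D" "insert 0 C \<subseteq> D" "\<forall>x\<in>D. \<forall>y\<in>D. \<Phi> x y \<subseteq> D" by simp_all
  have \<Phi>D: "x + y \<in> D" "q \<in> \<rat> \<Longrightarrow> q *\<^sub>R x \<in> D" if "x \<in> D" "y \<in> D" for x y q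
    using D(3)[rule_format, OF that] unfolding \<Phi>_def by blast+
  have "subspace (closure D)" by (rule subspace_closure_rational) (use D(2) \<Phi>D in auto)
  moreover have "separable_set (closure D)"
    unfolding separable_set_def using D(1) closure_subset by (intro exI[of _ D]) simp
  moreover have "C \<subseteq> closure D" using D(2) closure_subset by blast
  ultimately show ?thesis by blast
qed

section \<open>Oscillation along subsequences\<close>

lemma not_countable_bool_seqs: "\<not> countable (UNIV :: (nat \<Rightarrow> bool) set)"
proof
  assume c: "countable (UNIV :: (nat \<Rightarrow> bool) set)"
  obtain n where "from_nat_into UNIV n = (\<lambda>n. \<not> from_nat_into (UNIV :: (nat \<Rightarrow> bool) set) n n)"
    using from_nat_into_surj[OF c] by blast
  then show False by (metis (full_types))
qed

text \<open>Both index sets must be infinite so that each of them can be split again.\<close>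

definition oscillates :: "(nat \<Rightarrow> 'a::real_normed_vector \<Rightarrow> real) \<Rightarrow> real \<Rightarrow> nat set \<Rightarrow> bool" where
  "oscillates f \<epsilon> M \<longleftrightarrow> (\<exists>x a. norm x \<le> 1 \<and> infinite {n\<in>M. f n x \<le> a} \<and> infinite {n\<in>M. a + \<epsilon> \<le> f n x})"

lemma oscillates_mono: "oscillates f \<epsilon> M \<Longrightarrow> M \<subseteq> M' \<Longrightarrow> oscillates f \<epsilon> M'"
  unfolding oscillates_def
  by (elim exE conjE, intro exI conjI) (auto elim!: contrapos_nn intro: finite_subset[rotated])

lemma infinite_image_strict_mono:
  "strict_mono (s :: nat \<Rightarrow> nat) \<Longrightarrow> infinite N \<Longrightarrow> infinite (s ` N)"
  by (simp add: finite_image_iff strict_mono_imp_inj_on inj_on_subset)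

text \<open>A bounded nonconvergent sequence is infinitely often within \<open>e / 3\<close> of a
  cluster value \<open>l\<close> and infinitely often at distance at least \<open>e\<close>, on one
  fixed side of \<open>l\<close>. All tails are covered because a diagonal sequence is controlled
  only from some index on.\<close>

lemma nonconvergent_oscillates:
  fixes f :: "nat \<Rightarrow> 'a::real_normed_vector \<Rightarrow> real"
  assumes B: "\<And>n x. \<bar>f n x\<bar> \<le> B * norm x" and x: "norm x \<le> 1" and s: "strict_mono (s :: nat \<Rightarrow> nat)"
    and nc: "\<not> convergent (\<lambda>n. f (s n) x)"
  shows "\<exists>\<epsilon>>0. \<forall>k. oscillates f \<epsilon> (s ` {k..})"
proof -
  let ?a = "\<lambda>n. f (s n) x"
  have "bounded (range ?a)" using B by (auto simp: bounded_iff)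
  then obtain l r where l: "strict_mono r" "(?a \<circ> r) \<longlonglongrightarrow> l" using bounded_imp_convergent_subsequence by blast
  have "\<not> ?a \<longlonglongrightarrow> l" using nc by (auto simp: convergent_def)
  then obtain e where e: "e > 0" "\<And>N. \<exists>n\<ge>N. \<bar>?a n - l\<bar> \<ge> e"
    unfolding LIMSEQ_iff by (metis linorder_not_less real_norm_def)
  obtain N where N: "\<And>n. n \<ge> N \<Longrightarrow> \<bar>?a (r n) - l\<bar> < e / 3"
    using l(2) e(1) unfolding LIMSEQ_iff by (metis comp_apply divide_pos_pos real_norm_def zero_less_numeral)
  have near: "infinite {n. k \<le> n \<and> \<bar>?a n - l\<bar> < e / 3}" for k
  proof -
    have "r ` {max N k..} \<subseteq> {n. k \<le> n \<and> \<bar>?a n - l\<bar> < e / 3}"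
    proof
      fix m assume "m \<in> r ` {max N k..}"
      then obtain n where n: "m = r n" "N \<le> n" "k \<le> n" by auto
      then show "m \<in> {n. k \<le> n \<and> \<bar>?a n - l\<bar> < e / 3}" using seq_suble[OF l(1), of n] N[of n] by simp
    qed
    moreover have "infinite (r ` {max N k..})" by (rule infinite_image_strict_mono[OF l(1)]) (simp add: infinite_Ici)
    ultimately show ?thesis using infinite_super by blast
  qed
  have "infinite {n. \<bar>?a n - l\<bar> \<ge> e}" unfolding infinite_nat_iff_unbounded_le using e(2) by blast
  moreover have "{n. \<bar>?a n - l\<bar> \<ge> e} = {n. ?a n \<ge> l + e} \<union> {n. ?a n \<le> l - e}" by auto
  ultimately have "infinite {n. ?a n \<ge> l + e} \<or> infinite {n. ?a n \<le> l - e}" by (metis finite_UnI)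
  moreover have "infinite {n::nat. k \<le> n \<and> P n}" if "infinite {n. P n}" for P k
  proof -
    have "{n. P n} \<subseteq> {..<k} \<union> {n. k \<le> n \<and> P n}" by auto
    then show ?thesis using that by (meson finite_UnI finite_lessThan finite_subset)
  qed
  ultimately have far: "(\<forall>k. infinite {n. k \<le> n \<and> ?a n \<ge> l + e}) \<or> (\<forall>k. infinite {n. k \<le> n \<and> ?a n \<le> l - e})"
    by blast
  have img: "infinite {n \<in> s ` {k..}. P n}" if "infinite {n. k \<le> n \<and> P (s n)}" for k P
  proof -
    have "s ` {n. k \<le> n \<and> P (s n)} \<subseteq> {n \<in> s ` {k..}. P n}" by auto
    then show ?thesis using infinite_image_strict_mono[OF s that] infinite_super by blast
  qed
  from far show ?thesis
  proof
    assume up: "\<forall>k. infinite {n. k \<le> n \<and> ?a n \<ge> l + e}"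
    have "oscillates f (e/3) (s ` {k..})" for k
      unfolding oscillates_def
    proof (intro exI[of _ x] exI[of _ "l + e/3"] conjI x img)
      show "infinite {n. k \<le> n \<and> f (s n) x \<le> l + e / 3}"
        by (rule infinite_super[OF _ near[of k]]) (intro Collect_mono impI conjI; linarith)
      show "infinite {n. k \<le> n \<and> l + e / 3 + e / 3 \<le> f (s n) x}"
        by (rule infinite_super[OF _ up[rule_format, of k]]) (use e(1) in \<open>intro Collect_mono impI conjI; linarith\<close>)
    qed
    then show ?thesis using e by (intro exI[of _ "e/3"]) simp
  next
    assume dn: "\<forall>k. infinite {n. k \<le> n \<and> ?a n \<le> l - e}"
    have "oscillates f (e/3) (s ` {k..})" for k
      unfolding oscillates_def
    proof (intro exI[of _ x] exI[of _ "l - e"] conjI x img)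
      show "infinite {n. k \<le> n \<and> f (s n) x \<le> l - e}" using dn by blast
      show "infinite {n. k \<le> n \<and> l - e + e / 3 \<le> f (s n) x}"
        by (rule infinite_super[OF _ near[of k]]) (use e(1) in \<open>intro Collect_mono impI conjI; linarith\<close>)
    qed
    then show ?thesis using e by (intro exI[of _ "e/3"]) simp
  qed
qed

text \<open>Otherwise every infinite index set has, for each \<open>k\<close>, an infinite subset
  without oscillation of size \<open>1 / real (Suc k)\<close>. A diagonal sequence then has tails
  free of each such oscillation, although it fails to converge at some point of the unit
  ball.\<close>

lemma ex_hereditarily_oscillating:
  fixes f :: "nat \<Rightarrow> 'a::real_normed_vector \<Rightarrow> real"
  assumes lin: "\<And>n. linear (f n)" and B: "\<And>n x. \<bar>f n x\<bar> \<le> B * norm x"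
    and nc: "\<forall>s. strict_mono s \<longrightarrow> (\<exists>x. \<not> convergent (\<lambda>n. f (s n) x))"
  shows "\<exists>\<epsilon>>0. \<exists>M. infinite M \<and> (\<forall>M'\<subseteq>M. infinite M' \<longrightarrow> oscillates f \<epsilon> M')"
proof (rule ccontr)
  assume neg: "\<not> ?thesis"
  interpret subseqs "\<lambda>k s. \<not> oscillates f (1 / real (Suc k)) (range s)"
  proof
    fix k and s :: "nat \<Rightarrow> nat" assume s: "strict_mono s"
    have "infinite (range s)" using infinite_image_strict_mono[OF s] by blast
    then obtain M' where M': "M' \<subseteq> range s" "infinite M'" "\<not> oscillates f (1 / real (Suc k)) M'"
      using neg by (metis of_nat_0_less_iff zero_less_Suc zero_less_divide_1_iff)
    have inf: "infinite (s -` M')" using M' by (metis finite_imageI image_vimage_eq inf.absorb_iff1)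
    then have "range (s \<circ> enumerate (s -` M')) \<subseteq> M'" using enumerate_in_set by fastforce
    then have "\<not> oscillates f (1 / real (Suc k)) (range (s \<circ> enumerate (s -` M')))"
      using M'(3) oscillates_mono by blast
    then show "\<exists>r' :: nat \<Rightarrow> nat. strict_mono r' \<and> \<not> oscillates f (1 / real (Suc k)) (range (s \<circ> r'))"
      using strict_mono_enumerate[OF inf] by (intro exI[of _ "enumerate (s -` M')"]) simp
  qed
  obtain x where x: "\<not> convergent (\<lambda>n. f (diagseq n) x)" using nc subseq_diagseq by blast
  have x0: "x \<noteq> 0"
  proof
    assume "x = 0"
    then have "(\<lambda>n. f (diagseq n) x) = (\<lambda>n. 0)" using lin by (simp add: linear_0)
    then show False using x by (simp add: convergent_const)
  qed
  let ?y = "(1 / norm x) *\<^sub>R x"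
  have "\<not> convergent (\<lambda>n. f (diagseq n) ?y)"
  proof
    assume "convergent (\<lambda>n. f (diagseq n) ?y)"
    then have "convergent (\<lambda>n. norm x * f (diagseq n) ?y)" by (intro convergent_mult convergent_const)
    moreover have "norm x * f (diagseq n) ?y = f (diagseq n) x" for n
      using x0 linear_scale[OF lin, of "diagseq n" "1 / norm x" x] by simp
    ultimately show False using x by simp
  qed
  moreover have "norm ?y \<le> 1" using x0 by simp
  ultimately obtain \<epsilon> where \<epsilon>: "\<epsilon> > 0" "\<And>k. oscillates f \<epsilon> (diagseq ` {k..})"
    using nonconvergent_oscillates[where f = f, OF B _ subseq_diagseq, of ?y] by blast
  obtain k where k: "1 / real (Suc k) < \<epsilon>" using \<epsilon>(1) by (metis inverse_eq_divide reals_Archimedean)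
  have "\<not> oscillates f (1 / real (Suc k)) (range (diagseq \<circ> (+) (Suc k)))"
  proof (rule diagseq_holds)
    fix r s :: "nat \<Rightarrow> nat" and n assume "\<not> oscillates f (1 / real (Suc n)) (range s)"
    then show "\<not> oscillates f (1 / real (Suc n)) (range (s \<circ> r))" using oscillates_mono by (metis image_comp image_mono subset_UNIV)
  qed
  moreover have "range (diagseq \<circ> (+) (Suc k)) = diagseq ` {Suc k..}"
  proof -
    have "range ((+) (Suc k)) = {Suc k..}" by (auto simp: le_iff_add image_iff)
    then show ?thesis by (metis image_comp)
  qed
  moreover have "oscillates f (1 / real (Suc k)) (diagseq ` {Suc k..})"
  proof -
    obtain y a where y: "norm y \<le> 1" "infinite {n \<in> diagseq ` {Suc k..}. f n y \<le> a}" "infinite {n \<in> diagseq ` {Suc k..}. a + \<epsilon> \<le> f n y}"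
      using \<epsilon>(2)[of "Suc k"] unfolding oscillates_def by blast
    have "infinite {n \<in> diagseq ` {Suc k..}. a + 1 / real (Suc k) \<le> f n y}"
      using y(3) by (rule infinite_super[rotated]) (use k in auto)
    then show ?thesis using y unfolding oscillates_def by blast
  qed
  ultimately show False by simp
qed

text \<open>
  If all subsequences oscillate by \<open>\<epsilon>\<close>, splitting index sets repeatedly gives a dyadic tree of index sets and points;
  limits along its branches are \<open>\<epsilon>\<close>-separated on the separable span of the points, which then has a nonseparable dual.
\<close>

theorem asplund_pointwise_convergent_subseq:
  fixes f :: "nat \<Rightarrow> 'a::banach \<Rightarrow> real"
  assumes asp: "asplund TYPE('a)" and lin: "\<And>n. linear (f n)" and B: "\<And>n x. \<bar>f n x\<bar> \<le> B * norm x"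
  shows "\<exists>\<sigma>. strict_mono \<sigma> \<and> (\<forall>x. convergent (\<lambda>n. f (\<sigma> n) x))"
proof (rule ccontr)
  assume "\<not> ?thesis"
  then have nc: "\<forall>s. strict_mono s \<longrightarrow> (\<exists>x. \<not> convergent (\<lambda>n. f (s n) x))" by blast
  from ex_hereditarily_oscillating[OF lin B nc]
  obtain \<epsilon> M where \<epsilon>: "\<epsilon> > 0" and M: "infinite M" "\<And>M'. M' \<subseteq> M \<Longrightarrow> infinite M' \<Longrightarrow> oscillates f \<epsilon> M'" by blast
  have "\<forall>M'. \<exists>x a. M' \<subseteq> M \<and> infinite M' \<longrightarrow>
      norm x \<le> 1 \<and> infinite {n\<in>M'. f n x \<le> a} \<and> infinite {n\<in>M'. a + \<epsilon> \<le> f n x}"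
    using M(2) unfolding oscillates_def by blast
  from choice[OF this] obtain X where "\<forall>M'. \<exists>a. M' \<subseteq> M \<and> infinite M' \<longrightarrow>
      norm (X M') \<le> 1 \<and> infinite {n\<in>M'. f n (X M') \<le> a} \<and> infinite {n\<in>M'. a + \<epsilon> \<le> f n (X M')}" by (rule exE)
  from choice[OF this] obtain A where XA: "\<forall>M'. M' \<subseteq> M \<and> infinite M' \<longrightarrow>
      norm (X M') \<le> 1 \<and> infinite {n\<in>M'. f n (X M') \<le> A M'} \<and> infinite {n\<in>M'. A M' + \<epsilon> \<le> f n (X M')}" by (rule exE)
  \<comment> \<open>The splitting vector and the threshold depend on the index set alone, so two
    siblings are separated by \<epsilon> at the same vector.\<close>
  define child where "child b N = {n\<in>N. if b then A N + \<epsilon> \<le> f n (X N) else f n (X N) \<le> A N}" for b N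
  define node where "node bs = foldr child bs M" for bs
  have node_Nil: "node [] = M" and node_Cons: "node (b # bs) = child b (node bs)" for b bs
    by (simp_all add: node_def)
  have node: "node bs \<subseteq> M \<and> infinite (node bs)" for bs
  proof (induction bs)
    case Nil then show ?case using M by (simp add: node_Nil)
  next
    case (Cons b bs)
    then show ?case using XA[rule_format, of "node bs"] by (cases b) (auto simp: node_Cons child_def)
  qed
  have Xn: "norm (X (node bs)) \<le> 1" for bs using XA node by blast
  obtain V where V: "subspace V" "separable_set V" "range (\<lambda>bs. X (node bs)) \<subseteq> V"
    using separable_closed_span[of "range (\<lambda>bs. X (node bs))"] by auto
  obtain D where D: "countable D" "V \<subseteq> closure D" using V(2) by (auto simp: separable_set_def)
  \<comment> \<open>The prefix is reversed because \<open>node\<close> applies the head of the list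
    last.\<close>
  define pre where "pre \<beta> k = rev (map \<beta> [0..<k])" for \<beta> :: "nat \<Rightarrow> bool" and k
  have pre_Suc: "pre \<beta> (Suc k) = \<beta> k # pre \<beta> k" for \<beta> k by (simp add: pre_def)
  have anti: "node (pre \<beta> j) \<subseteq> node (pre \<beta> k)" if "k \<le> j" for \<beta> j k
    using that by (induction rule: dec_induct) (auto simp: pre_Suc node_Cons child_def)
  have "\<exists>F. F \<in> dual_on V \<and> (\<forall>k. if \<beta> k then A (node (pre \<beta> k)) + \<epsilon> \<le> F (X (node (pre \<beta> k)))
      else F (X (node (pre \<beta> k))) \<le> A (node (pre \<beta> k)))" for \<beta>
  proof -
    \<comment> \<open>Increasing indices are taken from the decreasing nodes of the branch: each
      node contains all but finitely many of them, so limits inherit the inequality of every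
      level.\<close>
    have "\<exists>n. \<forall>k. n k \<in> node (pre \<beta> k) \<and> n k < n (Suc k)"
    proof (rule dependent_nat_choice[where P = "\<lambda>k n. n \<in> node (pre \<beta> k)" and Q = "\<lambda>k n n'. n < n'"])
      show "\<exists>n. n \<in> node (pre \<beta> 0)" using node[of "pre \<beta> 0"] infinite_imp_nonempty by blast
      show "\<exists>y. y \<in> node (pre \<beta> (Suc k)) \<and> n < y" for n k
        using node[of "pre \<beta> (Suc k)"] unfolding infinite_nat_iff_unbounded by blast
    qed
    then obtain n where n: "\<And>k. n k \<in> node (pre \<beta> k)" "\<And>k. n k < n (Suc k)" by blast
    obtain r where r: "strict_mono r" "\<And>x. x \<in> closure D \<Longrightarrow> convergent (\<lambda>i. f (n (r i)) x)"
      using pointwise_convergent_subseq[of "\<lambda>k. f (n k)" B D, OF lin B D(1)] by blast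
    define F where "F x = lim (\<lambda>i. f (n (r i)) x)" for x
    have F: "(\<lambda>i. f (n (r i)) x) \<longlonglongrightarrow> F x" if "x \<in> V" for x
      unfolding F_def using r(2)[of x] D(2) that by (auto simp: convergent_LIMSEQ_iff)
    have "F \<in> dual_on V"
      unfolding dual_on_def
    proof (intro CollectI conjI ballI allI exI[of _ B])
      fix x y assume xy: "x \<in> V" "y \<in> V"
      show "F (x + y) = F x + F y"
        using tendsto_add[OF F[OF xy(1)] F[OF xy(2)]] F[OF subspace_add[OF V(1) xy]]
        by (simp add: linear_add[OF lin] LIMSEQ_unique)
    next
      fix c x assume x: "x \<in> V"
      show "F (c *\<^sub>R x) = c * F x"
        using tendsto_mult_left[OF F[OF x], of c] F[OF subspace_scale[OF V(1) x], of c]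
        by (simp add: linear_scale[OF lin] LIMSEQ_unique)
    next
      fix x assume x: "x \<in> V"
      show "\<bar>F x\<bar> \<le> B * norm x"
        using tendsto_rabs[OF F[OF x]] B by (intro LIMSEQ_le_const2[of "\<lambda>i. \<bar>f (n (r i)) x\<bar>"]) auto
    qed
    moreover have "if \<beta> k then A (node (pre \<beta> k)) + \<epsilon> \<le> F (X (node (pre \<beta> k)))
      else F (X (node (pre \<beta> k))) \<le> A (node (pre \<beta> k))" for k
    proof -
      let ?x = "X (node (pre \<beta> k))"
      have lim: "(\<lambda>i. f (n (r i)) ?x) \<longlonglongrightarrow> F ?x" using V(3) by (intro F) blast
      have mem: "n (r i) \<in> child (\<beta> k) (node (pre \<beta> k))" if "i \<ge> Suc k" for i
      proof -
        have "Suc k \<le> r i" using that seq_suble[OF r(1), of i] by simp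
        then have "n (r i) \<in> node (pre \<beta> (Suc k))" using anti n(1) by blast
        then show ?thesis by (simp add: pre_Suc node_Cons)
      qed
      show ?thesis
      proof (cases "\<beta> k")
        case True
        then have "\<exists>N. \<forall>i\<ge>N. A (node (pre \<beta> k)) + \<epsilon> \<le> f (n (r i)) ?x"
          using mem by (intro exI[of _ "Suc k"]) (auto simp: child_def)
        then show ?thesis using True LIMSEQ_le_const[OF lim] by simp
      next
        case False
        then have "\<exists>N. \<forall>i\<ge>N. f (n (r i)) ?x \<le> A (node (pre \<beta> k))"
          using mem by (intro exI[of _ "Suc k"]) (auto simp: child_def)
        then show ?thesis using False LIMSEQ_le_const2[OF lim] by simp
      qed
    qed
    ultimately show ?thesis by blast
  qed
  then obtain F where F: "\<And>\<beta>. F \<beta> \<in> dual_on V" and FX: "\<And>\<beta> k. if \<beta> k then A (node (pre \<beta> k)) + \<epsilon> \<le> F \<beta> (X (node (pre \<beta> k)))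
      else F \<beta> (X (node (pre \<beta> k))) \<le> A (node (pre \<beta> k))" by metis
  have "separable_dual_on V" using asp V(1,2) by (simp add: asplund_def)
  from separable_dual_onE[OF this] obtain G where G: "countable G" "G \<subseteq> dual_on V"
    "\<And>f e. f \<in> dual_on V \<Longrightarrow> e > 0 \<Longrightarrow> \<exists>h\<in>G. \<forall>x\<in>V. \<bar>f x - h x\<bar> \<le> e * norm x"
    by metis
  have "\<forall>\<beta>. \<exists>h\<in>G. \<forall>x\<in>V. \<bar>F \<beta> x - h x\<bar> \<le> \<epsilon> / 3 * norm x" using G(3)[OF F, of "\<epsilon>/3"] \<epsilon> by simp
  then obtain h where h: "\<And>\<beta>. h \<beta> \<in> G" "\<And>\<beta> x. x \<in> V \<Longrightarrow> \<bar>F \<beta> x - h \<beta> x\<bar> \<le> \<epsilon> / 3 * norm x" by metis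
  \<comment> \<open>Branches parting at level \<open>k\<close> differ by at least \<epsilon> at a
    vector of norm at most 1, while a common approximant would put them within
    \<open>2\<epsilon>/3\<close> there.\<close>
  have sep: "h \<beta> \<noteq> h \<gamma>" if pk: "pre \<beta> k = pre \<gamma> k" and b: "\<beta> k" "\<not> \<gamma> k" for \<beta> \<gamma> k
  proof
    assume eq: "h \<beta> = h \<gamma>"
    let ?x = "X (node (pre \<beta> k))"
    have x: "?x \<in> V" using V(3) by blast
    have "A (node (pre \<beta> k)) + \<epsilon> \<le> F \<beta> ?x" "F \<gamma> ?x \<le> A (node (pre \<beta> k))"
      using FX[of \<beta> k] FX[of \<gamma> k] b pk by auto
    moreover have "\<bar>F \<beta> ?x - h \<beta> ?x\<bar> \<le> \<epsilon> / 3 * norm ?x" "\<bar>F \<gamma> ?x - h \<beta> ?x\<bar> \<le> \<epsilon> / 3 * norm ?x"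
      using h(2)[OF x, of \<beta>] h(2)[OF x, of \<gamma>] eq by auto
    moreover have "\<epsilon> / 3 * norm ?x \<le> \<epsilon> / 3 * 1" using Xn \<epsilon> by (intro mult_left_mono) auto
    ultimately show False using \<epsilon> by linarith
  qed
  have "inj h"
  proof (rule injI, rule ccontr)
    fix \<beta> \<gamma> assume eq: "h \<beta> = h \<gamma>" and ne: "\<beta> \<noteq> \<gamma>"
    define k where "k = (LEAST k. \<beta> k \<noteq> \<gamma> k)"
    have "\<exists>k. \<beta> k \<noteq> \<gamma> k" using ne by auto
    then have k: "\<beta> k \<noteq> \<gamma> k" unfolding k_def by (rule LeastI_ex)
    have "\<beta> j = \<gamma> j" if "j < k" for j using not_less_Least that unfolding k_def by blast
    then have "pre \<beta> k = pre \<gamma> k" by (simp add: pre_def)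
    then show False using sep[of \<beta> k \<gamma>] sep[of \<gamma> k \<beta>] k eq by auto
  qed
  then have "countable (UNIV :: (nat \<Rightarrow> bool) set)" using G(1) h(1)
    by (meson countable_image_inj_on countable_subset image_subset_iff)
  then show False using not_countable_bool_seqs by blast
qed

section \<open>Fuzzy sum rule\<close>

lemma frechet_normalD:
  assumes "b \<in> frechet_normal \<Omega> x" "\<epsilon> > 0"
  shows "\<exists>\<delta>>0. \<forall>u\<in>\<Omega>. norm (u - x) < \<delta> \<longrightarrow> b (u - x) \<le> \<epsilon> * norm (u - x)"
  using assms by (simp add: frechet_normal_def)

lemma frechet_normal_local:
  assumes b: "b \<in> frechet_normal \<Omega> x" and \<rho>: "\<rho> > 0" "\<And>u. u \<in> \<Omega>' \<Longrightarrow> norm (u - x) < \<rho> \<Longrightarrow> u \<in> \<Omega>"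
  shows "b \<in> frechet_normal \<Omega>' x"
proof -
  have "\<exists>\<delta>>0. \<forall>u\<in>\<Omega>'. norm (u - x) < \<delta> \<longrightarrow> b (u - x) \<le> \<epsilon> * norm (u - x)" if e: "\<epsilon> > 0" for \<epsilon>
  proof -
    obtain \<delta> where "\<delta> > 0" "\<forall>u\<in>\<Omega>. norm (u - x) < \<delta> \<longrightarrow> b (u - x) \<le> \<epsilon> * norm (u - x)"
      using frechet_normalD[OF b e] by blast
    then show ?thesis using \<rho> by (intro exI[of _ "min \<delta> \<rho>"]) simp
  qed
  then show ?thesis using b by (simp add: frechet_normal_def)
qed

lemma frechet_normal_scale:
  assumes b: "b \<in> frechet_normal \<Omega> x" and c: "c > 0"
  shows "(\<lambda>h. c * b h) \<in> frechet_normal \<Omega> x"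
proof -
  have "\<exists>\<delta>>0. \<forall>u\<in>\<Omega>. norm (u - x) < \<delta> \<longrightarrow> c * b (u - x) \<le> \<epsilon> * norm (u - x)" if "\<epsilon> > 0" for \<epsilon>
  proof -
    have "\<epsilon> / c > 0" using that c by simp
    then obtain \<delta> where "\<delta> > 0" "\<forall>u\<in>\<Omega>. norm (u - x) < \<delta> \<longrightarrow> b (u - x) \<le> \<epsilon> / c * norm (u - x)"
      using frechet_normalD[OF b] by blast
    then show ?thesis using c by (intro exI[of _ \<delta>]) (auto simp: field_simps)
  qed
  then show ?thesis using b c by (simp add: frechet_normal_def bounded_linear_const_mult)
qed

lemma frechet_normal_prod:
  assumes b: "b \<in> frechet_normal (A \<times> B) (x, y)" and xy: "x \<in> A" "y \<in> B"
  shows "(\<lambda>h. b (h, 0)) \<in> frechet_normal A x" "(\<lambda>k. b (0, k)) \<in> frechet_normal B y"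
proof -
  have bl: "bounded_linear b" using b by (simp add: frechet_normal_def)
  have "bounded_linear (\<lambda>h. b (h, 0))" "bounded_linear (\<lambda>k. b (0, k))"
    by (intro bounded_linear_compose[OF bl] bounded_linear_Pair bounded_linear_ident bounded_linear_zero)+
  moreover have "\<exists>\<delta>>0. \<forall>u\<in>A. norm (u - x) < \<delta> \<longrightarrow> b (u - x, 0) \<le> \<epsilon> * norm (u - x)" if e: "\<epsilon> > 0" for \<epsilon>
  proof -
    obtain \<delta> where \<delta>: "\<delta> > 0" "\<forall>u\<in>A \<times> B. norm (u - (x, y)) < \<delta> \<longrightarrow> b (u - (x, y)) \<le> \<epsilon> * norm (u - (x, y))"
      using frechet_normalD[OF b e] by blast
    have "b (u - x, 0) \<le> \<epsilon> * norm (u - x)" if "u \<in> A" "norm (u - x) < \<delta>" for u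
      using \<delta>(2)[rule_format, of "(u, y)"] that xy by simp
    then show ?thesis using \<delta>(1) by blast
  qed
  moreover have "\<exists>\<delta>>0. \<forall>u\<in>B. norm (u - y) < \<delta> \<longrightarrow> b (0, u - y) \<le> \<epsilon> * norm (u - y)" if e: "\<epsilon> > 0" for \<epsilon>
  proof -
    obtain \<delta> where \<delta>: "\<delta> > 0" "\<forall>u\<in>A \<times> B. norm (u - (x, y)) < \<delta> \<longrightarrow> b (u - (x, y)) \<le> \<epsilon> * norm (u - (x, y))"
      using frechet_normalD[OF b e] by blast
    have "b (0, u - y) \<le> \<epsilon> * norm (u - y)" if "u \<in> B" "norm (u - y) < \<delta>" for u
      using \<delta>(2)[rule_format, of "(x, u)"] that xy by simp
    then show ?thesis using \<delta>(1) by blast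
  qed
  ultimately show "(\<lambda>h. b (h, 0)) \<in> frechet_normal A x" "(\<lambda>k. b (0, k)) \<in> frechet_normal B y"
    by (simp_all add: frechet_normal_def)
qed

text \<open>The Lipschitz bound makes the norm of \<open>(v - u, G v - G u)\<close> at most
  \<open>(1 + C) * norm (v - u)\<close>, so the error can be measured in \<open>v - u\<close>.
  \<Omega> may be an epigraph or a piece of the graph.\<close>

lemma graph_normal_subgradient:
  fixes G :: "'w::real_normed_vector \<Rightarrow> 'z::real_normed_vector"
  assumes b: "b \<in> frechet_normal \<Omega> (u, G u)" and \<rho>: "\<rho> > 0"
    and mem: "\<And>v. norm (v - u) < \<rho> \<Longrightarrow> (v, G v) \<in> \<Omega>"
    and lip: "\<And>v. norm (v - u) < \<rho> \<Longrightarrow> norm (G v - G u) \<le> C * norm (v - u)" and C: "C \<ge> 0" and \<tau>: "\<tau> > 0"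
  shows "\<exists>\<delta>>0. \<forall>v. norm (v - u) < \<delta> \<longrightarrow> b (v - u, G v - G u) \<le> \<tau> * norm (v - u)"
proof -
  have "\<tau> / (1 + C) > 0" using \<tau> C by simp
  then obtain \<delta> where \<delta>: "\<delta> > 0" "\<forall>w\<in>\<Omega>. norm (w - (u, G u)) < \<delta> \<longrightarrow> b (w - (u, G u)) \<le> \<tau> / (1 + C) * norm (w - (u, G u))"
    using frechet_normalD[OF b] by blast
  have "b (v - u, G v - G u) \<le> \<tau> * norm (v - u)" if v: "norm (v - u) < min \<rho> (\<delta> / (1 + C))" for v
  proof -
    have n: "norm (v - u, G v - G u) \<le> (1 + C) * norm (v - u)"
      using norm_Pair_le[of "v - u" "G v - G u"] lip[of v] v by (simp add: distrib_right)
    have "(1 + C) * norm (v - u) < \<delta>" using v C by (simp add: pos_less_divide_eq mult.commute)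
    then have "b (v - u, G v - G u) \<le> \<tau> / (1 + C) * norm (v - u, G v - G u)"
      using \<delta>(2)[rule_format, of "(v, G v)"] mem[of v] v n by simp
    also have "\<dots> \<le> \<tau> / (1 + C) * ((1 + C) * norm (v - u))" using n \<tau> C by (intro mult_left_mono) auto
    finally show ?thesis using C by simp
  qed
  then show ?thesis using \<rho> \<delta>(1) C by (intro exI[of _ "min \<rho> (\<delta> / (1 + C))"]) simp
qed

section \<open>Normals to epigraphs\<close>

text \<open>Strictly above the graph one can also move down, which is incompatible with a negative
  vertical component.\<close>

lemma epigraph_normal_on_graph:
  fixes f :: "'w::real_normed_vector \<Rightarrow> real"
  assumes b: "b \<in> frechet_normal {(u, t). u \<in> S \<and> f u \<le> t} (u, t)" and ut: "u \<in> S" "f u \<le> t"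
    and \<sigma>: "b (0, 1) < 0"
  shows "t = f u"
proof (rule ccontr)
  assume "t \<noteq> f u"
  then have lt: "f u < t" using ut by simp
  have bl: "linear b" using b by (simp add: frechet_normal_def bounded_linear.linear)
  have "- b (0, 1) / 2 > 0" using \<sigma> by simp
  then obtain \<delta> where \<delta>: "\<delta> > 0" "\<forall>w\<in>{(u, t). u \<in> S \<and> f u \<le> t}. norm (w - (u, t)) < \<delta> \<longrightarrow> b (w - (u, t)) \<le> - b (0, 1) / 2 * norm (w - (u, t))"
    using frechet_normalD[OF b] by blast
  define \<eta> where "\<eta> = min (\<delta>/2) (t - f u)"
  have \<eta>: "\<eta> > 0" "\<eta> < \<delta>" "f u \<le> t - \<eta>" using \<delta>(1) lt by (auto simp: \<eta>_def)
  have "b (0, - \<eta>) \<le> - b (0, 1) / 2 * \<eta>"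
    using \<delta>(2)[rule_format, of "(u, t - \<eta>)"] ut \<eta> by (simp add: norm_Pair)
  moreover have "b (0, - \<eta>) = - \<eta> * b (0, 1)" using linear_scale[OF bl, of "- \<eta>" "(0, 1)"] by simp
  ultimately have "- \<eta> * b (0, 1) \<le> - \<eta> * b (0, 1) / 2" by (simp add: mult.commute)
  moreover have "- \<eta> * b (0, 1) > 0" using \<eta>(1) \<sigma> by (simp add: mult_pos_neg)
  ultimately show False by linarith
qed

lemma closed_epigraph_cball:
  fixes f :: "'w::real_normed_vector \<Rightarrow> real"
  assumes lip: "\<And>u v. u \<in> cball w0 \<rho> \<Longrightarrow> v \<in> cball w0 \<rho> \<Longrightarrow> \<bar>f u - f v\<bar> \<le> C * norm (u - v)"
  shows "closed {(u, t). u \<in> cball w0 \<rho> \<and> f u \<le> t}"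
  unfolding closed_sequential_limits
proof (intro allI impI, elim conjE)
  fix x l assume x: "\<forall>n. x n \<in> {(u, t). u \<in> cball w0 \<rho> \<and> f u \<le> t}" and lim: "x \<longlonglongrightarrow> l"
  have l1: "(\<lambda>n. fst (x n)) \<longlonglongrightarrow> fst l" and l2: "(\<lambda>n. snd (x n)) \<longlonglongrightarrow> snd l"
    using lim by (auto intro: tendsto_fst tendsto_snd)
  have m: "fst (x n) \<in> cball w0 \<rho>" "f (fst (x n)) \<le> snd (x n)" for n using x[rule_format, of n] by auto
  have m1: "fst l \<in> cball w0 \<rho>" by (rule closed_sequentially[OF closed_cball _ l1]) (use m(1) in simp)
  have "f (fst l) \<le> snd (x n) + C * norm (fst l - fst (x n))" for n
    using lip[OF m1 m(1)[of n]] m(2)[of n] by linarith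
  moreover have "(\<lambda>n. snd (x n) + C * norm (fst l - fst (x n))) \<longlonglongrightarrow> snd l + C * norm (fst l - fst l)"
    by (intro tendsto_intros l1 l2)
  ultimately have "f (fst l) \<le> snd l" using LIMSEQ_le_const[of _ "snd l" "f (fst l)"] by auto
  then show "l \<in> {(u, t). u \<in> cball w0 \<rho> \<and> f u \<le> t}" using m1 by (auto simp: case_prod_beta)
qed

text \<open>The vertical component is only close to -1. Dividing by its modulus
  \<open>\<sigma> \<ge> 1/2\<close> makes it exactly -1 and changes the horizontal part by a factor
  within \<open>2 * e\<close> of 1. Since \<open>u\<close> is inside the ball, the truncation of the
  epigraph is invisible near the point.\<close>

lemma epigraph_normal_rescale:
  fixes f :: "'w::real_normed_vector \<Rightarrow> real"
  assumes b: "b \<in> frechet_normal {(u, t). u \<in> cball w0 \<rho> \<and> f u \<le> t} (u, t)"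
    and ut: "norm (u - w0) < \<rho>" "f u \<le> t" and e: "e \<le> 1/2" "\<bar>b (0, 1) + 1\<bar> \<le> e"
    and K: "\<And>h. \<bar>b (h, 0)\<bar> \<le> K * norm h"
  shows "\<exists>A. bounded_linear A \<and> (\<lambda>(h, t). A h - t) \<in> frechet_normal (epigraph f) (u, f u) \<and>
    (\<forall>h. \<bar>A h - b (h, 0)\<bar> \<le> 2 * e * K * norm h)"
proof -
  define \<sigma> where "\<sigma> = - b (0, 1)"
  have \<sigma>: "\<sigma> \<ge> 1/2" "\<bar>\<sigma> - 1\<bar> \<le> e" using e by (auto simp: \<sigma>_def)
  have bl: "bounded_linear b" using b by (simp add: frechet_normal_def)
  have t: "t = f u" by (rule epigraph_normal_on_graph[OF b]) (use ut \<sigma> in \<open>auto simp: dist_norm norm_minus_commute \<sigma>_def\<close>)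
  define A where "A h = (1 / \<sigma>) * b (h, 0)" for h
  have "bounded_linear A" unfolding A_def
    by (intro bounded_linear_const_mult bounded_linear_compose[OF bl] bounded_linear_Pair bounded_linear_ident bounded_linear_zero)
  moreover have "(\<lambda>(h, t). A h - t) = (\<lambda>z. (1 / \<sigma>) * b z)"
  proof
    fix z :: "'w \<times> real"
    have "b z = b (fst z, 0) + snd z * b (0, 1)"
      using linear_add[OF bounded_linear.linear[OF bl], of "(fst z, 0)" "snd z *\<^sub>R (0, 1)"]
        linear_scale[OF bounded_linear.linear[OF bl], of "snd z" "(0, 1)"] by simp
    then show "(\<lambda>(h, t). A h - t) z = (1 / \<sigma>) * b z" using \<sigma> by (simp add: case_prod_beta A_def \<sigma>_def field_simps)
  qed
  moreover have "(\<lambda>z. (1 / \<sigma>) * b z) \<in> frechet_normal (epigraph f) (u, f u)"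
  proof (rule frechet_normal_local[OF frechet_normal_scale[OF b[unfolded t]]])
    show "\<rho> - norm (u - w0) > 0" using ut by simp
    fix z assume z: "z \<in> epigraph f" "norm (z - (u, f u)) < \<rho> - norm (u - w0)"
    have "norm (fst z - u) \<le> norm (z - (u, f u))" using norm_fst_le_norm[of "z - (u, f u)"] by simp
    then have "norm (fst z - w0) \<le> \<rho>" using z(2) norm_triangle_ineq[of "fst z - u" "u - w0"] by simp
    then show "z \<in> {(u, t). u \<in> cball w0 \<rho> \<and> f u \<le> t}"
      using z(1) by (auto simp: epigraph_def dist_norm norm_minus_commute)
  qed (use \<sigma> in simp)
  moreover have "\<bar>A h - b (h, 0)\<bar> \<le> 2 * e * K * norm h" for h
  proof -
    have "\<bar>A h - b (h, 0)\<bar> = \<bar>1 - \<sigma>\<bar> / \<sigma> * \<bar>b (h, 0)\<bar>"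
      using \<sigma>(1) by (simp add: A_def abs_mult[symmetric] abs_divide field_simps)
    also have "\<dots> \<le> (2 * e) * (K * norm h)"
    proof (intro mult_mono K)
      have "\<bar>1 - \<sigma>\<bar> / \<sigma> \<le> \<bar>1 - \<sigma>\<bar> / (1/2)" using \<sigma>(1) by (intro divide_left_mono) auto
      then show "\<bar>1 - \<sigma>\<bar> / \<sigma> \<le> 2 * e" using \<sigma>(2) abs_minus_commute[of 1 \<sigma>] by simp
    qed (use \<sigma> in auto)
    finally show ?thesis by simp
  qed
  ultimately show ?thesis by (intro exI[of _ A]) simp
qed

text \<open>
  Apply \<open>fuzzy_minimum\<close> to the product of the epigraphs and
  \<open>s ((h, t), (h', t')) = t + t' - \<alpha> h + e * norm h + C * norm (h - h')\<close>.
\<close>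

theorem fuzzy_sum_rule:
  fixes f1 f2 :: "'w::banach \<Rightarrow> real"
  assumes asp: "asplund TYPE('w)" and \<rho>: "\<rho> > 0" and C: "C \<ge> 0"
    and lip1: "\<And>u v. u \<in> cball w0 \<rho> \<Longrightarrow> v \<in> cball w0 \<rho> \<Longrightarrow> \<bar>f1 u - f1 v\<bar> \<le> C * norm (u - v)"
    and lip2: "\<And>u v. u \<in> cball w0 \<rho> \<Longrightarrow> v \<in> cball w0 \<rho> \<Longrightarrow> \<bar>f2 u - f2 v\<bar> \<le> C * norm (u - v)"
    and \<alpha>: "bounded_linear \<alpha>"
    and sub: "\<And>\<tau>. \<tau> > 0 \<Longrightarrow> \<exists>\<delta>>0. \<forall>u. norm (u - w0) < \<delta> \<longrightarrow>
        \<alpha> (u - w0) \<le> (f1 u - f1 w0) + (f2 u - f2 w0) + \<tau> * norm (u - w0)"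
    and \<epsilon>: "\<epsilon> > 0"
  shows "\<exists>u u' A A'. norm (u - w0) < \<epsilon> \<and> norm (u' - w0) < \<epsilon> \<and> bounded_linear A \<and> bounded_linear A' \<and>
    (\<lambda>(h, t). A h - t) \<in> frechet_normal (epigraph f1) (u, f1 u) \<and>
    (\<lambda>(h, t). A' h - t) \<in> frechet_normal (epigraph f2) (u', f2 u') \<and>
    (\<forall>h. \<bar>A h + A' h - \<alpha> h\<bar> \<le> \<epsilon> * norm h)"
proof -
  obtain B where B: "B > 0" "\<And>h. \<bar>\<alpha> h\<bar> \<le> B * norm h"
    using bounded_linear.pos_bounded[OF \<alpha>] by (auto simp: mult.commute)
  have al: "linear \<alpha>" using \<alpha> by (rule bounded_linear.linear)
  define K where "K = B + C + 2"
  \<comment> \<open>The error is \<open>3 * e\<close> from testing on the diagonal plus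
    \<open>2 * e * K\<close> from each of two rescalings. \<open>e \<le> 1/2\<close> keeps the
    vertical components away from 0, and \<open>e < \<rho>\<close> puts the points inside the
    ball.\<close>
  define e where "e = min (min (1/2) (\<rho>/2)) (\<epsilon> / (3 + 4 * K))"
  have K: "K > 0" using B C by (simp add: K_def)
  have "e \<le> min (1/2) (\<rho>/2)" unfolding e_def by (rule min.cobounded1)
  moreover have "e > 0" using \<rho> \<epsilon> K by (simp add: e_def)
  ultimately have e: "e > 0" "e \<le> 1/2" "e < \<rho>" using \<rho> by linarith+
  have "e \<le> \<epsilon> / (3 + 4 * K)" unfolding e_def by (rule min.cobounded2)
  then have eK: "3 * e + 4 * e * K \<le> \<epsilon>" using K by (simp add: pos_le_divide_eq algebra_simps)
  have e\<epsilon>: "e \<le> \<epsilon>" using eK e(1) mult_pos_pos[OF e(1) K] by linarith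
  define E1 where "E1 = {(u, t). u \<in> cball w0 \<rho> \<and> f1 u \<le> t}"
  define E2 where "E2 = {(u, t). u \<in> cball w0 \<rho> \<and> f2 u \<le> t}"
  have cl: "closed (E1 \<times> E2)" unfolding E1_def E2_def
    by (intro closed_Times closed_epigraph_cball[where C = C]) (use lip1 lip2 in blast)+
  define s :: "('w \<times> real) \<times> ('w \<times> real) \<Rightarrow> real"
    where "s z = snd (fst z) + snd (snd z) - \<alpha> (fst (fst z)) + e * norm (fst (fst z)) + C * norm (fst (fst z) - fst (snd z))" for z
  have s: "sublin s"
    unfolding sublin_def
  proof (intro conjI allI impI)
    fix x y :: "('w \<times> real) \<times> ('w \<times> real)"
    have "e * norm (fst (fst x) + fst (fst y)) \<le> e * (norm (fst (fst x)) + norm (fst (fst y)))"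
      using e by (intro mult_left_mono norm_triangle_ineq) auto
    moreover have "C * norm (fst (fst x) + fst (fst y) - (fst (snd x) + fst (snd y)))
        \<le> C * (norm (fst (fst x) - fst (snd x)) + norm (fst (fst y) - fst (snd y)))"
      using C norm_triangle_ineq[of "fst (fst x) - fst (snd x)" "fst (fst y) - fst (snd y)"]
      by (intro mult_left_mono) (auto simp: algebra_simps)
    ultimately show "s (x + y) \<le> s x + s y" by (simp add: s_def linear_add[OF al] algebra_simps)
  next
    fix c :: real and x :: "('w \<times> real) \<times> ('w \<times> real)" assume "c > 0"
    moreover have "norm (c *\<^sub>R fst (fst x) - c *\<^sub>R fst (snd x)) = \<bar>c\<bar> * norm (fst (fst x) - fst (snd x))"
      by (simp flip: scaleR_diff_right)
    ultimately show "s (c *\<^sub>R x) = c * s x" by (simp add: s_def linear_scale[OF al] algebra_simps)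
  qed
  have sM: "s z \<le> (2 + B + e + 2 * C) * norm z" for z
  proof -
    have n: "norm (fst (fst z)) \<le> norm z" "norm (fst (snd z)) \<le> norm z"
      "\<bar>snd (fst z)\<bar> \<le> norm z" "\<bar>snd (snd z)\<bar> \<le> norm z"
      using norm_fst_le_norm[of z] norm_snd_le_norm[of z] norm_fst_le_norm[of "fst z"] norm_snd_le_norm[of "fst z"]
        norm_fst_le_norm[of "snd z"] norm_snd_le_norm[of "snd z"] by auto
    have "\<bar>\<alpha> (fst (fst z))\<bar> \<le> B * norm z"
      using B(2)[of "fst (fst z)"] mult_left_mono[OF n(1), of B] B(1) by linarith
    moreover have "e * norm (fst (fst z)) \<le> e * norm z" using n e by (intro mult_left_mono) auto
    moreover have "C * norm (fst (fst z) - fst (snd z)) \<le> C * (2 * norm z)"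
      using n C norm_triangle_ineq4[of "fst (fst z)" "fst (snd z)"] by (intro mult_left_mono) auto
    ultimately show ?thesis using n unfolding s_def by (simp add: algebra_simps)
  qed
  obtain \<delta> where \<delta>: "\<delta> > 0" "\<forall>u. norm (u - w0) < \<delta> \<longrightarrow>
      \<alpha> (u - w0) \<le> (f1 u - f1 w0) + (f2 u - f2 w0) + e * norm (u - w0)" using sub[OF e(1)] by blast
  define xb where "xb = ((w0, f1 w0), (w0, f2 w0))"
  have xb: "xb \<in> E1 \<times> E2" using \<rho> by (simp add: xb_def E1_def E2_def)
  have loc: "s (x - xb) \<ge> 0" if x: "x \<in> E1 \<times> E2" "norm (x - xb) < \<delta>" for x
  proof -
    obtain u t u' t' where xx: "x = ((u, t), (u', t'))" by (metis surj_pair)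
    have m: "u \<in> cball w0 \<rho>" "f1 u \<le> t" "u' \<in> cball w0 \<rho>" "f2 u' \<le> t'" using x(1) by (auto simp: xx E1_def E2_def)
    have "norm (u - w0) \<le> norm (x - xb)"
      using norm_fst_le_norm[of "x - xb"] norm_fst_le_norm[of "fst (x - xb)"] by (simp add: xx xb_def)
    then have "\<alpha> (u - w0) \<le> (f1 u - f1 w0) + (f2 u - f2 w0) + e * norm (u - w0)" using \<delta>(2) x(2) by auto
    \<comment> \<open>The hypothesis speaks of one point \<open>u\<close>; the coupling term of
      \<open>s\<close> pays for evaluating \<open>f2\<close> at \<open>u'\<close>.\<close>
    moreover have "\<bar>f2 u - f2 u'\<bar> \<le> C * norm (u - u')" using lip2 m by blast
    ultimately show ?thesis using m by (simp add: s_def xx xb_def)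
  qed
  have "asplund TYPE(('w \<times> real) \<times> ('w \<times> real))" by (intro asplund_prod asp asplund_real)
  moreover have "2 + B + e + 2 * C \<ge> 0" using C B(1) e(1) by simp
  moreover have "\<forall>x\<in>E1 \<times> E2. norm (x - xb) < \<delta> \<longrightarrow> s (x - xb) \<ge> 0" using loc by blast
  ultimately obtain x b where x: "x \<in> E1 \<times> E2" "norm (x - xb) < e" and b: "b \<in> frechet_normal (E1 \<times> E2) x"
    and bs: "\<And>h. - b h \<le> s h + e * norm h"
    using fuzzy_minimum[OF _ cl s _ sM xb \<delta>(1) _ e(1)] by blast
  obtain u t u' t' where xx: "x = ((u, t), (u', t'))" by (metis surj_pair)
  have m: "(u, t) \<in> E1" "(u', t') \<in> E2" using x(1) by (auto simp: xx)
  have nu: "norm (u - w0) < e" "norm (u' - w0) < e"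
    using x(2) norm_fst_le_norm[of "x - xb"] norm_fst_le_norm[of "fst (x - xb)"]
      norm_snd_le_norm[of "x - xb"] norm_fst_le_norm[of "snd (x - xb)"] by (auto simp: xx xb_def)
  define b1 where "b1 h = b (h, 0)" for h
  define b2 where "b2 h = b (0, h)" for h
  have n1: "b1 \<in> frechet_normal {(u, t). u \<in> cball w0 \<rho> \<and> f1 u \<le> t} (u, t)"
    and n2: "b2 \<in> frechet_normal {(u, t). u \<in> cball w0 \<rho> \<and> f2 u \<le> t} (u', t')"
    using frechet_normal_prod[OF b[unfolded xx] m] by (simp_all add: b1_def[abs_def] b2_def[abs_def] E1_def E2_def)
  have bl: "linear b" using b by (simp add: frechet_normal_def bounded_linear.linear)
  have neg: "b (- h) = - b h" for h using linear_neg[OF bl] by simp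
  \<comment> \<open>\<open>s\<close> is linear in the vertical directions, with slope 1, so testing
    with both signs pins \<open>b\<close> there to -1 up to \<open>e\<close>.\<close>
  have s1: "\<bar>b1 (0, 1) + 1\<bar> \<le> e" and s2: "\<bar>b2 (0, 1) + 1\<bar> \<le> e"
    using bs[of "((0, 1), 0)"] bs[of "- ((0, 1), 0)"] bs[of "(0, (0, 1))"] bs[of "- (0, (0, 1))"]
      neg[of "((0, 1), 0)"] neg[of "(0, (0, 1))"] linear_0[OF al]
    by (auto simp: b1_def b2_def s_def norm_Pair zero_prod_def)
  have absI: "\<bar>c h\<bar> \<le> q * norm h" if "linear c" "\<And>h. - c h \<le> q * norm h" for c :: "'w \<Rightarrow> real" and q h
    using that(2)[of h] that(2)[of "- h"] linear_neg[OF that(1), of h] by auto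
  have lin: "linear (\<lambda>h. b1 (h, 0))" "linear (\<lambda>h. b2 (h, 0))"
    unfolding b1_def b2_def using linear_compose[OF _ bl, unfolded o_def]
    by (auto intro!: linear_compose[OF _ bl, unfolded o_def] linearI simp: zero_prod_def)
  have k1: "\<bar>b1 (h, 0)\<bar> \<le> K * norm h" for h
  proof (rule absI[OF lin(1)])
    fix h
    have "- b1 (h, 0) \<le> - \<alpha> h + e * norm h + C * norm h + e * norm h"
      using bs[of "((h, 0), 0)"] by (simp add: b1_def s_def norm_Pair zero_prod_def)
    moreover have "- \<alpha> h \<le> B * norm h" using B(2)[of h] by simp
    moreover have "e * norm h \<le> 1 * norm h" using e by (intro mult_right_mono) auto
    ultimately show "- b1 (h, 0) \<le> K * norm h" by (simp add: K_def algebra_simps)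
  qed
  have k2: "\<bar>b2 (h, 0)\<bar> \<le> K * norm h" for h
  proof (rule absI[OF lin(2)])
    fix h
    have "- b2 (h, 0) \<le> C * norm h + e * norm h"
      using bs[of "(0, (h, 0))"] linear_0[OF al] by (simp add: b2_def s_def norm_Pair zero_prod_def)
    moreover have "e * norm h \<le> 1 * norm h" using e by (intro mult_right_mono) auto
    moreover have "0 \<le> B * norm h" using B by simp
    ultimately show "- b2 (h, 0) \<le> K * norm h" using norm_ge_zero[of h]
      unfolding K_def distrib_right by linarith
  qed
  \<comment> \<open>On the diagonal the coupling term vanishes, so its large constant
    \<open>C\<close> does not enter.\<close>
  have sum: "\<bar>b1 (h, 0) + b2 (h, 0) - \<alpha> h\<bar> \<le> (3 * e) * norm h" for h
  proof (rule absI[of "\<lambda>h. b1 (h, 0) + b2 (h, 0) - \<alpha> h"])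
    show "linear (\<lambda>h. b1 (h, 0) + b2 (h, 0) - \<alpha> h)" by (intro linear_compose_sub linear_compose_add lin al)
    fix h
    have "b1 (h, 0) + b2 (h, 0) = b ((h, 0), (h, 0))"
      using linear_add[OF bl, of "((h, 0), 0)" "(0, (h, 0))"] by (simp add: b1_def b2_def)
    moreover have "- b ((h, 0), (h, 0)) \<le> - \<alpha> h + e * norm h + e * norm ((h, 0::real), (h, 0::real))"
      using bs[of "((h, 0), (h, 0))"] by (simp add: s_def)
    moreover have "norm ((h, 0::real), (h, 0::real)) \<le> 2 * norm h"
      using norm_Pair_le[of "(h, 0::real)" "(h, 0::real)"] by (simp add: norm_Pair)
    then have "e * norm ((h, 0::real), (h, 0::real)) \<le> e * (2 * norm h)" using e by (intro mult_left_mono) auto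
    ultimately show "- (b1 (h, 0) + b2 (h, 0) - \<alpha> h) \<le> (3 * e) * norm h" by simp
  qed
  have ut: "norm (u - w0) < \<rho>" "f1 u \<le> t" "norm (u' - w0) < \<rho>" "f2 u' \<le> t'"
    using nu e(3) m by (auto simp: E1_def E2_def)
  obtain A where A: "bounded_linear A" "(\<lambda>(h, t). A h - t) \<in> frechet_normal (epigraph f1) (u, f1 u)"
    "\<And>h. \<bar>A h - b1 (h, 0)\<bar> \<le> 2 * e * K * norm h"
    using epigraph_normal_rescale[OF n1 ut(1,2) e(2) s1 k1] by blast
  obtain A' where A': "bounded_linear A'" "(\<lambda>(h, t). A' h - t) \<in> frechet_normal (epigraph f2) (u', f2 u')"
    "\<And>h. \<bar>A' h - b2 (h, 0)\<bar> \<le> 2 * e * K * norm h"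
    using epigraph_normal_rescale[OF n2 ut(3,4) e(2) s2 k2] by blast
  have "\<bar>A h + A' h - \<alpha> h\<bar> \<le> \<epsilon> * norm h" for h
  proof -
    have "\<bar>A h + A' h - \<alpha> h\<bar> \<le> (3 * e + 4 * e * K) * norm h"
      using A(3)[of h] A'(3)[of h] sum[of h] by (simp add: distrib_right)
    also have "\<dots> \<le> \<epsilon> * norm h" using eK by (intro mult_right_mono) auto
    finally show ?thesis .
  qed
  then show ?thesis using A(1,2) A'(1,2) nu e\<epsilon>
    by (intro exI[of _ u] exI[of _ u'] exI[of _ A] exI[of _ A']) simp
qed

section \<open>Limits of subgradients of scalarisations\<close>

text \<open>Strict Lipschitz continuity provides only convergent subsequences; this recovers
  convergence of the whole sequence.\<close>

lemma tendsto_zero_subseqI: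
  fixes x :: "nat \<Rightarrow> real"
  assumes "\<And>r :: nat \<Rightarrow> nat. strict_mono r \<Longrightarrow> \<exists>\<sigma> :: nat \<Rightarrow> nat. strict_mono \<sigma> \<and> (\<lambda>k. x (r (\<sigma> k))) \<longlonglongrightarrow> 0"
  shows "x \<longlonglongrightarrow> 0"
proof (rule ccontr)
  assume "\<not> x \<longlonglongrightarrow> 0"
  then obtain e where e: "e > 0" "\<And>N. \<exists>n\<ge>N. \<bar>x n\<bar> \<ge> e"
    unfolding LIMSEQ_iff by (metis diff_zero linorder_not_less real_norm_def)
  then have inf: "infinite {n. \<bar>x n\<bar> \<ge> e}" unfolding infinite_nat_iff_unbounded_le by blast
  define r where "r = enumerate {n. \<bar>x n\<bar> \<ge> e}"
  have r: "strict_mono r" "\<And>n. \<bar>x (r n)\<bar> \<ge> e"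
    using strict_mono_enumerate[OF inf] enumerate_in_set[OF inf] by (auto simp: r_def)
  obtain \<sigma> :: "nat \<Rightarrow> nat" where "strict_mono \<sigma>" and \<sigma>: "(\<lambda>k. x (r (\<sigma> k))) \<longlonglongrightarrow> 0" using assms[OF r(1)] by blast
  from tendsto_rabs[OF \<sigma>] have "(\<lambda>k. \<bar>x (r (\<sigma> k))\<bar>) \<longlonglongrightarrow> 0" by simp
  then have "e \<le> 0" using r(2) by (intro LIMSEQ_le_const[of _ 0 e]) auto
  then show False using e by simp
qed

lemma tendsto_zero_below_inverse_Suc:
  fixes e :: "nat \<Rightarrow> real"
  assumes "\<And>n. e n > 0" "\<And>n. e n \<le> 1 / real (Suc n)"
  shows "e \<longlonglongrightarrow> 0"
proof (rule tendsto_sandwich[OF _ _ tendsto_const LIMSEQ_inverse_real_of_nat])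
  show "\<forall>\<^sub>F n in sequentially. 0 \<le> e n" using less_imp_le[OF assms(1)] by (intro always_eventually allI)
  show "\<forall>\<^sub>F n in sequentially. e n \<le> inverse (real (Suc n))"
    using assms(2) unfolding inverse_eq_divide by (intro always_eventually allI)
qed

lemma weak_star_limit_bound:
  fixes \<zeta> :: "'z::real_normed_vector \<Rightarrow> real"
  assumes lin: "\<And>n. linear (\<zeta>s n)" and B: "\<And>n z. \<bar>\<zeta>s n z\<bar> \<le> B * norm z" and lim: "\<And>z. (\<lambda>n. \<zeta>s n z) \<longlonglongrightarrow> \<zeta> z"
  shows "linear \<zeta>" "\<bar>\<zeta> z\<bar> \<le> B * norm z"
proof -
  show "linear \<zeta>"
  proof (rule linearI)
    show "\<zeta> (x + y) = \<zeta> x + \<zeta> y" for x y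
      by (rule LIMSEQ_unique[OF lim[of "x + y"]]) (simp add: linear_add[OF lin] tendsto_add lim)
    show "\<zeta> (c *\<^sub>R x) = c *\<^sub>R \<zeta> x" for c x
      by (rule LIMSEQ_unique[OF lim[of "c *\<^sub>R x"]]) (simp add: linear_scale[OF lin] tendsto_mult_left lim)
  qed
  show "\<bar>\<zeta> z\<bar> \<le> B * norm z"
    using tendsto_rabs[OF lim[of z]] B by (intro LIMSEQ_le_const2[of "\<lambda>n. \<bar>\<zeta>s n z\<bar>"]) auto
qed

text \<open>Bounded functionals converging weakly* to 0 tend to 0 along norm convergent arguments,
  and by \<open>V0\<close> every subsequence of the difference quotients has a norm convergent
  one.\<close>

lemma strictly_lipschitz_quotient_tendsto:
  fixes h :: "'w::real_normed_vector \<Rightarrow> 'z::real_normed_vector"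
  assumes V0: "\<And>ws ts. ws \<longlonglongrightarrow> w0 \<Longrightarrow> (\<And>k. ts k > 0) \<Longrightarrow> ts \<longlonglongrightarrow> 0 \<Longrightarrow> \<exists>\<sigma>. strict_mono \<sigma> \<and>
      convergent (\<lambda>k. (1 / ts (\<sigma> k)) *\<^sub>R (h (ws (\<sigma> k) + ts (\<sigma> k) *\<^sub>R v) - h (ws (\<sigma> k))))"
    and w: "ws \<longlonglongrightarrow> w0" and t: "\<And>k. ts k > 0" "ts \<longlonglongrightarrow> 0"
    and lin: "\<And>n. linear (\<xi> n)" and B: "\<And>n z. \<bar>\<xi> n z\<bar> \<le> B * norm z" and lim: "\<And>z. (\<lambda>n. \<xi> n z) \<longlonglongrightarrow> 0"
  shows "(\<lambda>n. \<xi> n ((1 / ts n) *\<^sub>R (h (ws n + ts n *\<^sub>R v) - h (ws n)))) \<longlonglongrightarrow> 0"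
proof (rule tendsto_zero_subseqI)
  fix r :: "nat \<Rightarrow> nat" assume r: "strict_mono r"
  let ?q = "\<lambda>n. (1 / ts n) *\<^sub>R (h (ws n + ts n *\<^sub>R v) - h (ws n))"
  have "(\<lambda>k. ws (r k)) \<longlonglongrightarrow> w0" "(\<lambda>k. ts (r k)) \<longlonglongrightarrow> 0"
    using LIMSEQ_subseq_LIMSEQ[OF w r] LIMSEQ_subseq_LIMSEQ[OF t(2) r] by (auto simp: o_def)
  from V0[OF this(1) _ this(2)] t(1)
  obtain \<sigma> q where \<sigma>: "strict_mono \<sigma>" "(\<lambda>k. ?q (r (\<sigma> k))) \<longlonglongrightarrow> q" by (auto simp: convergent_def)
  have rs: "strict_mono (\<lambda>k. r (\<sigma> k))" using strict_mono_o[OF r \<sigma>(1)] by (simp add: o_def)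
  have "(\<lambda>k. \<xi> (r (\<sigma> k)) q) \<longlonglongrightarrow> 0" using LIMSEQ_subseq_LIMSEQ[OF lim rs] by (simp add: o_def)
  moreover have "(\<lambda>k. \<xi> (r (\<sigma> k)) (?q (r (\<sigma> k)) - q)) \<longlonglongrightarrow> 0"
  proof (rule Lim_null_comparison)
    show "\<forall>\<^sub>F k in sequentially. norm (\<xi> (r (\<sigma> k)) (?q (r (\<sigma> k)) - q)) \<le> B * norm (?q (r (\<sigma> k)) - q)"
      using B by simp
    have "(\<lambda>k. B * norm (?q (r (\<sigma> k)) - q)) \<longlonglongrightarrow> B * norm (q - q)" by (intro tendsto_intros \<sigma>(2))
    then show "(\<lambda>k. B * norm (?q (r (\<sigma> k)) - q)) \<longlonglongrightarrow> 0" by simp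
  qed
  ultimately have "(\<lambda>k. \<xi> (r (\<sigma> k)) q + \<xi> (r (\<sigma> k)) (?q (r (\<sigma> k)) - q)) \<longlonglongrightarrow> 0 + 0" by (rule tendsto_add)
  then have "(\<lambda>k. \<xi> (r (\<sigma> k)) (?q (r (\<sigma> k)))) \<longlonglongrightarrow> 0" by (simp add: linear_diff[OF lin])
  then show "\<exists>\<sigma>. strict_mono \<sigma> \<and> (\<lambda>k. \<xi> (r (\<sigma> k)) (?q (r (\<sigma> k)))) \<longlonglongrightarrow> 0" using \<sigma>(1) by blast
qed

lemma lipschitz_around_cball:
  assumes "lipschitz_around h w0"
  shows "\<exists>\<rho>>0. \<exists>C\<ge>0. \<forall>u\<in>cball w0 \<rho>. \<forall>v\<in>cball w0 \<rho>. norm (h u - h v) \<le> C * norm (u - v)"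
proof -
  obtain N C where N: "open N" "w0 \<in> N" "\<And>u v. u \<in> N \<Longrightarrow> v \<in> N \<Longrightarrow> norm (h u - h v) \<le> C * norm (u - v)"
    using assms unfolding lipschitz_around_def by blast
  obtain \<rho> where \<rho>: "\<rho> > 0" "cball w0 \<rho> \<subseteq> N" using N open_contains_cball by blast
  have "norm (h u - h v) \<le> max C 0 * norm (u - v)" if "u \<in> cball w0 \<rho>" "v \<in> cball w0 \<rho>" for u v
  proof -
    have "norm (h u - h v) \<le> C * norm (u - v)" using N(3) \<rho>(2) that by blast
    also have "\<dots> \<le> max C 0 * norm (u - v)" by (intro mult_right_mono) auto
    finally show ?thesis .
  qed
  then show ?thesis using \<rho>(1) by (intro exI[of _ \<rho>] conjI exI[of _ "max C 0"]) auto
qed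

lemma limiting_subdiffI:
  fixes \<phi> :: "'w::real_normed_vector \<Rightarrow> real"
  assumes \<alpha>: "bounded_linear \<alpha>" and nA: "\<And>n. (\<lambda>(h, t). A n h - t) \<in> frechet_normal (epigraph \<phi>) (u n, \<phi> (u n))"
    and u: "u \<longlonglongrightarrow> w0" "(\<lambda>n. \<phi> (u n)) \<longlonglongrightarrow> \<phi> w0" and A: "\<And>h. (\<lambda>n. A n h) \<longlonglongrightarrow> \<alpha> h"
  shows "\<alpha> \<in> limiting_subdiff \<phi> w0"
proof -
  have "bounded_linear (\<lambda>(h, t). \<alpha> h - t)"
    unfolding case_prod_beta
    by (intro bounded_linear_sub bounded_linear_compose[OF \<alpha>] bounded_linear_fst bounded_linear_snd)
  moreover have "(\<lambda>n. (u n, \<phi> (u n))) \<longlonglongrightarrow> (w0, \<phi> w0)" using u by (rule tendsto_Pair)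
  moreover have "(u n, \<phi> (u n)) \<in> epigraph \<phi>" for n by (simp add: epigraph_def)
  moreover have "(\<lambda>n. (\<lambda>(h, t). A n h - t) z) \<longlonglongrightarrow> (\<lambda>(h, t). \<alpha> h - t) z" for z
    using A by (cases z) (auto intro!: tendsto_intros)
  ultimately have "(\<lambda>(h, t). \<alpha> h - t) \<in> limiting_normal (epigraph \<phi>) (w0, \<phi> w0)"
    unfolding limiting_normal_def using nA
    by (intro CollectI conjI exI[of _ "\<lambda>n. (u n, \<phi> (u n))"] exI[of _ "\<lambda>n (h, t). A n h - t"]) auto
  then show ?thesis using \<alpha> by (simp add: limiting_subdiff_def)
qed

text \<open>
  Split \<open>\<zeta>s n \<circ> g\<close> into \<open>\<zeta> \<circ> g\<close> and \<open>(\<zeta>s n - \<zeta>) \<circ> g\<close>; strict Lipschitz continuity makes the Frechet subgradients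
  of the second summand converge weakly* to 0.
\<close>

theorem weak_star_limit_in_limiting_subdiff:
  fixes g :: "'w::banach \<Rightarrow> 'z::real_normed_vector"
  assumes asp: "asplund TYPE('w)" and g: "strictly_lipschitz_at g w0"
    and \<zeta>: "\<And>n. linear (\<zeta>s n)" "\<And>n z. \<bar>\<zeta>s n z\<bar> \<le> B * norm z" "\<And>z. (\<lambda>n. \<zeta>s n z) \<longlonglongrightarrow> \<zeta> z" and B: "B \<ge> 0"
    and \<alpha>: "\<And>n. bounded_linear (\<alpha>s n)" "bounded_linear \<alpha>" "\<And>h. (\<lambda>n. \<alpha>s n h) \<longlonglongrightarrow> \<alpha> h" and w: "ws \<longlonglongrightarrow> w0"
    and sub: "\<And>n \<tau>. \<tau> > 0 \<Longrightarrow> \<exists>\<delta>>0. \<forall>u. norm (u - ws n) < \<delta> \<longrightarrow>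
        \<alpha>s n (u - ws n) \<le> \<zeta>s n (g u - g (ws n)) + \<tau> * norm (u - ws n)"
  shows "\<alpha> \<in> limiting_subdiff (\<zeta> \<circ> g) w0"
proof -
  have \<zeta>l: "linear \<zeta>" "\<bar>\<zeta> z\<bar> \<le> B * norm z" for z using weak_star_limit_bound[OF \<zeta>] by blast+
  obtain \<rho> C where \<rho>: "\<rho> > 0" and C: "C \<ge> 0"
    and lip: "\<And>u v. u \<in> cball w0 \<rho> \<Longrightarrow> v \<in> cball w0 \<rho> \<Longrightarrow> norm (g u - g v) \<le> C * norm (u - v)"
    using lipschitz_around_cball[of g w0] g unfolding strictly_lipschitz_at_def by metis
  \<comment> \<open>From \<open>n0\<close> on, the ball of radius \<open>\<rho>/2\<close> around
    \<open>ws n\<close> lies in the ball where \<open>g\<close> is known to be Lipschitz; hence the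
    shift \<open>n + n0\<close> below.\<close>
  obtain n0 where n0: "\<And>n. n \<ge> n0 \<Longrightarrow> norm (ws n - w0) < \<rho>/2"
    using w \<rho> unfolding LIMSEQ_iff by (meson half_gt_zero)
  define \<xi> where "\<xi> n z = \<zeta>s n z - \<zeta> z" for n z
  have \<xi>: "linear (\<xi> n)" "\<bar>\<xi> n z\<bar> \<le> 2 * B * norm z" for n z
    unfolding \<xi>_def using \<zeta>(2)[of n z] \<zeta>l(2)[of z] by (auto intro!: linear_compose_sub \<zeta> \<zeta>l)
  have \<xi>0: "(\<lambda>n. \<xi> n z) \<longlonglongrightarrow> 0" for z
    unfolding \<xi>_def using tendsto_diff[OF \<zeta>(3)[of z] tendsto_const[of "\<zeta> z"]] by simp
  let ?f1 = "\<zeta> \<circ> g" and ?f2 = "\<lambda>n u. \<xi> n (g u)"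
  define \<epsilon> where "\<epsilon> n = min (1 / real (Suc n)) (\<rho>/4)" for n
  have \<epsilon>: "\<epsilon> n > 0" "\<epsilon> n \<le> 1 / real (Suc n)" "\<epsilon> n < \<rho>/2" for n using \<rho> by (auto simp: \<epsilon>_def min_def)
  have lip1: "\<bar>?f1 u - ?f1 v\<bar> \<le> 2 * B * C * norm (u - v)" and lip2: "\<bar>?f2 n u - ?f2 n v\<bar> \<le> 2 * B * C * norm (u - v)"
    if "u \<in> cball w0 \<rho>" "v \<in> cball w0 \<rho>" for u v n
  proof -
    have "2 * B * norm (g u - g v) \<le> 2 * B * (C * norm (u - v))" using lip[OF that] B by (intro mult_left_mono) auto
    moreover have "\<bar>\<zeta> (g u - g v)\<bar> \<le> 2 * B * norm (g u - g v)"
      using \<zeta>l(2)[of "g u - g v"] mult_nonneg_nonneg[OF B norm_ge_zero[of "g u - g v"]] by linarith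
    moreover have "\<bar>\<xi> n (g u - g v)\<bar> \<le> 2 * B * norm (g u - g v)" by (rule \<xi>(2))
    ultimately show "\<bar>?f1 u - ?f1 v\<bar> \<le> 2 * B * C * norm (u - v)" "\<bar>?f2 n u - ?f2 n v\<bar> \<le> 2 * B * C * norm (u - v)"
      by (simp_all add: linear_diff[OF \<zeta>l(1)] linear_diff[OF \<xi>(1)])
  qed
  have ballsub: "v \<in> cball w0 \<rho>" if "n \<ge> n0" "v \<in> cball (ws n) (\<rho>/2)" for n v
    using that(2) n0[OF that(1)] norm_triangle_ineq[of "v - ws n" "ws n - w0"]
    by (simp add: dist_norm norm_minus_commute)
  have ballsub': "v \<in> cball w0 \<rho>" if "norm (v - ws (n + n0)) \<le> \<rho>/2" for n v
    by (rule ballsub[OF le_add2]) (use that in \<open>simp add: dist_norm norm_minus_commute\<close>)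
  have "\<forall>n. \<exists>u u' A A'. norm (u - ws (n + n0)) < \<epsilon> n \<and> norm (u' - ws (n + n0)) < \<epsilon> n \<and> bounded_linear A \<and> bounded_linear A' \<and>
    (\<lambda>(h, t). A h - t) \<in> frechet_normal (epigraph ?f1) (u, ?f1 u) \<and>
    (\<lambda>(h, t). A' h - t) \<in> frechet_normal (epigraph (?f2 (n + n0))) (u', ?f2 (n + n0) u') \<and>
    (\<forall>h. \<bar>A h + A' h - \<alpha>s (n + n0) h\<bar> \<le> \<epsilon> n * norm h)"
  proof
    fix n
    show "\<exists>u u' A A'. norm (u - ws (n + n0)) < \<epsilon> n \<and> norm (u' - ws (n + n0)) < \<epsilon> n \<and> bounded_linear A \<and> bounded_linear A' \<and>
    (\<lambda>(h, t). A h - t) \<in> frechet_normal (epigraph ?f1) (u, ?f1 u) \<and>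
    (\<lambda>(h, t). A' h - t) \<in> frechet_normal (epigraph (?f2 (n + n0))) (u', ?f2 (n + n0) u') \<and>
    (\<forall>h. \<bar>A h + A' h - \<alpha>s (n + n0) h\<bar> \<le> \<epsilon> n * norm h)"
    proof (rule fuzzy_sum_rule[OF asp, of "\<rho>/2" "2 * B * C"])
      fix \<tau> :: real assume "\<tau> > 0"
      then obtain \<delta> where "\<delta> > 0" "\<forall>u. norm (u - ws (n + n0)) < \<delta> \<longrightarrow>
        \<alpha>s (n + n0) (u - ws (n + n0)) \<le> \<zeta>s (n + n0) (g u - g (ws (n + n0))) + \<tau> * norm (u - ws (n + n0))" using sub by blast
      then show "\<exists>\<delta>>0. \<forall>u. norm (u - ws (n + n0)) < \<delta> \<longrightarrow>
        \<alpha>s (n + n0) (u - ws (n + n0)) \<le> (?f1 u - ?f1 (ws (n + n0))) + (?f2 (n + n0) u - ?f2 (n + n0) (ws (n + n0))) + \<tau> * norm (u - ws (n + n0))"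
        by (intro exI[of _ \<delta>]) (auto simp: \<xi>_def linear_diff[OF \<zeta>(1)])
    qed (use \<rho> B C \<alpha> \<epsilon> lip1 lip2 ballsub[of "n + n0"] in auto)
  qed
  then obtain u u' A A' where
    "\<forall>n. norm (u n - ws (n + n0)) < \<epsilon> n \<and> norm (u' n - ws (n + n0)) < \<epsilon> n \<and> bounded_linear (A n) \<and> bounded_linear (A' n) \<and>
    (\<lambda>(h, t). A n h - t) \<in> frechet_normal (epigraph ?f1) (u n, ?f1 (u n)) \<and>
    (\<lambda>(h, t). A' n h - t) \<in> frechet_normal (epigraph (?f2 (n + n0))) (u' n, ?f2 (n + n0) (u' n)) \<and>
    (\<forall>h. \<bar>A n h + A' n h - \<alpha>s (n + n0) h\<bar> \<le> \<epsilon> n * norm h)"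
    by metis
  then have un: "\<And>n. norm (u n - ws (n + n0)) < \<epsilon> n" and un': "\<And>n. norm (u' n - ws (n + n0)) < \<epsilon> n"
    and bA: "\<And>n. bounded_linear (A n)" "\<And>n. bounded_linear (A' n)"
    and nA: "\<And>n. (\<lambda>(h, t). A n h - t) \<in> frechet_normal (epigraph ?f1) (u n, ?f1 (u n))"
    and nA': "\<And>n. (\<lambda>(h, t). A' n h - t) \<in> frechet_normal (epigraph (?f2 (n + n0))) (u' n, ?f2 (n + n0) (u' n))"
    and AA: "\<And>n h. \<bar>A n h + A' n h - \<alpha>s (n + n0) h\<bar> \<le> \<epsilon> n * norm h" by blast+
  have \<epsilon>0: "\<epsilon> \<longlonglongrightarrow> 0"
    by (rule tendsto_zero_below_inverse_Suc[OF \<epsilon>(1,2)])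
  have wsn: "(\<lambda>n. ws (n + n0)) \<longlonglongrightarrow> w0" using w by (rule LIMSEQ_ignore_initial_segment)
  have near: "v \<longlonglongrightarrow> w0" if "\<And>n. norm (v n - ws (n + n0)) < \<epsilon> n" for v :: "nat \<Rightarrow> 'w"
  proof -
    have "(\<lambda>n. v n - ws (n + n0)) \<longlonglongrightarrow> 0"
      by (rule Lim_null_comparison[OF always_eventually[OF allI[OF less_imp_le[OF that]]] \<epsilon>0])
    from tendsto_add[OF this wsn] show ?thesis by simp
  qed
  have ulim: "u \<longlonglongrightarrow> w0" and ulim': "u' \<longlonglongrightarrow> w0" using near un un' by blast+
  obtain V0 where V0: "open V0" "0 \<in> V0" and V0c: "\<forall>v\<in>V0. \<forall>ws ts. ws \<longlonglongrightarrow> w0 \<and> (\<forall>k. ts k > 0) \<and> ts \<longlonglongrightarrow> 0 \<longrightarrow>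
           (\<exists>\<sigma>. strict_mono \<sigma> \<and> convergent (\<lambda>k. (1 / ts (\<sigma> k)) *\<^sub>R (g (ws (\<sigma> k) + ts (\<sigma> k) *\<^sub>R v) - g (ws (\<sigma> k)))))"
    using g unfolding strictly_lipschitz_at_def by blast
  \<comment> \<open>The Frechet inequality at \<open>u' n + t n *\<^sub>R v\<close> bounds
    \<open>A' n v\<close> by \<open>\<xi> (n + n0)\<close> of a difference quotient of
    \<open>g\<close>, up to a null sequence. Only upper bounds arise; using \<open>v\<close> and
    \<open>- v\<close> gives the limit 0.\<close>
  have upper: "\<exists>y. y \<longlonglongrightarrow> 0 \<and> (\<forall>n. A' n v \<le> y n)" if v: "v \<in> V0" for v
  proof -
    define \<tau> where "\<tau> n = 1 / real (Suc n) / (norm v + 1)" for n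
    have nv: "norm v + 1 > 0" using norm_ge_zero[of v] by linarith
    have \<tau>: "\<tau> n > 0" "\<tau> n * norm v \<le> 1 / real (Suc n)" for n
    proof -
      show "\<tau> n > 0" unfolding \<tau>_def using nv by (intro divide_pos_pos) auto
      have "1 / real (Suc n) * (norm v / (norm v + 1)) \<le> 1 / real (Suc n)"
        using nv by (intro mult_left_le) auto
      then show "\<tau> n * norm v \<le> 1 / real (Suc n)" by (simp add: \<tau>_def)
    qed
    have "\<forall>n. \<exists>\<delta>>0. \<forall>x. norm (x - u' n) < \<delta> \<longrightarrow> (\<lambda>(h, t). A' n h - t) (x - u' n, ?f2 (n + n0) x - ?f2 (n + n0) (u' n)) \<le> \<tau> n * norm (x - u' n)"
    proof
      fix n
      show "\<exists>\<delta>>0. \<forall>x. norm (x - u' n) < \<delta> \<longrightarrow> (\<lambda>(h, t). A' n h - t) (x - u' n, ?f2 (n + n0) x - ?f2 (n + n0) (u' n)) \<le> \<tau> n * norm (x - u' n)"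
      proof (rule graph_normal_subgradient[where G = "?f2 (n + n0)", OF nA' _ _ _ _ \<tau>(1)])
        show "\<rho>/2 - \<epsilon> n > 0" using \<epsilon>(3)[of n] by simp
        show "0 \<le> 2 * B * C" using B C by simp
        fix x assume x: "norm (x - u' n) < \<rho>/2 - \<epsilon> n"
        show "(x, ?f2 (n + n0) x) \<in> epigraph (?f2 (n + n0))" by (simp add: epigraph_def)
        have "norm (x - ws (n + n0)) \<le> \<rho>/2" using x un'[of n] norm_triangle_ineq[of "x - u' n" "u' n - ws (n + n0)"] by simp
        moreover have "norm (u' n - ws (n + n0)) \<le> \<rho>/2" using un'[of n] \<epsilon>(3)[of n] by simp
        ultimately have "x \<in> cball w0 \<rho>" "u' n \<in> cball w0 \<rho>" by (auto intro: ballsub' simp del: mem_cball)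
        then show "norm (?f2 (n + n0) x - ?f2 (n + n0) (u' n)) \<le> 2 * B * C * norm (x - u' n)" using lip2 by simp
      qed
    qed
    then obtain \<delta> where \<delta>: "\<And>n. \<delta> n > 0" "\<And>n x. norm (x - u' n) < \<delta> n \<Longrightarrow>
        A' n (x - u' n) - (?f2 (n + n0) x - ?f2 (n + n0) (u' n)) \<le> \<tau> n * norm (x - u' n)"
      unfolding case_prod_conv by metis
    \<comment> \<open>The step length is chosen after \<open>\<delta> n\<close>, so that the
      inequality applies, and tends to 0, as strict Lipschitz continuity requires.\<close>
    define t where "t n = min (1 / real (Suc n)) (\<delta> n / 2 / (norm v + 1))" for n
    have t: "t n > 0" "t n \<le> 1 / real (Suc n)" for n using \<delta>(1)[of n] nv by (auto simp: t_def)
    have t\<delta>: "norm (t n *\<^sub>R v) < \<delta> n" for n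
    proof -
      have "t n \<le> \<delta> n / 2 / (norm v + 1)" unfolding t_def by (rule min.cobounded2)
      then have "t n * (norm v + 1) \<le> \<delta> n / 2" using nv by (simp only: pos_le_divide_eq)
      then show ?thesis using t(1)[of n] \<delta>(1)[of n] by (simp add: algebra_simps)
    qed
    have t0: "t \<longlonglongrightarrow> 0"
      by (rule tendsto_zero_below_inverse_Suc[OF t])
    let ?q = "\<lambda>n. (1 / t n) *\<^sub>R (g (u' n + t n *\<^sub>R v) - g (u' n))"
    have "A' n v \<le> \<xi> (n + n0) (?q n) + 1 / real (Suc n)" for n
    proof -
      have "A' n (t n *\<^sub>R v) - \<xi> (n + n0) (g (u' n + t n *\<^sub>R v) - g (u' n)) \<le> \<tau> n * norm (t n *\<^sub>R v)"
        using \<delta>(2)[of "u' n + t n *\<^sub>R v" n] t\<delta>[of n] by (simp add: linear_diff[OF \<xi>(1)])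
      moreover have "A' n (t n *\<^sub>R v) = t n * A' n v" using linear_scale[OF bounded_linear.linear[OF bA(2)]] by simp
      moreover have "\<xi> (n + n0) (g (u' n + t n *\<^sub>R v) - g (u' n)) = t n * \<xi> (n + n0) (?q n)"
        using linear_scale[OF \<xi>(1), of "n + n0" "1 / t n"] t(1)[of n] by simp
      moreover have "\<tau> n * norm (t n *\<^sub>R v) = t n * (\<tau> n * norm v)" using t(1)[of n] by simp
      ultimately have "t n * (A' n v) \<le> t n * (\<xi> (n + n0) (?q n) + \<tau> n * norm v)"
        unfolding distrib_left by linarith
      then have "A' n v \<le> \<xi> (n + n0) (?q n) + \<tau> n * norm v" using t(1)[of n] by (simp only: mult_le_cancel_left_pos)
      then show ?thesis using \<tau>(2)[of n] by linarith
    qed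
    moreover have "(\<lambda>n. \<xi> (n + n0) (?q n) + 1 / real (Suc n)) \<longlonglongrightarrow> 0 + 0"
    proof (rule tendsto_add)
      show "(\<lambda>n. \<xi> (n + n0) (?q n)) \<longlonglongrightarrow> 0"
      proof (rule strictly_lipschitz_quotient_tendsto[OF _ ulim' t(1) t0 \<xi>(1) \<xi>(2)])
        show "(\<lambda>n. \<xi> (n + n0) z) \<longlonglongrightarrow> 0" for z by (rule LIMSEQ_ignore_initial_segment[OF \<xi>0])
      qed (use V0c v in blast)
      show "(\<lambda>n. 1 / real (Suc n)) \<longlonglongrightarrow> 0" using LIMSEQ_inverse_real_of_nat by (simp add: inverse_eq_divide)
    qed
    ultimately show ?thesis by (intro exI[of _ "\<lambda>n. \<xi> (n + n0) (?q n) + 1 / real (Suc n)"]) simp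
  qed
  have A'0: "(\<lambda>n. A' n h) \<longlonglongrightarrow> 0" for h
  proof -
    obtain d where d: "d > 0" "ball 0 d \<subseteq> V0" using V0 open_contains_ball by blast
    define c where "c = d / (norm h + 1)"
    have nh: "norm h + 1 > 0" using norm_ge_zero[of h] by linarith
    have c: "c > 0" using d nh by (simp add: c_def)
    have "c * norm h < d" using d nh by (simp add: c_def field_simps)
    then have "c *\<^sub>R h \<in> V0" "- (c *\<^sub>R h) \<in> V0" using d c by (auto simp: subset_iff)
    then obtain y y' where y: "y \<longlonglongrightarrow> 0" "\<And>n. A' n (c *\<^sub>R h) \<le> y n" and y': "y' \<longlonglongrightarrow> 0" "\<And>n. A' n (- (c *\<^sub>R h)) \<le> y' n"
      using upper by meson
    have "(\<lambda>n. A' n (c *\<^sub>R h)) \<longlonglongrightarrow> 0"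
    proof (rule tendsto_sandwich[OF _ _ _ y(1)])
      show "\<forall>\<^sub>F n in sequentially. - y' n \<le> A' n (c *\<^sub>R h)"
        using y'(2) linear_neg[OF bounded_linear.linear[OF bA(2)], of _ "c *\<^sub>R h"] by (auto simp: minus_le_iff)
      show "(\<lambda>n. - y' n) \<longlonglongrightarrow> 0" using tendsto_minus[OF y'(1)] by simp
    qed (use y in simp)
    from tendsto_mult_left[OF this, of "1 / c"] show ?thesis
      using c linear_scale[OF bounded_linear.linear[OF bA(2)], of _ c h] by simp
  qed
  have Alim: "(\<lambda>n. A n h) \<longlonglongrightarrow> \<alpha> h" for h
  proof -
    have "(\<lambda>n. A n h + A' n h - \<alpha>s (n + n0) h) \<longlonglongrightarrow> 0"
    proof (rule Lim_null_comparison)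
      show "\<forall>\<^sub>F n in sequentially. norm (A n h + A' n h - \<alpha>s (n + n0) h) \<le> \<epsilon> n * norm h" using AA by simp
      show "(\<lambda>n. \<epsilon> n * norm h) \<longlonglongrightarrow> 0" using tendsto_mult_right[OF \<epsilon>0, of "norm h"] by simp
    qed
    from tendsto_diff[OF tendsto_add[OF this LIMSEQ_ignore_initial_segment[OF \<alpha>(3), of n0 h]] A'0[of h]]
    show ?thesis by simp
  qed
  have "(\<lambda>n. ?f1 (u n)) \<longlonglongrightarrow> ?f1 w0"
  proof -
    have "u n \<in> cball w0 \<rho>" for n by (rule ballsub'[of _ n]) (use un[of n] \<epsilon>(3)[of n] in linarith)
    then have "\<bar>?f1 (u n) - ?f1 w0\<bar> \<le> 2 * B * C * norm (u n - w0)" for n using lip1 \<rho> by simp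
    moreover have "(\<lambda>n. 2 * B * C * norm (u n - w0)) \<longlonglongrightarrow> 0"
      using tendsto_mult_left[OF tendsto_norm[OF tendsto_diff[OF ulim tendsto_const[of w0]]], of "2 * B * C"] by simp
    ultimately have "(\<lambda>n. ?f1 (u n) - ?f1 w0) \<longlonglongrightarrow> 0"
      using Lim_null_comparison[of "\<lambda>n. ?f1 (u n) - ?f1 w0" "\<lambda>n. 2 * B * C * norm (u n - w0)"] by simp
    then show ?thesis by (simp add: LIM_zero_iff)
  qed
  then show ?thesis using limiting_subdiffI[OF \<alpha>(2) nA ulim _ Alim] by blast
qed

section \<open>The optimality condition\<close>

text \<open>\<open>s z = inf {t. t e - z \<in> K}\<close> is the Gerstewitz scalarisation.
  \<open>e\<close> being interior bounds it above by a multiple of the norm. It is bounded below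
  since \<open>t e \<in> K\<close> with \<open>t < 0\<close> would make
  \<open>t e + (- t) e = 0\<close> an interior point.\<close>

lemma cone_gauge:
  fixes K :: "'z::real_normed_vector set"
  assumes K: "convex K" "cone K" and e: "e \<in> interior K" and K0: "0 \<notin> interior K"
  shows "\<exists>s l. l \<ge> 0 \<and> sublin s \<and> (\<forall>z. s z \<le> l * norm z) \<and> (\<forall>z. s z < 0 \<longrightarrow> - z \<in> interior K) \<and>
    (\<forall>z\<in>K. s (- z) \<le> 0) \<and> s e \<le> 1 \<and> s (- e) \<le> - 1"
proof -
  have sc: "c *\<^sub>R x \<in> K" if "c \<ge> 0" "x \<in> K" for c x using K(2) that by (simp add: cone_def)
  have add: "x + y \<in> K" if "x \<in> K" "y \<in> K" for x y using K that convex_cone by blast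
  have eK: "e \<in> K" using e interior_subset by blast
  have K00: "0 \<in> K" using sc[of 0 e] eK by simp
  obtain d where d: "d > 0" "ball e d \<subseteq> K" using e by (auto simp: mem_interior)
  have intK: "k + c *\<^sub>R e \<in> interior K" if k: "k \<in> K" and c: "c > 0" for k c
  proof -
    have "y \<in> K" if y: "dist (k + c *\<^sub>R e) y < c * d" for y
    proof -
      have "e - (1/c) *\<^sub>R (y - k) = (1/c) *\<^sub>R (k + c *\<^sub>R e - y)" using c by (simp add: algebra_simps)
      then have "dist e ((1/c) *\<^sub>R (y - k)) = dist (k + c *\<^sub>R e) y / c" using c by (simp add: dist_norm)
      then have "(1/c) *\<^sub>R (y - k) \<in> K" using y c d(2) by (auto simp: pos_divide_less_eq mult.commute)
      from add[OF k sc[OF less_imp_le[OF c] this]] show ?thesis using c by simp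
    qed
    then have "ball (k + c *\<^sub>R e) (c * d) \<subseteq> K" by auto
    then show ?thesis using c d(1) by (auto simp: mem_interior intro!: exI[of _ "c * d"])
  qed
  define R where "R z = {t. t *\<^sub>R e - z \<in> K}" for z
  \<comment> \<open>The factor 2 places \<open>e - (1 / (l * norm z)) *\<^sub>R z\<close> at
    distance \<open>d / 2\<close> from \<open>e\<close>, inside the open ball.\<close>
  define l where "l = 2 / d"
  have l: "l > 0" using d by (simp add: l_def)
  have lR: "l * norm z \<in> R z" for z
  proof (cases "z = 0")
    case True then show ?thesis using K00 by (simp add: R_def)
  next
    case False
    then have t: "l * norm z > 0" using l by simp
    have "dist e (e - (1 / (l * norm z)) *\<^sub>R z) = 1 / l" using False l by (simp add: dist_norm)
    also have "\<dots> < d" using d by (simp add: l_def)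
    finally have "e - (1 / (l * norm z)) *\<^sub>R z \<in> K" using d(2) by auto
    from sc[OF less_imp_le[OF t] this] show ?thesis using False l by (simp add: R_def scaleR_diff_right)
  qed
  have pos: "t \<ge> 0" if "t *\<^sub>R e \<in> K" for t
  proof (rule ccontr)
    assume "\<not> t \<ge> 0"
    then have "t *\<^sub>R e + (- t) *\<^sub>R e \<in> interior K" by (intro intK that) simp
    then show False using K0 by simp
  qed
  have bd: "- (l * norm z) \<le> t" if "t \<in> R z" for t z
  proof -
    have "(t *\<^sub>R e - z) + ((l * norm z) *\<^sub>R e + z) \<in> K" using that lR[of "- z"] by (intro add[of "t *\<^sub>R e - z"]) (auto simp: R_def)
    then have "(t + l * norm z) *\<^sub>R e \<in> K" by (simp add: algebra_simps)
    then show ?thesis using pos by fastforce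
  qed
  have bb: "bdd_below (R z)" for z by (rule bdd_belowI[OF bd])
  define s where "s z = Inf (R z)" for z
  have le: "s z \<le> t" if "t \<in> R z" for t z unfolding s_def using that bb by (rule cInf_lower)
  have "sublin s" unfolding s_def
  proof (rule sublin_Inf[of R "\<lambda>z. - (l * norm z)"])
    show "R z \<noteq> {}" for z using lR by blast
    show "- (l * norm z) \<le> t" if "t \<in> R z" for z t using bd that .
    fix x y t t' assume "t \<in> R x" "t' \<in> R y"
    then have "(t *\<^sub>R e - x) + (t' *\<^sub>R e - y) \<in> K" by (intro add) (auto simp: R_def)
    then have "t + t' \<in> R (x + y)" by (simp add: R_def algebra_simps)
    then show "\<exists>r\<in>R (x + y). r \<le> t + t'" by blast
  next
    fix x c t assume "(c::real) > 0" "t \<in> R x"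
    then have "c *\<^sub>R (t *\<^sub>R e - x) \<in> K" by (intro sc) (auto simp: R_def)
    then show "c * t \<in> R (c *\<^sub>R x)" by (simp add: R_def scaleR_diff_right)
  qed
  moreover have "- z \<in> interior K" if "s z < 0" for z
  proof -
    have "R z \<noteq> {}" using lR by blast
    from cInf_lessD[OF this, of 0] that obtain t where t: "t \<in> R z" "t < 0" by (auto simp: s_def)
    then have "(t *\<^sub>R e - z) + (- t) *\<^sub>R e \<in> interior K" by (intro intK) (auto simp: R_def)
    then show ?thesis by simp
  qed
  moreover have "s (- z) \<le> 0" if "z \<in> K" for z by (rule le) (use that in \<open>simp add: R_def\<close>)
  moreover have "s e \<le> 1" by (rule le) (use K00 in \<open>simp add: R_def\<close>)
  moreover have "s (- e) \<le> - 1" by (rule le) (use K00 in \<open>simp add: R_def\<close>)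
  ultimately show ?thesis using l le[OF lR] by (intro exI[of _ s] exI[of _ l]) simp
qed

text \<open>Exact penalisation: if \<open>v \<in> H w\<close>, the point \<open>(w, 0)\<close> has
  distance at most \<open>norm v\<close> from the graph, so calmness yields a feasible point at
  distance about \<open>r * norm v\<close> from \<open>w\<close>, and passing there changes \<phi>
  by at most \<open>C\<close> times this distance.\<close>

lemma exact_penalty:
  fixes \<phi> :: "'x::real_normed_vector \<times> 'p::real_normed_vector \<Rightarrow> real"
    and H :: "'x \<times> 'p \<Rightarrow> 'y::real_normed_vector set"
  assumes \<rho>: "\<rho> > 0" and C: "C \<ge> 0" and r: "r > 0"
    and lip: "\<And>u v. u \<in> ball w0 \<rho> \<Longrightarrow> v \<in> ball w0 \<rho> \<Longrightarrow> \<bar>\<phi> u - \<phi> v\<bar> \<le> C * norm (u - v)"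
    and pos: "\<And>u. u \<in> ball w0 \<rho> \<Longrightarrow> 0 \<in> H u \<Longrightarrow> \<phi> u \<ge> 0"
    and calm: "\<And>x p. (x, p) \<in> ball w0 \<rho> \<Longrightarrow> dist_S H p x \<le> ereal r * dist_GrH H x p 0"
  shows "\<exists>\<delta>>0. \<delta> \<le> \<rho> \<and> (\<forall>w v. norm (w - w0) < \<delta> \<longrightarrow> norm v < \<delta> \<longrightarrow> v \<in> H w \<longrightarrow> - (C * r * norm v) \<le> \<phi> w)"
proof -
  \<comment> \<open>\<open>\<delta> + r * \<delta> = \<rho> / 2\<close>; the remaining
    \<open>\<rho> / 2\<close> absorbs \<tau>, so that the nearby feasible point stays in the
    ball.\<close>
  define \<delta> where "\<delta> = \<rho> / 2 / (1 + r)"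
  have \<delta>: "\<delta> > 0" using \<rho> r by (simp add: \<delta>_def)
  have "(1 + r) * (\<rho> / 2) / (1 + r) = \<rho> / 2" by (rule nonzero_mult_div_cancel_left) (use r in simp)
  then have "(1 + r) * \<delta> = \<rho> / 2" unfolding \<delta>_def by (simp only: times_divide_eq_right)
  then have \<delta>r: "\<delta> + r * \<delta> = \<rho> / 2" by (simp add: distrib_right)
  have r\<delta>: "r * \<delta> > 0" using r \<delta> by simp
  have \<delta>\<rho>: "\<delta> \<le> \<rho>" using \<delta>r r\<delta> \<rho> by linarith
  have "- (C * r * norm v) \<le> \<phi> w" if w: "norm (w - w0) < \<delta>" and v: "norm v < \<delta>" "v \<in> H w" for w v
  proof -
    obtain x p where xp: "w = (x, p)" by (cases w)
    have wb: "w \<in> ball w0 \<rho>" using w \<delta>\<rho> by (simp add: dist_norm norm_minus_commute)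
    have "dist_GrH H x p 0 \<le> ereal (norm v)"
      unfolding dist_GrH_def using v(2) xp by (intro INF_lower2[of "((x, p), v)"]) (auto simp: graph_sv_def)
    then have "ereal r * dist_GrH H x p 0 \<le> ereal r * ereal (norm v)" using r by (intro ereal_mult_left_mono) auto
    then have dS: "dist_S H p x \<le> ereal (r * norm v)" using calm[of x p] wb xp by (metis order_trans times_ereal.simps(1))
    \<comment> \<open>The distance to the feasible set need not be attained; \<tau> is the slack and
      is removed at the end.\<close>
    have "- (C * r * norm v) - C * \<tau> \<le> \<phi> w" if \<tau>: "0 < \<tau>" "\<tau> \<le> \<rho> / 2" for \<tau>
    proof -
      have "dist_S H p x < ereal (r * norm v + \<tau>)" by (rule le_less_trans[OF dS]) (use \<tau>(1) in simp)
      then obtain q u where qu: "0 \<in> H (u, q)" "norm (p - q) + norm (x - u) < r * norm v + \<tau>"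
        unfolding dist_S_def INF_less_iff by auto
      have n: "norm (w - (u, q)) < r * norm v + \<tau>"
        using norm_Pair_le[of "x - u" "p - q"] qu(2) by (simp add: xp)
      have "r * norm v \<le> r * \<delta>" using v r by (intro mult_left_mono) auto
      then have "norm (w0 - (u, q)) < \<rho>"
        using n w \<tau>(2) \<delta>r dist_triangle[of w0 "(u, q)" w] norm_minus_commute[of w w0]
        unfolding dist_norm by linarith
      then have uq: "(u, q) \<in> ball w0 \<rho>" by (simp add: dist_norm)
      have "\<phi> (u, q) - C * norm (w - (u, q)) \<le> \<phi> w" using lip[OF wb uq] by linarith
      moreover have "C * norm (w - (u, q)) \<le> C * (r * norm v + \<tau>)" using n C by (intro mult_left_mono) auto
      ultimately show ?thesis using pos[OF uq qu(1)] by (simp add: distrib_left)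
    qed
    note 1 = this
    show ?thesis
    proof (rule field_le_epsilon)
      fix e :: real assume e: "e > 0"
      define \<tau> where "\<tau> = min (\<rho> / 2) (e / (C + 1))"
      have \<tau>: "0 < \<tau>" "\<tau> \<le> \<rho> / 2" "\<tau> \<le> e / (C + 1)"
        unfolding \<tau>_def by (use \<rho> e C in simp) (rule min.cobounded1, rule min.cobounded2)
      have "(C + 1) * \<tau> \<le> e" using \<tau>(3) C by (simp add: pos_le_divide_eq mult.commute)
      then have "C * \<tau> \<le> e" using \<tau>(1) by (simp add: distrib_right)
      then show "- (C * r * norm v) \<le> \<phi> w + e" using 1[OF \<tau>(1,2)] by linarith
    qed
  qed
  then show ?thesis using \<delta> \<delta>\<rho> by blast
qed

lemma closed_graph_cball:
  fixes g :: "'w::real_normed_vector \<Rightarrow> 'z::real_normed_vector"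
  assumes lip: "\<And>u v. u \<in> cball w0 \<rho> \<Longrightarrow> v \<in> cball w0 \<rho> \<Longrightarrow> norm (g u - g v) \<le> C * norm (u - v)"
  shows "closed {(u, z). u \<in> cball w0 \<rho> \<and> z = g u}"
  unfolding closed_sequential_limits
proof (intro allI impI, elim conjE)
  fix x l assume x: "\<forall>n. x n \<in> {(u, z). u \<in> cball w0 \<rho> \<and> z = g u}" and lim: "x \<longlonglongrightarrow> l"
  have l1: "(\<lambda>n. fst (x n)) \<longlonglongrightarrow> fst l" and l2: "(\<lambda>n. snd (x n)) \<longlonglongrightarrow> snd l"
    using lim by (auto intro: tendsto_fst tendsto_snd)
  have m: "fst (x n) \<in> cball w0 \<rho>" "snd (x n) = g (fst (x n))" for n using x[rule_format, of n] by auto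
  have m1: "fst l \<in> cball w0 \<rho>" by (rule closed_sequentially[OF closed_cball _ l1]) (use m(1) in simp)
  have "norm (snd (x n) - g (fst l)) \<le> C * norm (fst (x n) - fst l)" for n
    using lip[OF m(1)[of n] m1] m(2)[of n] by simp
  moreover have "(\<lambda>n. C * norm (fst (x n) - fst l)) \<longlonglongrightarrow> 0"
    using tendsto_mult_left[OF tendsto_norm[OF tendsto_diff[OF l1 tendsto_const[of "fst l"]]], of C] by simp
  ultimately have "(\<lambda>n. snd (x n) - g (fst l)) \<longlonglongrightarrow> 0"
    using Lim_null_comparison[of "\<lambda>n. snd (x n) - g (fst l)" "\<lambda>n. C * norm (fst (x n) - fst l)"] by simp
  then have "(\<lambda>n. snd (x n)) \<longlonglongrightarrow> g (fst l)" by (simp add: LIM_zero_iff)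
  then have "snd l = g (fst l)" using l2 LIMSEQ_unique by blast
  then show "l \<in> {(u, z). u \<in> cball w0 \<rho> \<and> z = g u}" using m1 by (auto simp: case_prod_beta)
qed

theorem theorem4p3:
  fixes g :: "'x::banach \<times> 'p::banach \<Rightarrow> 'z::banach"
    and H :: "'x \<times> 'p \<Rightarrow> 'y::banach set"
    and K :: "'z set"
    and xb :: 'x and pb :: 'p and L :: real
  assumes asplX: "asplund TYPE('x)" and asplY: "asplund TYPE('y)"
    and asplZ: "asplund TYPE('z)" and asplP: "asplund TYPE('p)"
    and K_closed: "closed K" and K_convex: "convex K" and K_cone: "cone K"
    and K_pointed: "K \<inter> uminus ` K = {0}" and K_int: "interior K \<noteq> {}"
    and H_closed: "closed (graph_sv H)"
    and L_pos: "L > 0"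
    and g_strict: "strictly_lipschitz_at g (xb, pb)"
    and g_lip: "\<exists>N. open N \<and> (xb, pb) \<in> N \<and>
                  (\<forall>x p u q. (x, p) \<in> N \<and> (u, q) \<in> N \<longrightarrow>
                     norm (g (x, p) - g (u, q)) \<le> L * (norm (x - u) + norm (p - q)))"
    and feas: "0 \<in> H (xb, pb)"
    and locmin: "\<exists>U W. open U \<and> xb \<in> U \<and> open W \<and> pb \<in> W \<and>
                  (\<forall>x\<in>U. \<forall>p\<in>W. 0 \<in> H (x, p) \<longrightarrow>
                     g (x, p) - g (xb, pb) \<notin> uminus ` interior K)"
    and calm: "\<exists>r>0. \<exists>N. open N \<and> (xb, pb) \<in> N \<and>
                  (\<forall>x p. (x, p) \<in> N \<longrightarrow> dist_S H p x \<le> ereal r * dist_GrH H x p 0)"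
  shows "\<forall>e\<in>interior K. \<exists>zs ys. zs \<in> dual_cone K \<and> zs e = 1 \<and> bounded_linear ys \<and>
           (\<exists>a b. a \<in> limiting_subdiff (zs \<circ> g) (xb, pb) \<and> b \<in> coderiv H (xb, pb) 0 ys \<and>
                  (\<forall>w. a w + b w = 0))"
proof
  fix e assume e: "e \<in> interior K"
  define w0 where "w0 = (xb, pb)"
  obtain U W where UW: "open U" "xb \<in> U" "open W" "pb \<in> W"
    "\<And>x p. x \<in> U \<Longrightarrow> p \<in> W \<Longrightarrow> 0 \<in> H (x, p) \<Longrightarrow> g (x, p) - g (xb, pb) \<notin> uminus ` interior K"
    using locmin by blast
  obtain r N where r: "r > 0" and N: "open N" "(xb, pb) \<in> N"
    and calmN: "\<And>x p. (x, p) \<in> N \<Longrightarrow> dist_S H p x \<le> ereal r * dist_GrH H x p 0" using calm by blast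
  \<comment> \<open>The reference point competes with itself in the local optimality
    condition.\<close>
  have K0: "0 \<notin> interior K"
  proof
    assume "0 \<in> interior K"
    then have "g (xb, pb) - g (xb, pb) \<in> uminus ` interior K" by force
    then show False using UW(5)[of xb pb] UW(2,4) feas by blast
  qed
  obtain s l where l: "l \<ge> 0" and s: "sublin s" "\<And>z. s z \<le> l * norm z" "\<And>z. s z < 0 \<Longrightarrow> - z \<in> interior K"
      "\<And>z. z \<in> K \<Longrightarrow> s (- z) \<le> 0" "s e \<le> 1" "s (- e) \<le> - 1"
    using cone_gauge[OF K_convex K_cone e K0] by blast
  obtain \<rho>0 C where \<rho>0: "\<rho>0 > 0" and C: "C \<ge> 0"
    and lip0: "\<And>u v. u \<in> cball w0 \<rho>0 \<Longrightarrow> v \<in> cball w0 \<rho>0 \<Longrightarrow> norm (g u - g v) \<le> C * norm (u - v)"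
    using lipschitz_around_cball[of g w0] g_strict unfolding strictly_lipschitz_at_def w0_def by metis
  have "open (N \<inter> U \<times> W)" "w0 \<in> N \<inter> U \<times> W" using N UW by (auto simp: w0_def open_Times)
  then obtain \<rho>1 where \<rho>1: "\<rho>1 > 0" "ball w0 \<rho>1 \<subseteq> N \<inter> U \<times> W" using open_contains_ball by blast
  define \<rho> where "\<rho> = min \<rho>0 \<rho>1"
  have \<rho>: "\<rho> > 0" using \<rho>0 \<rho>1 by (simp add: \<rho>_def)
  have lip: "norm (g u - g v) \<le> C * norm (u - v)" if "u \<in> cball w0 \<rho>" "v \<in> cball w0 \<rho>" for u v
    using lip0 that by (simp add: \<rho>_def)
  have sub: "u \<in> N \<inter> U \<times> W" if "u \<in> ball w0 \<rho>" for u using \<rho>1(2) that by (auto simp: \<rho>_def)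
  define \<phi> where "\<phi> w = s (g w - g w0)" for w
  have slip: "\<bar>s y - s z\<bar> \<le> l * norm (y - z)" for y z
    using sublin_diff[OF s(1), of y z] sublin_diff[OF s(1), of z y] s(2)[of "y - z"] s(2)[of "z - y"]
    by (simp add: norm_minus_commute abs_le_iff)
  have \<phi>lip: "\<bar>\<phi> u - \<phi> v\<bar> \<le> l * C * norm (u - v)" if "u \<in> cball w0 \<rho>" "v \<in> cball w0 \<rho>" for u v
  proof -
    have "\<bar>\<phi> u - \<phi> v\<bar> \<le> l * norm (g u - g v)" using slip[of "g u - g w0" "g v - g w0"] by (simp add: \<phi>_def)
    also have "\<dots> \<le> l * (C * norm (u - v))" using lip[OF that] l by (intro mult_left_mono) auto
    finally show ?thesis by simp
  qed
  have \<phi>pos: "\<phi> u \<ge> 0" if "u \<in> ball w0 \<rho>" "0 \<in> H u" for u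
  proof (rule ccontr)
    assume "\<not> \<phi> u \<ge> 0"
    then have "- (g u - g w0) \<in> interior K" by (intro s(3)) (simp add: \<phi>_def)
    then have "g u - g w0 \<in> uminus ` interior K" by (metis image_eqI minus_minus)
    moreover obtain x p where "u = (x, p)" by (cases u)
    ultimately show False using UW(5)[of x p] sub[OF that(1)] that(2) by (auto simp: w0_def)
  qed
  have lC: "l * C \<ge> 0" using l C by simp
  have "\<exists>\<delta>>0. \<delta> \<le> \<rho> \<and> (\<forall>w v. norm (w - w0) < \<delta> \<longrightarrow> norm v < \<delta> \<longrightarrow> v \<in> H w \<longrightarrow> - (l * C * r * norm v) \<le> \<phi> w)"
  proof (rule exact_penalty[OF \<rho> lC r])
    show "\<bar>\<phi> u - \<phi> v\<bar> \<le> l * C * norm (u - v)" if "u \<in> ball w0 \<rho>" "v \<in> ball w0 \<rho>" for u v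
      by (rule \<phi>lip) (use that in auto)
    show "dist_S H p x \<le> ereal r * dist_GrH H x p 0" if "(x, p) \<in> ball w0 \<rho>" for x p
      using calmN sub[OF that] by blast
  qed (use \<phi>pos in auto)
  then obtain \<delta> where \<delta>: "\<delta> > 0" "\<delta> \<le> \<rho>"
    and pen: "\<And>w v. norm (w - w0) < \<delta> \<Longrightarrow> norm v < \<delta> \<Longrightarrow> v \<in> H w \<Longrightarrow> - (l * C * r * norm v) \<le> \<phi> w" by blast
  \<comment> \<open>\<open>g\<close> is known to be Lipschitz only near \<open>w0\<close>; over a
    closed ball there its graph is closed.\<close>
  define G where "G = {(u, z). u \<in> cball w0 \<rho> \<and> z = g u}"
  have cl: "closed (G \<times> graph_sv H)" unfolding G_def
    by (intro closed_Times H_closed closed_graph_cball[where C = C]) (use lip in blast)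
  \<comment> \<open>\<open>l * C\<close> is a Lipschitz constant of \<phi>: it prices the distance
    between the copies of \<open>w\<close> and, multiplied by the calmness constant
    \<open>r\<close>, the residual \<open>v\<close> of the inclusion.\<close>
  define S :: "(('x \<times> 'p) \<times> 'z) \<times> (('x \<times> 'p) \<times> 'y) \<Rightarrow> real" where
    "S h = s (snd (fst h)) + l * C * r * norm (snd (snd h)) + l * C * norm (fst (fst h) - fst (snd h))" for h
  have S: "sublin S"
    unfolding sublin_def
  proof (intro conjI allI impI)
    fix x y :: "(('x \<times> 'p) \<times> 'z) \<times> (('x \<times> 'p) \<times> 'y)"
    have "l * C * r * norm (snd (snd x) + snd (snd y)) \<le> l * C * r * (norm (snd (snd x)) + norm (snd (snd y)))"
      using lC r by (intro mult_left_mono norm_triangle_ineq) auto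
    moreover have "l * C * norm (fst (fst x) + fst (fst y) - (fst (snd x) + fst (snd y)))
        \<le> l * C * (norm (fst (fst x) - fst (snd x)) + norm (fst (fst y) - fst (snd y)))"
      using lC norm_triangle_ineq[of "fst (fst x) - fst (snd x)" "fst (fst y) - fst (snd y)"]
      by (intro mult_left_mono) (auto simp: algebra_simps)
    moreover have "s (snd (fst x) + snd (fst y)) \<le> s (snd (fst x)) + s (snd (fst y))" by (rule sublin_add[OF s(1)])
    ultimately show "S (x + y) \<le> S x + S y" unfolding S_def fst_add snd_add distrib_left by linarith
  next
    fix c :: real and x :: "(('x \<times> 'p) \<times> 'z) \<times> (('x \<times> 'p) \<times> 'y)" assume c: "c > 0"
    moreover have "norm (c *\<^sub>R fst (fst x) - c *\<^sub>R fst (snd x)) = \<bar>c\<bar> * norm (fst (fst x) - fst (snd x))"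
      by (simp flip: scaleR_diff_right)
    ultimately show "S (c *\<^sub>R x) = c * S x" using sublin_scale_pos[OF s(1) c] by (simp add: S_def algebra_simps)
  qed
  define M where "M = l + l * C * r + l * C * 2"
  have M: "M \<ge> 0" using l lC r by (simp add: M_def)
  have SM: "S h \<le> M * norm h" for h
  proof -
    have n: "norm (fst (fst h)) \<le> norm h" "norm (fst (snd h)) \<le> norm h" "norm (snd (fst h)) \<le> norm h" "norm (snd (snd h)) \<le> norm h"
      using norm_fst_le_norm[of h] norm_snd_le_norm[of h] norm_fst_le_norm[of "fst h"] norm_snd_le_norm[of "fst h"]
        norm_fst_le_norm[of "snd h"] norm_snd_le_norm[of "snd h"] by auto
    have "s (snd (fst h)) \<le> l * norm h" using s(2)[of "snd (fst h)"] mult_left_mono[OF n(3) l] by linarith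
    moreover have "l * C * r * norm (snd (snd h)) \<le> l * C * r * norm h" using n lC r by (intro mult_left_mono) auto
    moreover have "l * C * norm (fst (fst h) - fst (snd h)) \<le> l * C * (2 * norm h)"
      using n lC norm_triangle_ineq4[of "fst (fst h)" "fst (snd h)"] by (intro mult_left_mono) auto
    ultimately show ?thesis unfolding S_def M_def distrib_right by simp
  qed
  define xx where "xx = ((w0, g w0), (w0, 0::'y))"
  have xx: "xx \<in> G \<times> graph_sv H" using \<rho> feas by (simp add: xx_def G_def graph_sv_def w0_def)
  have comp: "norm (fst (fst x) - w0) \<le> norm (x - xx)" "norm (fst (snd x) - w0) \<le> norm (x - xx)" "norm (snd (snd x)) \<le> norm (x - xx)" for x
    using norm_fst_le_norm[of "x - xx"] norm_snd_le_norm[of "x - xx"] norm_fst_le_norm[of "fst (x - xx)"]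
      norm_fst_le_norm[of "snd (x - xx)"] norm_snd_le_norm[of "snd (x - xx)"] by (auto simp: xx_def)
  have loc: "\<forall>x\<in>G \<times> graph_sv H. norm (x - xx) < \<delta> \<longrightarrow> S (x - xx) \<ge> 0"
  proof (intro ballI impI)
    fix x assume x: "x \<in> G \<times> graph_sv H" "norm (x - xx) < \<delta>"
    obtain w z w' v where x4: "x = ((w, z), (w', v))" by (metis surj_pair)
    have m: "w \<in> cball w0 \<rho>" "z = g w" "v \<in> H w'" using x(1) by (auto simp: x4 G_def graph_sv_def)
    have n: "norm (w' - w0) < \<delta>" "norm v < \<delta>" using comp[of x] x(2) by (auto simp: x4)
    then have "w' \<in> cball w0 \<rho>" using \<delta>(2) by (simp add: dist_norm norm_minus_commute)
    then have "\<bar>\<phi> w - \<phi> w'\<bar> \<le> l * C * norm (w - w')" using \<phi>lip m(1) by blast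
    moreover have "- (l * C * r * norm v) \<le> \<phi> w'" using pen n m(3) by blast
    ultimately show "S (x - xx) \<ge> 0" by (simp add: S_def x4 xx_def m(2) \<phi>_def)
  qed
  have aspW: "asplund TYPE('x \<times> 'p)" by (intro asplund_prod asplX asplP)
  have aspE: "asplund TYPE((('x \<times> 'p) \<times> 'z) \<times> (('x \<times> 'p) \<times> 'y))" by (intro asplund_prod aspW asplZ asplY)
  \<comment> \<open>The bound \<open>\<rho>/2\<close> keeps the points inside the ball, where
    \<open>G\<close> coincides locally with the graph of \<open>g\<close>.\<close>
  define \<epsilon> where "\<epsilon> n = min (1 / real (Suc n)) (\<rho>/2)" for n
  have \<epsilon>: "\<epsilon> n > 0" "\<epsilon> n \<le> 1 / real (Suc n)" "\<epsilon> n < \<rho>" "\<epsilon> n \<le> 1" for n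
  proof -
    show "\<epsilon> n > 0" using \<rho> by (simp add: \<epsilon>_def)
    show 1: "\<epsilon> n \<le> 1 / real (Suc n)" unfolding \<epsilon>_def by (rule min.cobounded1)
    have "\<epsilon> n \<le> \<rho>/2" unfolding \<epsilon>_def by (rule min.cobounded2)
    then show "\<epsilon> n < \<rho>" using \<rho> by linarith
    have "1 / real (Suc n) \<le> 1" by simp
    then show "\<epsilon> n \<le> 1" using 1 by linarith
  qed
  have \<epsilon>0: "\<epsilon> \<longlonglongrightarrow> 0" by (rule tendsto_zero_below_inverse_Suc[OF \<epsilon>(1,2)])
  have "\<forall>n. \<exists>x b. x \<in> G \<times> graph_sv H \<and> norm (x - xx) < \<epsilon> n \<and> b \<in> frechet_normal (G \<times> graph_sv H) x \<and> (\<forall>h. - b h \<le> S h + \<epsilon> n * norm h)"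
    using fuzzy_minimum[OF aspE cl S M SM xx \<delta>(1) loc \<epsilon>(1)] by blast
  then obtain X b0 where X0: "\<And>n. X n \<in> G \<times> graph_sv H" "\<And>n. norm (X n - xx) < \<epsilon> n"
    and b0: "\<And>n. b0 n \<in> frechet_normal (G \<times> graph_sv H) (X n)" "\<And>n h. - b0 n h \<le> S h + \<epsilon> n * norm h" by metis
  have bl0: "bounded_linear (b0 n)" for n using b0(1)[of n] by (simp add: frechet_normal_def)
  have bnd0: "\<bar>b0 n h\<bar> \<le> (M + 1) * norm h" for n h
  proof -
    have "- b0 n h \<le> (M + 1) * norm h" for h
    proof -
      have "\<epsilon> n * norm h \<le> 1 * norm h" using \<epsilon>(4) by (intro mult_right_mono) auto
      then show ?thesis using b0(2)[of n h] SM[of h] unfolding distrib_right by linarith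
    qed
    from bounded_linear_below(2)[OF linear_compose_neg[OF bounded_linear.linear[OF bl0[of n]]] this, of h]
    show ?thesis by simp
  qed
  obtain \<sigma> where \<sigma>: "strict_mono \<sigma>" "\<And>h. convergent (\<lambda>n. b0 (\<sigma> n) h)"
    using asplund_pointwise_convergent_subseq[where f = b0, OF aspE bounded_linear.linear[OF bl0] bnd0] by blast
  define b where "b n = b0 (\<sigma> n)" for n
  define B where "B h = lim (\<lambda>n. b n h)" for h
  have blim: "(\<lambda>n. b n h) \<longlonglongrightarrow> B h" for h using \<sigma>(2)[of h] by (simp add: B_def b_def convergent_LIMSEQ_iff)
  have bl: "bounded_linear (b n)" and bnd: "\<bar>b n h\<bar> \<le> (M + 1) * norm h" for n h by (simp_all add: b_def bl0 bnd0)
  have Bl: "linear B" and Bb: "\<bar>B h\<bar> \<le> (M + 1) * norm h" for h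
    using weak_star_limit_bound[OF bounded_linear.linear[OF bl] bnd blim] by blast+
  have Bbl: "bounded_linear B" by (rule bounded_linear_below(1)[OF Bl]) (use Bb abs_le_D1 in blast)
  define x where "x n = X (\<sigma> n)" for n
  have \<epsilon>\<sigma>: "(\<lambda>n. \<epsilon> (\<sigma> n)) \<longlonglongrightarrow> 0" using LIMSEQ_subseq_LIMSEQ[OF \<epsilon>0 \<sigma>(1)] by (simp add: o_def)
  have "(\<lambda>n. x n - xx) \<longlonglongrightarrow> 0"
    by (rule Lim_null_comparison[OF always_eventually[OF allI[OF less_imp_le]] \<epsilon>\<sigma>]) (simp add: x_def X0(2))
  then have xlim: "x \<longlonglongrightarrow> xx" by (simp add: LIM_zero_iff)
  define w where "w n = fst (fst (x n))" for n
  have xm: "x n = ((w n, g (w n)), snd (x n))" "w n \<in> cball w0 \<rho>" "snd (x n) \<in> graph_sv H" for n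
    using X0(1)[of "\<sigma> n"] by (auto simp: x_def w_def G_def)
  have wn: "norm (w n - w0) < \<rho>" for n using comp(1)[of "x n"] X0(2)[of "\<sigma> n"] \<epsilon>(3)[of "\<sigma> n"] by (simp add: w_def x_def)
  have nb: "b n \<in> frechet_normal (G \<times> graph_sv H) ((w n, g (w n)), snd (x n))" for n
    using b0(1)[of "\<sigma> n"] xm(1)[of n] by (simp add: b_def x_def)
  have Gm: "(w n, g (w n)) \<in> G" for n using xm(2) by (simp add: G_def)
  note n1 = frechet_normal_prod(1)[OF nb Gm xm(3)] and n2 = frechet_normal_prod(2)[OF nb Gm xm(3)]
  \<comment> \<open>The properties of \<zeta> and the identity \<open>\<alpha> + \<beta> = 0\<close>
    are read off from this limit inequality at special vectors.\<close>
  have Bup: "- B h \<le> S h" for h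
  proof (rule LIMSEQ_le)
    show "(\<lambda>n. - b n h) \<longlonglongrightarrow> - B h" by (intro tendsto_minus blim)
    have "(\<lambda>n. S h + \<epsilon> (\<sigma> n) * norm h) \<longlonglongrightarrow> S h + 0 * norm h" by (intro tendsto_intros \<epsilon>\<sigma>)
    then show "(\<lambda>n. S h + \<epsilon> (\<sigma> n) * norm h) \<longlonglongrightarrow> S h" by simp
    show "\<exists>N. \<forall>n\<ge>N. - b n h \<le> S h + \<epsilon> (\<sigma> n) * norm h" using b0(2) by (auto simp: b_def)
  qed
  define \<zeta> where "\<zeta> z = - B ((0, z), 0)" for z
  define \<alpha> where "\<alpha> h = B ((h, 0), 0)" for h
  define \<beta> where "\<beta> h = B (0, (h, 0))" for h
  define ys where "ys v = - B (0, (0, v))" for v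
  have embed: "bounded_linear (\<lambda>z::'z. ((0::'x \<times> 'p, z), 0::('x \<times> 'p) \<times> 'y))" "bounded_linear (\<lambda>h::'x \<times> 'p. ((h, 0::'z), 0::('x \<times> 'p) \<times> 'y))"
    "bounded_linear (\<lambda>h::'x \<times> 'p. (0::('x \<times> 'p) \<times> 'z, (h, 0::'y)))" "bounded_linear (\<lambda>v::'y. (0::('x \<times> 'p) \<times> 'z, (0::'x \<times> 'p, v)))"
    "bounded_linear (\<lambda>k::('x \<times> 'p) \<times> 'y. (0::('x \<times> 'p) \<times> 'z, k))"
    by (intro bounded_linear_Pair bounded_linear_ident bounded_linear_zero)+
  have \<zeta>bl: "bounded_linear \<zeta>" unfolding \<zeta>_def by (intro bounded_linear_minus bounded_linear_compose[OF Bbl] embed)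
  have \<alpha>bl: "bounded_linear \<alpha>" and \<beta>bl: "bounded_linear \<beta>" unfolding \<alpha>_def \<beta>_def by (intro bounded_linear_compose[OF Bbl] embed)+
  have ysbl: "bounded_linear ys" unfolding ys_def by (intro bounded_linear_minus bounded_linear_compose[OF Bbl] embed)
  have \<zeta>s: "\<zeta> z \<le> s z" for z using Bup[of "((0, z), 0)"] by (simp add: \<zeta>_def S_def)
  have \<zeta>neg: "\<zeta> (- z) = - \<zeta> z" for z using linear_neg[OF bounded_linear.linear[OF \<zeta>bl]] by simp
  have "\<zeta> z \<ge> 0" if "z \<in> K" for z using \<zeta>s[of "- z"] s(4)[OF that] \<zeta>neg[of z] by linarith
  then have dual: "\<zeta> \<in> dual_cone K" using \<zeta>bl by (simp add: dual_cone_def)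
  have \<zeta>e: "\<zeta> e = 1" using \<zeta>s[of e] \<zeta>s[of "- e"] s(5,6) \<zeta>neg[of e] by linarith
  \<comment> \<open>\<open>S\<close> vanishes at \<open>((h, 0), (h, 0))\<close>; nonnegativity of a
    linear functional at both \<open>h\<close> and \<open>- h\<close> makes it zero.\<close>
  have zero: "\<alpha> h + \<beta> h = 0" for h
  proof -
    have "\<alpha> h + \<beta> h = B ((h, 0), (h, 0))" for h
      using linear_add[OF Bl, of "((h, 0), 0)" "(0, (h, 0))"] by (simp add: \<alpha>_def \<beta>_def)
    then have "- (\<alpha> h + \<beta> h) \<le> 0" for h using Bup[of "((h, 0), (h, 0))"] sublin_0[OF s(1)] by (simp add: S_def)
    from this[of h] this[of "- h"] show ?thesis
      using linear_neg[OF bounded_linear.linear[OF \<alpha>bl], of h] linear_neg[OF bounded_linear.linear[OF \<beta>bl], of h] by simp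
  qed
  have "(\<lambda>(u, v). \<beta> u - ys v) = (\<lambda>k. B (0, k))"
  proof
    fix k :: "('x \<times> 'p) \<times> 'y"
    show "(\<lambda>(u, v). \<beta> u - ys v) k = B (0, k)"
      using linear_add[OF Bl, of "(0, (fst k, 0))" "(0, (0, snd k))"] by (simp add: case_prod_beta \<beta>_def ys_def)
  qed
  moreover have "(\<lambda>k. B (0, k)) \<in> limiting_normal (graph_sv H) ((xb, pb), 0)"
    unfolding limiting_normal_def
  proof (intro CollectI conjI exI[of _ "\<lambda>n. snd (x n)"] exI[of _ "\<lambda>n k. b n (0, k)"] allI)
    show "bounded_linear (\<lambda>k. B (0, k))" by (rule bounded_linear_compose[OF Bbl embed(5)])
    show "(\<lambda>n. snd (x n)) \<longlonglongrightarrow> ((xb, pb), 0)" using tendsto_snd[OF xlim] by (simp add: xx_def w0_def)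
  qed (use xm(3) n2 blim in auto)
  ultimately have cod: "\<beta> \<in> coderiv H (xb, pb) 0 ys" using \<beta>bl by (simp add: coderiv_def)
  have "\<alpha> \<in> limiting_subdiff (\<zeta> \<circ> g) w0"
  proof (rule weak_star_limit_in_limiting_subdiff[where \<zeta>s = "\<lambda>n z. - b n ((0, z), 0)" and \<alpha>s = "\<lambda>n h. b n ((h, 0), 0)" and ws = w and B = "M + 1"])
    show "strictly_lipschitz_at g w0" using g_strict by (simp add: w0_def)
    show "linear (\<lambda>z. - b n ((0, z), 0))" for n
      by (intro bounded_linear.linear bounded_linear_minus bounded_linear_compose[OF bl] embed)
    show "\<bar>- b n ((0, z), 0)\<bar> \<le> (M + 1) * norm z" for n z using bnd[of n "((0, z), 0)"] by (simp add: norm_Pair)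
    show "(\<lambda>n. - b n ((0, z), 0)) \<longlonglongrightarrow> \<zeta> z" for z unfolding \<zeta>_def by (intro tendsto_minus blim)
    show "bounded_linear (\<lambda>h. b n ((h, 0), 0))" for n by (intro bounded_linear_compose[OF bl] embed)
    show "(\<lambda>n. b n ((h, 0), 0)) \<longlonglongrightarrow> \<alpha> h" for h unfolding \<alpha>_def by (rule blim)
    show "w \<longlonglongrightarrow> w0" using tendsto_fst[OF tendsto_fst[OF xlim]] by (simp add: w_def[abs_def] xx_def)
    fix n and \<tau> :: real assume \<tau>: "\<tau> > 0"
    \<comment> \<open>Normality of \<open>b n\<close> to the graph says that its \<open>w\<close>
      part is a Frechet subgradient at \<open>w n\<close> of \<open>g\<close> scalarised by minus
      its \<open>z\<close> part.\<close>
    have "\<exists>\<delta>>0. \<forall>v. norm (v - w n) < \<delta> \<longrightarrow> b n ((v - w n, g v - g (w n)), 0) \<le> \<tau> * norm (v - w n)"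
    proof (rule graph_normal_subgradient[where G = g, OF n1 _ _ _ C \<tau>])
      show "\<rho> - norm (w n - w0) > 0" using wn[of n] by simp
      fix v assume v: "norm (v - w n) < \<rho> - norm (w n - w0)"
      then have vb: "v \<in> cball w0 \<rho>" using norm_triangle_ineq[of "v - w n" "w n - w0"] by (simp add: dist_norm norm_minus_commute)
      then show "(v, g v) \<in> G" by (simp add: G_def)
      show "norm (g v - g (w n)) \<le> C * norm (v - w n)" using lip vb xm(2) by blast
    qed
    then obtain \<eta> where \<eta>: "\<eta> > 0" "\<And>v. norm (v - w n) < \<eta> \<Longrightarrow> b n ((v - w n, g v - g (w n)), 0) \<le> \<tau> * norm (v - w n)"
      by blast
    have split: "b n ((h, z), 0) = b n ((h, 0), 0) + b n ((0, z), 0)" for h z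
      using linear_add[OF bounded_linear.linear[OF bl], of n "((h, 0), 0)" "((0, z), 0)"] by simp
    have "b n ((u - w n, 0), 0) \<le> - b n ((0, g u - g (w n)), 0) + \<tau> * norm (u - w n)" if "norm (u - w n) < \<eta>" for u
      using \<eta>(2)[OF that] split[of "u - w n" "g u - g (w n)"] by linarith
    then show "\<exists>\<delta>>0. \<forall>u. norm (u - w n) < \<delta> \<longrightarrow>
        b n ((u - w n, 0), 0) \<le> - b n ((0, g u - g (w n)), 0) + \<tau> * norm (u - w n)"
      using \<eta>(1) by blast
  qed (use aspW M \<alpha>bl in auto)
  then show "\<exists>zs ys. zs \<in> dual_cone K \<and> zs e = 1 \<and> bounded_linear ys \<and>
           (\<exists>a b. a \<in> limiting_subdiff (zs \<circ> g) (xb, pb) \<and> b \<in> coderiv H (xb, pb) 0 ys \<and>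
                  (\<forall>w. a w + b w = 0))"
    using dual \<zeta>e ysbl cod zero unfolding w0_def by blast
qed

end
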